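(* The quantum query complexity of von Neumann entropy estimation is $\Omega\big(\frac{\sqrt{d}}{\sqrt{\varepsilon}}+\frac{\log(d)}{\varepsilon}\big)$.
   Context: Von Neumann entropy estimation: given an unknown $d$-dimensional quantum state $\rho$, estimate $\mathrm{S}(\rho) = -\tr(\rho\ln\rho)$ to within additive error $\varepsilon$ with success probability at least $2/3$. Query complexity is measured in the purified quantum query access model: the oracle is a unitary $U$ acting on subsystems $\mathsf{A}$ and $\mathsf{B}$ with $\rho = \tr_{\mathsf{B}}\big(U_{\mathsf{AB}}\, |0\rangle\langle 0|_{\mathsf{AB}}\, U_{\mathsf{AB}}^\dagger\big)$, and a query means one use of (controlled-)$U$ or (controlled-)$U^\dagger$. *)

theory Defs
  imports "Jordan_Normal_Form.Schur_Decomposition" "Jordan_Normal_Form.Char_Poly"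
begin

text \<open>Finite-dimensional quantum mechanics with complex matrices (Jordan_Normal_Form).
  Basis convention for tensor products: index (i,k) of C^a (x) C^b is i*b+k.\<close>

definition unitary_mat :: "complex mat \<Rightarrow> nat \<Rightarrow> bool" where
  "unitary_mat U n \<longleftrightarrow> U \<in> carrier_mat n n \<and> U * mat_adjoint U = 1\<^sub>m n \<and> mat_adjoint U * U = 1\<^sub>m n"

definition kron :: "complex mat \<Rightarrow> complex mat \<Rightarrow> complex mat" where
  "kron A B = mat (dim_row A * dim_row B) (dim_col A * dim_col B)
     (\<lambda>(i,j). A $$ (i div dim_row B, j div dim_col B) * B $$ (i mod dim_row B, j mod dim_col B))"

definition ptrace2 :: "nat \<Rightarrow> nat \<Rightarrow> complex mat \<Rightarrow> complex mat" where
  "ptrace2 d m M = mat d d (\<lambda>(i,j). \<Sum>k<m. M $$ (i*m+k, j*m+k))"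

definition proj0 :: "nat \<Rightarrow> complex mat" where
  "proj0 n = mat n n (\<lambda>(i,j). if i = 0 \<and> j = 0 then 1 else 0)"

definition proj1 :: "complex mat" where
  "proj1 = mat 2 2 (\<lambda>(i,j). if i = 1 \<and> j = 1 then 1 else 0)"

text \<open>The state prepared by the purified access oracle U on A (x) B, A = C^d, B = C^m:
  rho = tr_B (U |0><0| U^dagger).\<close>
definition oracle_state :: "nat \<Rightarrow> nat \<Rightarrow> complex mat \<Rightarrow> complex mat" where
  "oracle_state d m U = ptrace2 d m (U * proj0 (d*m) * mat_adjoint U)"

definition eigvals :: "complex mat \<Rightarrow> complex list" where
  "eigvals A = (SOME as. char_poly A = (\<Prod>a\<leftarrow>as. [:- a, 1:]) \<and> length as = dim_row A)"

text \<open>von Neumann entropy S(rho) = - tr(rho ln rho) = - sum of lambda ln lambda over the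
  eigenvalues lambda of rho (with 0 ln 0 = 0; note ln 0 = 0 in Isabelle).\<close>
definition vn_entropy :: "complex mat \<Rightarrow> real" where
  "vn_entropy \<rho> = - (\<Sum>a\<leftarrow>eigvals \<rho>. Re a * ln (Re a))"

text \<open>Query algorithm with T queries, working on C^2 (control) (x) C^k (workspace) (x) C^d (x) C^m
  (registers A and B). Query t applies controlled-U (or controlled-U^dagger when dg t),
  interleaved with arbitrary oracle-independent unitaries V 0, ..., V T; the initial state is
  |0>, and at the end the whole register is measured in the computational basis, outcome x
  producing the estimate est x.\<close>
definition ctrl_query :: "nat \<Rightarrow> complex mat \<Rightarrow> complex mat" where
  "ctrl_query k W = kron (proj0 2) (1\<^sub>m (k * dim_row W)) + kron proj1 (kron (1\<^sub>m k) W)"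

fun alg_state :: "nat \<Rightarrow> (nat \<Rightarrow> complex mat) \<Rightarrow> (nat \<Rightarrow> bool) \<Rightarrow> complex mat \<Rightarrow> nat \<Rightarrow> complex vec" where
  "alg_state k V dg U 0 = V 0 *\<^sub>v unit_vec (2 * k * dim_row U) 0"
| "alg_state k V dg U (Suc t) =
     V (Suc t) *\<^sub>v (ctrl_query k (if dg t then mat_adjoint U else U) *\<^sub>v alg_state k V dg U t)"

definition success_prob ::
  "nat \<Rightarrow> nat \<Rightarrow> (nat \<Rightarrow> complex mat) \<Rightarrow> (nat \<Rightarrow> bool) \<Rightarrow> (nat \<Rightarrow> real)
    \<Rightarrow> complex mat \<Rightarrow> real \<Rightarrow> real \<Rightarrow> real" where
  "success_prob T k V dg est U s \<epsilon> =
     (let \<psi> = alg_state k V dg U T in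
      \<Sum>x<dim_vec \<psi>. if \<bar>est x - s\<bar> \<le> \<epsilon> then (cmod (\<psi> $ x))\<^sup>2 else 0)"

text \<open>An algorithm (one circuit for each dimension m of register B, all with the same number T
  of queries) estimates the von Neumann entropy of d-dimensional states to additive error eps
  with success probability at least 2/3, for every purified query-access oracle.\<close>
definition entropy_estimator ::
  "nat \<Rightarrow> real \<Rightarrow> nat \<Rightarrow> (nat \<Rightarrow> nat) \<Rightarrow> (nat \<Rightarrow> nat \<Rightarrow> complex mat) \<Rightarrow> (nat \<Rightarrow> nat \<Rightarrow> bool)
     \<Rightarrow> (nat \<Rightarrow> nat \<Rightarrow> real) \<Rightarrow> bool" where
  "entropy_estimator d \<epsilon> T k V dg est \<longleftrightarrow>
     (\<forall>m \<ge> 1. k m \<ge> 1 \<and> (\<forall>t \<le> T. unitary_mat (V m t) (2 * k m * (d * m))) \<and>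
        (\<forall>U. unitary_mat U (d * m) \<longrightarrow>
           success_prob T (k m) (V m) (dg m) (est m) U (vn_entropy (oracle_state d m U)) \<epsilon> \<ge> 2/3))"

end

theory Submission
  imports Defs "HOL-Analysis.L2_Norm"
begin

text \<open>
  Both terms come from purifications on \<open>C\<^sup>d \<otimes> C\<^sup>d\<close>.

  The term \<open>ln d / \<epsilon>\<close> is a plain hybrid argument: moving the weight of the maximally mixed part
  from \<open>1/4\<close> to \<open>1/4 + 3\<epsilon> / ln d\<close> changes the entropy by at least \<open>3\<epsilon>\<close>, but the oracle only by
  \<open>O(\<epsilon> / ln d)\<close> in operator norm.

  For the term \<open>sqrt (d / \<epsilon>)\<close>, let \<open>H\<close> be a random symmetric matrix with entries \<open>\<plusminus>1/sqrt (d - 1)\<close>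
  off the diagonal and let the oracle prepare \<open>c \<Omega> + z s (H \<otimes> 1) \<Omega>\<close>, with \<open>\<Omega>\<close> maximally entangled,
  \<open>s\<^sup>2 = 4\<epsilon>\<close> and \<open>|z| = 1\<close>. The reduced state is \<open>(c + s H)\<^sup>2 / d\<close> for \<open>z = 1\<close> and
  \<open>(c\<^sup>2 + s\<^sup>2 H\<^sup>2) / d\<close> for \<open>z = \<i>\<close>; the entropy deficits are of order \<open>s\<^sup>2\<close> and \<open>s\<^sup>4\<close>. In the Walsh
  basis of the signs a query sends the label \<open>S\<close> to \<open>S\<close> with one edge added or removed. If every step
  out of the diagonal added an edge and every step back removed one, multiplying the component at \<open>S\<close>
  by \<open>z\<close> to the power \<open>|S|\<close> would carry \<open>z = 1\<close> to any other \<open>z\<close>, so that \<open>z\<close> would be undetectable on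
  average. The exceptional steps need an edge already in \<open>S\<close>; after \<open>t\<close> queries they have norm
  \<open>O(s sqrt t / d)\<close>. Hence \<open>T\<^sup>3 \<epsilon> \<ge> \<Omega>(d\<^sup>2)\<close>, which implies the claim when \<open>d \<epsilon> \<ge> 1\<close>; otherwise the other
  term dominates.
\<close>

section \<open>Walsh coefficients of query algorithms\<close>

text \<open>The oracles for \<open>z = 1\<close> and \<open>z = \<i>\<close> lie at operator
  distance of order \<open>s\<close>, so comparing them directly for fixed signs would give only
  \<open>T\<close> of order 1/sqrt \<epsilon>, with no dependence on \<open>d\<close>. The gain
  comes from averaging over the signs: by Parseval the averaged acceptance probability is a sum of
  squared moduli over labels, hence blind to any phase that depends on the label alone. To exploit
  this, every oracle is one fixed real matrix conjugated by a diagonal matrix of phases; the adjoint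
  then has the same shape, and randomness enters a query only through the two diagonal factors, each
  toggling at most one edge. After \<open>t\<close> queries a label holds at most
  \<open>2 * t\<close> edges, and an edge carries weight \<open>2 / (d * (d - 1))\<close> of the
  off-diagonal vector; this is where s * sqrt t / d comes from. Summed over the queries it gives s *
  T^(3/2) / d, which must be at least a constant. The values \<open>z = 1\<close> and
  \<open>z = \<i>\<close> are chosen because the term of the reduced state linear in H is
  proportional to Re z. That the remaining deficit is of order s^4 needs tr H^4 = O(d), which holds
  for most sign patterns.\<close>

definition sqnorm :: "nat \<Rightarrow> (nat \<Rightarrow> complex) \<Rightarrow> real" where
  "sqnorm n v = (\<Sum>i<n. (cmod (v i))\<^sup>2)"

definition mapp :: "nat \<Rightarrow> (nat \<Rightarrow> nat \<Rightarrow> complex) \<Rightarrow> (nat \<Rightarrow> complex) \<Rightarrow> nat \<Rightarrow> complex" where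
  "mapp n A v i = (\<Sum>j<n. A i j * v j)"

text \<open>For \<eta> \<ge> 0 this says that the operator norm is at most \<eta>; the squared form
  avoids square roots when bounds are added over blocks.\<close>

definition opbound :: "nat \<Rightarrow> (nat \<Rightarrow> nat \<Rightarrow> complex) \<Rightarrow> real \<Rightarrow> bool" where
  "opbound n A \<eta> \<longleftrightarrow> (\<forall>v. sqnorm n (mapp n A v) \<le> \<eta>\<^sup>2 * sqnorm n v)"

text \<open>The Hilbert space norm of the algorithm's register together with an extra register
  holding the Walsh label \<open>S\<close>.\<close>

definition joint_norm :: "'b set \<Rightarrow> nat \<Rightarrow> ('b set \<Rightarrow> nat \<Rightarrow> complex) \<Rightarrow> real" where
  "joint_norm P n F = sqrt (\<Sum>S\<in>Pow P. sqnorm n (F S))"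

definition shift :: "(nat \<Rightarrow> 'b set) \<Rightarrow> ('b set \<Rightarrow> nat \<Rightarrow> complex) \<Rightarrow> 'b set \<Rightarrow> nat \<Rightarrow> complex" where
  "shift J F S i = F (sym_diff S (J i)) i"

text \<open>The operator may depend on the label: the true queries do not, but their modified
  versions below do.\<close>

definition fibre :: "nat \<Rightarrow> ('b set \<Rightarrow> nat \<Rightarrow> nat \<Rightarrow> complex) \<Rightarrow> ('b set \<Rightarrow> nat \<Rightarrow> complex) \<Rightarrow> 'b set \<Rightarrow> nat \<Rightarrow> complex" where
  "fibre n A F S = mapp n (A S) (F S)"

lemma sqnorm_nonneg [simp]: "sqnorm n v \<ge> 0"
  by (simp add: sqnorm_def sum_nonneg)

lemma joint_norm_L2: "joint_norm P n F = L2_set (\<lambda>(S, i). cmod (F S i)) (Pow P \<times> {..<n})"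
  by (simp add: joint_norm_def sqnorm_def L2_set_def sum.cartesian_product case_prod_unfold)

lemma joint_norm_triangle:
  "joint_norm P n (\<lambda>S i. F S i + G S i) \<le> joint_norm P n F + joint_norm P n G"
proof -
  have "joint_norm P n (\<lambda>S i. F S i + G S i)
      \<le> L2_set (\<lambda>p. (case p of (S, i) \<Rightarrow> cmod (F S i)) + (case p of (S, i) \<Rightarrow> cmod (G S i))) (Pow P \<times> {..<n})"
    unfolding joint_norm_L2 by (intro L2_set_mono) (auto simp: norm_triangle_ineq)
  also have "\<dots> \<le> joint_norm P n F + joint_norm P n G"
    unfolding joint_norm_L2 by (rule L2_set_triangle_ineq)
  finally show ?thesis .
qed

text \<open>A norm bound is asked only for labels of size at most \<open>m\<close>, the only ones
  with weight. Through this the number of earlier queries enters the error of a query.\<close>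

lemma joint_norm_fibre:
  assumes "\<And>S. S \<subseteq> P \<Longrightarrow> card S \<le> m \<Longrightarrow> opbound n (A S) \<eta>"
    and "\<And>S i. S \<subseteq> P \<Longrightarrow> card S > m \<Longrightarrow> F S i = 0" and "\<eta> \<ge> 0"
  shows "joint_norm P n (fibre n A F) \<le> \<eta> * joint_norm P n F"
proof -
  have "sqnorm n (fibre n A F S) \<le> \<eta>\<^sup>2 * sqnorm n (F S)" if "S \<subseteq> P" for S
  proof (cases "card S \<le> m")
    case True
    then show ?thesis using assms(1)[OF that] by (simp add: fibre_def opbound_def)
  next
    case False
    then have "F S = (\<lambda>i. 0)" using assms(2)[OF that] by auto
    then show ?thesis by (simp add: fibre_def mapp_def sqnorm_def)
  qed
  then have "(\<Sum>S\<in>Pow P. sqnorm n (fibre n A F S)) \<le> (\<Sum>S\<in>Pow P. \<eta>\<^sup>2 * sqnorm n (F S))"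
    by (intro sum_mono) auto
  then have "joint_norm P n (fibre n A F) \<le> sqrt (\<eta>\<^sup>2 * (\<Sum>S\<in>Pow P. sqnorm n (F S)))"
    unfolding joint_norm_def by (simp add: sum_distrib_left)
  also have "\<dots> = \<eta> * joint_norm P n F"
    using assms(3) by (simp add: joint_norm_def real_sqrt_mult)
  finally show ?thesis .
qed

lemma joint_norm_fibre_contraction:
  assumes "\<And>S. S \<subseteq> P \<Longrightarrow> opbound n (A S) 1" "finite P"
  shows "joint_norm P n (fibre n A F) \<le> joint_norm P n F"
  using joint_norm_fibre[of P "card P" n A 1 F] assms card_mono[of P] by (auto simp: leD)

lemma bij_betw_sym_diff: "A \<subseteq> P \<Longrightarrow> bij_betw (\<lambda>S. sym_diff S A) (Pow P) (Pow P)"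
  by (rule bij_betw_byWitness[where f' = "\<lambda>S. sym_diff S A"]) auto

text \<open>At each fixed coordinate the shift permutes the labels.\<close>

lemma joint_norm_shift:
  assumes "\<And>i. J i \<subseteq> P"
  shows "joint_norm P n (shift J F) = joint_norm P n F"
proof -
  have "(\<Sum>S\<in>Pow P. (cmod (F (sym_diff S (J i)) i))\<^sup>2) = (\<Sum>S\<in>Pow P. (cmod (F S i))\<^sup>2)" for i
    using sum.reindex_bij_betw[OF bij_betw_sym_diff[OF assms], where g = "\<lambda>S. (cmod (F S i))\<^sup>2"] by simp
  then show ?thesis
    unfolding joint_norm_def sqnorm_def shift_def by (subst (1 2) sum.swap) simp
qed

lemma mapp_diff: "mapp n A (\<lambda>i. v i - w i) i = mapp n A v i - mapp n A w i"
  by (simp add: mapp_def right_diff_distrib sum_subtractf)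

lemma mapp_diff_left: "mapp n (\<lambda>i j. A i j - B i j) v i = mapp n A v i - mapp n B v i"
  by (simp add: mapp_def left_diff_distrib sum_subtractf)

text \<open>Walsh coefficients of \<open>evolution\<close> below, as a function of the signs: \<open>shift\<close> is multiplication
  by the sign attached to a coordinate.\<close>
fun joint_evolution ::
  "nat \<Rightarrow> (nat \<Rightarrow> 'b set) \<Rightarrow> (nat \<Rightarrow> nat \<Rightarrow> nat \<Rightarrow> complex)
     \<Rightarrow> (nat \<Rightarrow> 'b set \<Rightarrow> nat \<Rightarrow> nat \<Rightarrow> complex) \<Rightarrow> (nat \<Rightarrow> complex) \<Rightarrow> nat \<Rightarrow> 'b set \<Rightarrow> nat \<Rightarrow> complex" where
  "joint_evolution n J L C v 0 = (\<lambda>S i. if S = {} then v i else 0)"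
| "joint_evolution n J L C v (Suc t) =
     fibre n (\<lambda>_. L t) (shift J (fibre n (C t) (shift J (joint_evolution n J L C v t))))"

lemma joint_norm_initial:
  assumes "finite P"
  shows "joint_norm P n (joint_evolution n J L C v 0) = sqrt (sqnorm n v)"
proof -
  have "(\<Sum>S\<in>Pow P. sqnorm n (joint_evolution n J L C v 0 S)) = (\<Sum>S\<in>Pow P. if S = {} then sqnorm n v else 0)"
    by (intro sum.cong) (auto simp: sqnorm_def)
  also have "\<dots> = sqnorm n v" using assms by (subst sum.delta) auto
  finally show ?thesis by (simp add: joint_norm_def)
qed

lemma joint_norm_evolution:
  assumes "finite P" "\<And>i. J i \<subseteq> P" "\<And>t. t < T \<Longrightarrow> opbound n (L t) 1"
    and "\<And>t S. t < T \<Longrightarrow> S \<subseteq> P \<Longrightarrow> opbound n (C t S) 1"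
  shows "t \<le> T \<Longrightarrow> joint_norm P n (joint_evolution n J L C v t) \<le> sqrt (sqnorm n v)"
proof (induction t)
  case 0
  then show ?case using joint_norm_initial[OF assms(1)] by simp
next
  case (Suc t)
  have "joint_norm P n (joint_evolution n J L C v (Suc t))
      \<le> joint_norm P n (fibre n (C t) (shift J (joint_evolution n J L C v t)))"
    using joint_norm_fibre_contraction[of P n "\<lambda>_. L t" "shift J (fibre n (C t) (shift J (joint_evolution n J L C v t)))"] assms Suc.prems
    by (simp add: joint_norm_shift[OF assms(2)])
  also have "\<dots> \<le> joint_norm P n (joint_evolution n J L C v t)"
    using joint_norm_fibre_contraction[of P n "C t" "shift J (joint_evolution n J L C v t)"] assms Suc.prems
    by (simp add: joint_norm_shift[OF assms(2)])
  finally show ?case using Suc by simp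
qed

lemma sym_diff_card_le: "finite S \<Longrightarrow> finite A \<Longrightarrow> card S \<le> card (sym_diff S A) + card A"
proof -
  assume "finite S" "finite A"
  then have "card S \<le> card (sym_diff S A \<union> A)"
    by (intro card_mono) auto
  also have "\<dots> \<le> card (sym_diff S A) + card A" by (rule card_Un_le)
  finally show ?thesis .
qed

lemma shift_eq_0:
  assumes "finite P" "\<And>i. J i \<subseteq> P" "\<And>i. card (J i) \<le> 1"
    and "\<And>S i. S \<subseteq> P \<Longrightarrow> card S > m \<Longrightarrow> F S i = 0" and "S \<subseteq> P" "card S > Suc m"
  shows "shift J F S i = 0"
proof -
  have "sym_diff S (J i) \<subseteq> P" using assms by auto
  moreover have "card S \<le> card (sym_diff S (J i)) + card (J i)"
    using assms by (intro sym_diff_card_le) (auto intro: finite_subset)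
  then have "card (sym_diff S (J i)) > m" using assms(3)[of i] assms(6) by linarith
  ultimately show ?thesis using assms(4) by (simp add: shift_def)
qed

text \<open>A query contains two shifts, and each changes the size of the label by at most
  one.\<close>

lemma joint_evolution_support:
  assumes "finite P" "\<And>i. J i \<subseteq> P" "\<And>i. card (J i) \<le> 1"
  shows "S \<subseteq> P \<Longrightarrow> card S > 2 * t \<Longrightarrow> joint_evolution n J L C v t S i = 0"
proof (induction t arbitrary: S i)
  case 0
  then show ?case by auto
next
  case (Suc t)
  let ?F = "fibre n (C t) (shift J (joint_evolution n J L C v t))"
  have "shift J (joint_evolution n J L C v t) S i = 0" if "S \<subseteq> P" "card S > Suc (2 * t)" for S i
    by (rule shift_eq_0[OF assms, where m = "2 * t" and F = "joint_evolution n J L C v t"]) (use Suc.IH that in auto)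
  then have "?F S i = 0" if "S \<subseteq> P" "card S > Suc (2 * t)" for S i
    using that by (simp add: fibre_def mapp_def)
  then have "shift J ?F S i = 0" for i
    using shift_eq_0[OF assms, where m = "Suc (2 * t)" and F = ?F] Suc.prems by simp
  then show ?case by (simp add: fibre_def mapp_def)
qed

text \<open>Hybrid argument on the joint space. \<open>C t\<close> acts after the first of the two
  shifts of its query, so the labels it meets have size at most \<open>2 * t + 1\<close>; only there
  must \<open>C t\<close> and \<open>C' t\<close> be close.\<close>

lemma joint_evolution_perturb:
  assumes P: "finite P" "\<And>i. J i \<subseteq> P" "\<And>i. card (J i) \<le> 1"
    and L: "\<And>t. t < T \<Longrightarrow> opbound n (L t) 1"
    and C: "\<And>t S. t < T \<Longrightarrow> S \<subseteq> P \<Longrightarrow> opbound n (C t S) 1"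
    and C': "\<And>t S. t < T \<Longrightarrow> S \<subseteq> P \<Longrightarrow> opbound n (C' t S) 1"
    and d: "\<And>t S. t < T \<Longrightarrow> S \<subseteq> P \<Longrightarrow> card S \<le> 2 * t + 1 \<Longrightarrow> opbound n (\<lambda>i j. C t S i j - C' t S i j) (\<eta> t)"
    and "\<And>t. \<eta> t \<ge> 0" and v: "sqnorm n v \<le> 1"
  shows "t \<le> T \<Longrightarrow> joint_norm P n (\<lambda>S i. joint_evolution n J L C v t S i - joint_evolution n J L C' v t S i)
    \<le> (\<Sum>u<t. \<eta> u)"
proof (induction t)
  case 0
  then show ?case by (simp add: joint_norm_def sqnorm_def)
next
  case (Suc t)
  let ?F = "joint_evolution n J L C v t" and ?G = "joint_evolution n J L C' v t"
  let ?D = "\<lambda>S i. ?F S i - ?G S i"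
  \<comment> \<open>The new difference is \<open>C t\<close> applied to the old difference, plus
    \<open>C t - C' t\<close> applied to the second evolution, whose norm is at most 1.\<close>
  let ?H = "\<lambda>S i. fibre n (C t) (shift J ?D) S i
      + fibre n (\<lambda>S i j. C t S i j - C' t S i j) (shift J ?G) S i"
  have t: "t < T" using Suc.prems by simp
  have "(\<lambda>S i. joint_evolution n J L C v (Suc t) S i - joint_evolution n J L C' v (Suc t) S i)
      = fibre n (\<lambda>_. L t) (shift J ?H)"
  proof (intro ext)
    fix S i
    let ?FC = "fibre n (C t) (shift J ?F)" and ?GC = "fibre n (C' t) (shift J ?G)"
    have D: "shift J ?D S = (\<lambda>i. shift J ?F S i - shift J ?G S i)" for S
      by (simp add: shift_def fun_eq_iff)
    have "?H S i = ?FC S i - ?GC S i" for S i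
      by (simp add: fibre_def D mapp_diff mapp_diff_left)
    then have "shift J ?H S = (\<lambda>i. shift J ?FC S i - shift J ?GC S i)"
      by (simp add: shift_def fun_eq_iff)
    then show "joint_evolution n J L C v (Suc t) S i - joint_evolution n J L C' v (Suc t) S i
        = fibre n (\<lambda>_. L t) (shift J ?H) S i"
      by (simp add: fibre_def mapp_diff)
  qed
  then have "joint_norm P n (\<lambda>S i. joint_evolution n J L C v (Suc t) S i - joint_evolution n J L C' v (Suc t) S i)
      \<le> joint_norm P n ?H"
    using joint_norm_fibre_contraction[of P n "\<lambda>_. L t" "shift J ?H"] L[OF t] P
    by (simp add: joint_norm_shift[OF P(2)])
  also have "\<dots> \<le> joint_norm P n (fibre n (C t) (shift J ?D))
      + joint_norm P n (fibre n (\<lambda>S i j. C t S i j - C' t S i j) (shift J ?G))"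
    by (rule joint_norm_triangle)
  also have "joint_norm P n (fibre n (C t) (shift J ?D)) \<le> joint_norm P n ?D"
    using joint_norm_fibre_contraction[of P n "C t" "shift J ?D"] C[OF t] P
    by (simp add: joint_norm_shift[OF P(2)])
  also have "joint_norm P n ?D \<le> (\<Sum>u<t. \<eta> u)" using Suc by simp
  also have "joint_norm P n (fibre n (\<lambda>S i j. C t S i j - C' t S i j) (shift J ?G))
      \<le> \<eta> t * joint_norm P n (shift J ?G)"
  proof (rule joint_norm_fibre)
    show "shift J ?G S i = 0" if "S \<subseteq> P" "card S > 2 * t + 1" for S i
      using shift_eq_0[OF P, where m = "2 * t" and F = ?G] joint_evolution_support[OF P] that by simp
  qed (use d t assms in auto)
  also have "\<dots> \<le> \<eta> t * 1"
  proof (rule mult_left_mono)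
    have "joint_norm P n ?G \<le> sqrt (sqnorm n v)"
      using joint_norm_evolution[of P J T n L C' t v] P L C' t by simp
    then show "joint_norm P n (shift J ?G) \<le> 1"
      using v by (simp add: joint_norm_shift[OF P(2)]) (meson order_trans real_sqrt_le_1_iff)
  qed (use assms in auto)
  finally show ?case by simp
qed

text \<open>The coordinates at which \<open>shift\<close> lowers the size of the label instead of raising it.\<close>
definition charged :: "(nat \<Rightarrow> 'b set) \<Rightarrow> 'b set \<Rightarrow> nat \<Rightarrow> bool" where
  "charged J S i \<longleftrightarrow> J i \<noteq> {} \<and> J i \<subseteq> S"

text \<open>A query with its exceptional transitions cut out: the identity on the coordinates marked
  by \<open>b\<close>, and the compression of \<open>C\<close> on the others.\<close>

definition masked :: "(nat \<Rightarrow> bool) \<Rightarrow> (nat \<Rightarrow> nat \<Rightarrow> complex) \<Rightarrow> nat \<Rightarrow> nat \<Rightarrow> complex" where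
  "masked b C i j = (if b i \<or> b j then of_bool (i = j) else C i j)"

text \<open>Masking alters both rows and columns. The first clause controls the marked rows of C -
  1, the second its marked columns.\<close>

definition almost_fixes :: "nat \<Rightarrow> (nat \<Rightarrow> bool) \<Rightarrow> (nat \<Rightarrow> nat \<Rightarrow> complex) \<Rightarrow> real \<Rightarrow> bool" where
  "almost_fixes n b C \<eta> \<longleftrightarrow>
     (\<forall>v::nat \<Rightarrow> complex. (\<Sum>i | i < n \<and> b i. (cmod (mapp n C v i - v i))\<^sup>2) \<le> \<eta>\<^sup>2 * sqnorm n v) \<and>
     (\<forall>v::nat \<Rightarrow> complex. (\<forall>i<n. \<not> b i \<longrightarrow> v i = 0) \<longrightarrow> sqnorm n (\<lambda>i. mapp n C v i - v i) \<le> \<eta>\<^sup>2 * sqnorm n v)"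

lemma sqnorm_split:
  "sqnorm n v = (\<Sum>i | i < n \<and> b i. (cmod (v i))\<^sup>2) + (\<Sum>i | i < n \<and> \<not> b i. (cmod (v i))\<^sup>2)"
  unfolding sqnorm_def by (subst sum.union_disjoint[symmetric]) (auto intro!: sum.cong)

lemma mapp_masked:
  assumes "i < n"
  shows "mapp n (masked b C) v i = (if b i then v i else mapp n C (\<lambda>j. if b j then 0 else v j) i)"
proof (cases "b i")
  case True
  then have "mapp n (masked b C) v i = (\<Sum>j<n. if i = j then v j else 0)"
    unfolding mapp_def masked_def by (intro sum.cong) auto
  then show ?thesis using True assms by simp
next
  case False
  then have "mapp n (masked b C) v i = mapp n C (\<lambda>j. if b j then 0 else v j) i"
    unfolding mapp_def masked_def by (intro sum.cong) auto
  then show ?thesis using False by simp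
qed

text \<open>An orthogonal direct sum of an identity and a compression of a contraction.\<close>

lemma opbound_masked:
  assumes "opbound n C 1"
  shows "opbound n (masked b C) 1"
  unfolding opbound_def
proof
  fix v :: "nat \<Rightarrow> complex"
  let ?w = "\<lambda>j. if b j then 0 else v j"
  have "sqnorm n (mapp n (masked b C) v)
      = (\<Sum>i | i < n \<and> b i. (cmod (v i))\<^sup>2) + (\<Sum>i | i < n \<and> \<not> b i. (cmod (mapp n C ?w i))\<^sup>2)"
    unfolding sqnorm_split[of n _ b] by (simp add: mapp_masked cong: sum.cong_simp)
  also have "(\<Sum>i | i < n \<and> \<not> b i. (cmod (mapp n C ?w i))\<^sup>2) \<le> sqnorm n (mapp n C ?w)"
    unfolding sqnorm_def by (intro sum_mono2) auto
  also have "\<dots> \<le> sqnorm n ?w" using assms by (simp add: opbound_def)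
  also have "\<dots> = (\<Sum>i | i < n \<and> \<not> b i. (cmod (v i))\<^sup>2)"
    unfolding sqnorm_split[of n _ b] by (simp cong: sum.cong_simp)
  finally show "sqnorm n (mapp n (masked b C) v) \<le> 1\<^sup>2 * sqnorm n v"
    unfolding sqnorm_split[of n v b] by simp
qed

text \<open>Marked rows of the output contribute \<eta>^2, and marked inputs reaching unmarked rows
  contribute another \<eta>^2; hence the factor \<open>sqrt 2\<close>.\<close>

lemma opbound_diff_masked:
  assumes "almost_fixes n b C \<eta>"
  shows "opbound n (\<lambda>i j. C i j - masked b C i j) (sqrt 2 * \<eta>)"
  unfolding opbound_def
proof
  fix v :: "nat \<Rightarrow> complex"
  let ?w = "\<lambda>j. if b j then 0 else v j" and ?u = "\<lambda>j. if b j then v j else 0"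
  have "mapp n C v i - mapp n C ?w i = mapp n C ?u i" for i
    unfolding mapp_diff[symmetric] by (rule arg_cong[where f = "\<lambda>x. mapp n C x i"]) auto
  then have "sqnorm n (mapp n (\<lambda>i j. C i j - masked b C i j) v)
     = (\<Sum>i | i < n \<and> b i. (cmod (mapp n C v i - v i))\<^sup>2) + (\<Sum>i | i < n \<and> \<not> b i. (cmod (mapp n C ?u i - ?u i))\<^sup>2)"
    unfolding sqnorm_split[of n _ b] mapp_diff_left by (simp add: mapp_masked cong: sum.cong_simp)
  moreover have "(\<Sum>i | i < n \<and> \<not> b i. (cmod (mapp n C ?u i - ?u i))\<^sup>2) \<le> sqnorm n (\<lambda>i. mapp n C ?u i - ?u i)"
    unfolding sqnorm_def by (intro sum_mono2) auto
  moreover have "sqnorm n (\<lambda>i. mapp n C ?u i - ?u i) \<le> \<eta>\<^sup>2 * sqnorm n ?u"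
    using assms by (simp add: almost_fixes_def)
  moreover have "\<eta>\<^sup>2 * sqnorm n ?u \<le> \<eta>\<^sup>2 * sqnorm n v"
    unfolding sqnorm_def by (intro mult_left_mono sum_mono) auto
  moreover have "(\<Sum>i | i < n \<and> b i. (cmod (mapp n C v i - v i))\<^sup>2) \<le> \<eta>\<^sup>2 * sqnorm n v"
    using assms by (simp add: almost_fixes_def)
  ultimately have "sqnorm n (mapp n (\<lambda>i j. C i j - masked b C i j) v) \<le> 2 * (\<eta>\<^sup>2 * sqnorm n v)"
    by linarith
  then show "sqnorm n (mapp n (\<lambda>i j. C i j - masked b C i j) v) \<le> (sqrt 2 * \<eta>)\<^sup>2 * sqnorm n v"
    by (simp add: power_mult_distrib mult.assoc)
qed

section \<open>Conjugation by phases and its effect on masked evolutions\<close>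

definition gauge :: "(nat \<Rightarrow> complex) \<Rightarrow> (nat \<Rightarrow> nat \<Rightarrow> complex) \<Rightarrow> nat \<Rightarrow> nat \<Rightarrow> complex" where
  "gauge \<zeta> C i j = \<zeta> i * C i j * cnj (\<zeta> j)"

lemma card_sym_diff_uncharged:
  assumes "finite S" "\<not> charged J S i" "card (J i) \<le> 1" "finite (J i)"
  shows "card (sym_diff S (J i)) = card S + card (J i)"
proof -
  have "J i \<inter> S = {}"
  proof (cases "J i = {}")
    case False
    then have "card (J i) = 1" using assms by (metis One_nat_def Suc_leI card_gt_0_iff le_antisym)
    then obtain x where "J i = {x}" by (rule card_1_singletonE)
    then show ?thesis using assms(2) by (auto simp: charged_def)
  qed simp
  then have "sym_diff S (J i) = S \<union> J i" and "S \<inter> J i = {}" by auto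
  then show ?thesis using assms by (simp add: card_Un_disjoint)
qed

lemma sym_diff_cancel: "sym_diff (sym_diff S A) A = S"
  by auto

text \<open>Between uncharged coordinates the labels before and after are disjoint unions of
  \<open>S\<close> with \<open>J j\<close> and \<open>J i\<close>, so the phase
  \<open>z ^ card (J j)\<close> cancels against its conjugate in the gauge factor and
  \<open>z ^ card (J i)\<close> completes the new label. On charged coordinates the mask leaves only
  the diagonal, where label and phase stay the same.\<close>

lemma mapp_gauge_masked:
  assumes "cmod z = 1" "finite S" "\<And>i. card (J i) \<le> 1" "\<And>i. finite (J i)" "i < n"
    and F: "\<And>S i. finite S \<Longrightarrow> F' S i = z ^ card S * F S i"
  shows "mapp n (masked (charged J S) (gauge (\<lambda>i. z ^ card (J i)) C)) (shift J F' S) i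
    = z ^ card (sym_diff S (J i)) * mapp n (masked (charged J S) C) (shift J F S) i"
proof -
  have z: "z ^ m * cnj (z ^ m) = 1" for m
    using assms(1) by (metis complex_norm_square norm_power of_real_1 one_power2 power_one)
  have "masked (charged J S) (gauge (\<lambda>i. z ^ card (J i)) C) i j * z ^ card (sym_diff S (J j))
      = z ^ card (sym_diff S (J i)) * masked (charged J S) C i j" if "j < n" for j
  proof (cases "charged J S i \<or> charged J S j")
    case False
    then have "card (sym_diff S (J j)) = card S + card (J j)" "card (sym_diff S (J i)) = card S + card (J i)"
      using assms card_sym_diff_uncharged by blast+
    then show ?thesis using False z[of "card (J j)"]
      by (simp add: masked_def gauge_def power_add algebra_simps)
  qed (simp add: masked_def)
  then show ?thesis
    unfolding mapp_def shift_def sum_distrib_left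
    by (intro sum.cong) (use assms in \<open>auto simp: mult.assoc[symmetric]\<close>)
qed

text \<open>Multiplication by \<open>z ^ card S\<close> intertwines the two masked evolutions
  exactly. They start at the label \<open>{}\<close>, where this phase is 1.\<close>

lemma joint_evolution_gauge:
  assumes "cmod z = 1" "\<And>i. card (J i) \<le> 1" "\<And>i. finite (J i)"
  shows "finite S \<Longrightarrow> i < n \<Longrightarrow>
    joint_evolution n J L (\<lambda>t S. masked (charged J S) (gauge (\<lambda>i. z ^ card (J i)) (C t))) v t S i
     = z ^ card S * joint_evolution n J L (\<lambda>t S. masked (charged J S) (C t)) v t S i"
proof (induction t arbitrary: S i)
  case 0
  then show ?case by simp
next
  case (Suc t)
  let ?F = "joint_evolution n J L (\<lambda>t S. masked (charged J S) (C t)) v t"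
  \<comment> \<open>The induction hypothesis covers \<open>i < n\<close>, while
    \<open>mapp_gauge_masked\<close> wants the relation at every index; the values chosen beyond
    \<open>n\<close> never enter \<open>mapp\<close>.\<close>
  let ?F' = "\<lambda>S i. if i < n then joint_evolution n J L (\<lambda>t S. masked (charged J S) (gauge (\<lambda>i. z ^ card (J i)) (C t))) v t S i
     else z ^ card S * ?F S i"
  let ?X = "\<lambda>C F. fibre n (\<lambda>S. masked (charged J S) C) (shift J F)"
  let ?G = "gauge (\<lambda>i. z ^ card (J i)) (C t)"
  have F': "?F' S i = z ^ card S * ?F S i" if "finite S" for S i
    using Suc.IH[OF that] by simp
  have "?X ?G ?F' S i = z ^ card (sym_diff S (J i)) * ?X (C t) ?F S i" if "finite S" "i < n" for S i
    unfolding fibre_def using mapp_gauge_masked[OF assms(1) that(1) assms(2,3) that(2) F'] .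
  then have "shift J (?X ?G ?F') S i = z ^ card S * shift J (?X (C t) ?F) S i" if "i < n" for i
    using Suc.prems that assms(3) by (simp add: shift_def sym_diff_cancel)
  then have "fibre n (\<lambda>_. L t) (shift J (?X ?G ?F')) S i = z ^ card S * fibre n (\<lambda>_. L t) (shift J (?X (C t) ?F)) S i"
    by (simp add: fibre_def mapp_def sum_distrib_left mult.left_commute)
  moreover have "?X ?G ?F' = ?X ?G (joint_evolution n J L (\<lambda>t S. masked (charged J S) (gauge (\<lambda>i. z ^ card (J i)) (C t))) v t)"
    by (intro ext) (simp add: fibre_def mapp_def shift_def)
  ultimately show ?case by simp
qed

section \<open>Walsh characters and Parseval's identity\<close>

definition walsh :: "'b set \<Rightarrow> 'b set \<Rightarrow> complex" where
  "walsh S Y = (-1) ^ card (S \<inter> Y)"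

text \<open>\<open>Y\<close> is the set of edges whose sign is -1, and \<open>walsh S Y\<close> is
  the product of the signs over \<open>S\<close>: a character of the group of edge sets under
  symmetric difference.\<close>

lemma walsh_sym_diff:
  assumes "finite S" "finite A"
  shows "walsh (sym_diff S A) Y = walsh S Y * walsh A Y"
proof -
  have "card (S \<inter> Y) = card ((S - A) \<inter> Y) + card (S \<inter> A \<inter> Y)"
    using assms by (subst card_Un_disjoint[symmetric]) (auto intro: arg_cong[where f = card])
  moreover have "card (A \<inter> Y) = card ((A - S) \<inter> Y) + card (S \<inter> A \<inter> Y)"
    using assms by (subst card_Un_disjoint[symmetric]) (auto intro: arg_cong[where f = card])
  moreover have "card (sym_diff S A \<inter> Y) = card ((S - A) \<inter> Y) + card ((A - S) \<inter> Y)"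
    using assms by (subst card_Un_disjoint[symmetric]) (auto intro: arg_cong[where f = card])
  ultimately show ?thesis
    by (simp add: walsh_def power_add minus_one_power_iff)
qed

lemma walsh_square [simp]: "walsh S Y * walsh S Y = 1" "cnj (walsh S Y) = walsh S Y" "cmod (walsh S Y) = 1"
  by (simp_all add: walsh_def power_mult_distrib[symmetric] norm_power)

text \<open>Toggling an element \<open>x\<close> of \<open>S\<close> in \<open>Y\<close> permutes
  the summation range and negates every term.\<close>

lemma sum_walsh:
  assumes "finite P" "S \<subseteq> P"
  shows "(\<Sum>Y\<in>Pow P. walsh S Y) = (if S = {} then 2 ^ card P else 0)"
proof (cases "S = {}")
  case True
  then show ?thesis using assms by (simp add: walsh_def card_Pow)
next
  case False
  then obtain x where x: "x \<in> S" by auto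
  have "walsh S (sym_diff Y {x}) = - walsh S Y" for Y
  proof -
    have S: "finite S" using assms finite_subset by auto
    have "walsh S (sym_diff Y {x}) = walsh (sym_diff (S \<inter> Y) {x}) UNIV"
      using x by (simp add: walsh_def) (auto intro!: arg_cong[where f = "\<lambda>A. (-1) ^ card A"])
    also have "\<dots> = walsh (S \<inter> Y) UNIV * walsh {x} UNIV" using S by (intro walsh_sym_diff) auto
    finally show ?thesis by (simp add: walsh_def)
  qed
  then have "(\<Sum>Y\<in>Pow P. walsh S Y) = (\<Sum>Y\<in>Pow P. - walsh S Y)"
    using sum.reindex_bij_betw[OF bij_betw_sym_diff[of "{x}" P], of "walsh S"] x assms by auto
  then show ?thesis using False by (simp add: sum_negf)
qed

text \<open>The square expands into characters of \<open>sym_diff S S'\<close>, whose sums over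
  \<open>Y\<close> vanish unless \<open>S = S'\<close>.\<close>

lemma walsh_parseval:
  fixes f :: "'b set \<Rightarrow> complex"
  assumes "finite P"
  shows "(\<Sum>Y\<in>Pow P. (cmod (\<Sum>S\<in>Pow P. walsh S Y * f S))\<^sup>2) = 2 ^ card P * (\<Sum>S\<in>Pow P. (cmod (f S))\<^sup>2)"
proof -
  have fin: "finite S" if "S \<subseteq> P" for S using that assms finite_subset by auto
  have "complex_of_real (\<Sum>Y\<in>Pow P. (cmod (\<Sum>S\<in>Pow P. walsh S Y * f S))\<^sup>2)
     = (\<Sum>Y\<in>Pow P. (\<Sum>S\<in>Pow P. walsh S Y * f S) * (\<Sum>S'\<in>Pow P. walsh S' Y * cnj (f S')))"
    by (simp add: complex_norm_square del: of_real_power)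
  also have "\<dots> = (\<Sum>Y\<in>Pow P. \<Sum>S\<in>Pow P. \<Sum>S'\<in>Pow P. walsh (sym_diff S S') Y * (f S * cnj (f S')))"
    unfolding sum_product by (intro sum.cong refl) (simp add: walsh_sym_diff fin algebra_simps)
  also have "\<dots> = (\<Sum>S\<in>Pow P. \<Sum>Y\<in>Pow P. \<Sum>S'\<in>Pow P. walsh (sym_diff S S') Y * (f S * cnj (f S')))"
    by (rule sum.swap)
  also have "\<dots> = (\<Sum>S\<in>Pow P. \<Sum>S'\<in>Pow P. \<Sum>Y\<in>Pow P. walsh (sym_diff S S') Y * (f S * cnj (f S')))"
    by (intro sum.cong refl sum.swap)
  also have "\<dots> = (\<Sum>S\<in>Pow P. \<Sum>S'\<in>Pow P. if S = S' then 2 ^ card P * (f S * cnj (f S')) else 0)"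
  proof (intro sum.cong refl)
    fix S S' assume "S \<in> Pow P" "S' \<in> Pow P"
    then have "sym_diff S S' \<subseteq> P" "sym_diff S S' = {} \<longleftrightarrow> S = S'" by auto
    then show "(\<Sum>Y\<in>Pow P. walsh (sym_diff S S') Y * (f S * cnj (f S')))
        = (if S = S' then 2 ^ card P * (f S * cnj (f S')) else 0)"
      using sum_walsh[OF assms] by (simp add: sum_distrib_right[symmetric])
  qed
  also have "\<dots> = (\<Sum>S\<in>Pow P. 2 ^ card P * (f S * cnj (f S)))"
    using assms by (intro sum.cong refl) (simp add: sum.delta)
  also have "\<dots> = complex_of_real (2 ^ card P * (\<Sum>S\<in>Pow P. (cmod (f S))\<^sup>2))"
    using of_real_power[of 2 "card P", where 'a = complex]
    by (simp add: complex_norm_square sum_distrib_left del: of_real_power)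
  finally show ?thesis using of_real_eq_iff by blast
qed

lemma mapp_gauge: "mapp n (gauge \<zeta> C) v i = \<zeta> i * mapp n C (\<lambda>j. cnj (\<zeta> j) * v j) i"
  by (simp add: mapp_def gauge_def sum_distrib_left mult.assoc)

lemma sqnorm_phase: "(\<And>i. cmod (\<zeta> i) = 1) \<Longrightarrow> sqnorm n (\<lambda>i. \<zeta> i * v i) = sqnorm n v"
  by (simp add: sqnorm_def norm_mult)

lemma opbound_gauge:
  assumes "\<And>i. cmod (\<zeta> i) = 1" "opbound n C \<eta>"
  shows "opbound n (gauge \<zeta> C) \<eta>"
  unfolding opbound_def
proof
  fix v
  have "sqnorm n (mapp n (gauge \<zeta> C) v) = sqnorm n (mapp n C (\<lambda>j. cnj (\<zeta> j) * v j))"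
    using sqnorm_phase[OF assms(1)] by (simp add: mapp_gauge[abs_def])
  also have "\<dots> \<le> \<eta>\<^sup>2 * sqnorm n (\<lambda>j. cnj (\<zeta> j) * v j)"
    using assms(2) unfolding opbound_def by blast
  also have "sqnorm n (\<lambda>j. cnj (\<zeta> j) * v j) = sqnorm n v"
    using assms(1) by (intro sqnorm_phase) simp
  finally show "sqnorm n (mapp n (gauge \<zeta> C) v) \<le> \<eta>\<^sup>2 * sqnorm n v" .
qed

text \<open>Diagonal phases commute with the projection onto marked coordinates and preserve norms
  and supports.\<close>

lemma almost_fixes_gauge:
  assumes \<zeta>: "\<And>i. cmod (\<zeta> i) = 1" and C: "almost_fixes n b C \<eta>"
  shows "almost_fixes n b (gauge \<zeta> C) \<eta>"
proof -
  define w where "w = (\<lambda>v j. cnj (\<zeta> j) * (v j :: complex))"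
  have "\<zeta> i * cnj (\<zeta> i) = 1" for i
    using \<zeta>[of i] by (metis complex_norm_square of_real_1 one_power2)
  then have eq: "mapp n (gauge \<zeta> C) v i - v i = \<zeta> i * (mapp n C (w v) i - w v i)" for v i
    by (simp add: mapp_gauge w_def right_diff_distrib mult.assoc[symmetric])
  have w: "sqnorm n (w v) = sqnorm n v" for v
    unfolding w_def using \<zeta> by (intro sqnorm_phase) simp
  have "(\<Sum>i | i < n \<and> b i. (cmod (mapp n (gauge \<zeta> C) v i - v i))\<^sup>2) \<le> \<eta>\<^sup>2 * sqnorm n v" for v
    using C unfolding almost_fixes_def eq norm_mult \<zeta> w[of v, symmetric] by simp
  moreover have "sqnorm n (\<lambda>i. mapp n (gauge \<zeta> C) v i - v i) \<le> \<eta>\<^sup>2 * sqnorm n v"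
    if "\<forall>i<n. \<not> b i \<longrightarrow> v i = 0" for v
  proof -
    have "\<forall>i<n. \<not> b i \<longrightarrow> w v i = 0" using that by (simp add: w_def)
    then show ?thesis
      using C unfolding almost_fixes_def eq sqnorm_phase[OF \<zeta>] w[of v, symmetric] by blast
  qed
  ultimately show ?thesis unfolding almost_fixes_def by blast
qed

section \<open>Circuits for fixed signs and averages over all signs\<close>

fun evolution ::
  "nat \<Rightarrow> (nat \<Rightarrow> nat \<Rightarrow> nat \<Rightarrow> complex) \<Rightarrow> (nat \<Rightarrow> nat \<Rightarrow> nat \<Rightarrow> complex) \<Rightarrow> (nat \<Rightarrow> complex) \<Rightarrow> nat \<Rightarrow> nat \<Rightarrow> complex" where
  "evolution n L C v 0 = v"
| "evolution n L C v (Suc t) = mapp n (L t) (mapp n (C t) (evolution n L C v t))"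

lemma mapp_sum: "mapp n A (\<lambda>i. \<Sum>S\<in>X. c S * f S i) i = (\<Sum>S\<in>X. c S * mapp n A (f S) i)"
  unfolding mapp_def sum_distrib_left by (subst sum.swap) (simp add: mult.left_commute)

lemma sum_walsh_shift:
  assumes "finite P" "\<And>i. J i \<subseteq> P"
  shows "walsh (J i) Y * (\<Sum>S\<in>Pow P. walsh S Y * F S i) = (\<Sum>S\<in>Pow P. walsh S Y * shift J F S i)"
proof -
  have fin: "finite S" if "S \<subseteq> P" for S using finite_subset[OF that assms(1)] .
  have "(\<Sum>S\<in>Pow P. walsh S Y * shift J F S i)
      = (\<Sum>S\<in>Pow P. walsh (sym_diff S (J i)) Y * shift J F (sym_diff S (J i)) i)"
    using sum.reindex_bij_betw[OF bij_betw_sym_diff[OF assms(2)]] by (rule sym)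
  also have "\<dots> = (\<Sum>S\<in>Pow P. walsh (J i) Y * (walsh S Y * F S i))"
    by (intro sum.cong refl)
      (use assms(2) in \<open>simp add: shift_def sym_diff_cancel walsh_sym_diff fin mult_ac\<close>)
  finally show ?thesis by (simp add: sum_distrib_left)
qed

text \<open>The two sign factors of a conjugated query become the two shifts of
  \<open>joint_evolution\<close>, because multiplying a Walsh series by a character translates its
  coefficients.\<close>

lemma evolution_walsh:
  assumes "finite P" "\<And>i. J i \<subseteq> P"
  shows "evolution n L (\<lambda>t. gauge (\<lambda>i. walsh (J i) Y) (C t)) v t i
    = (\<Sum>S\<in>Pow P. walsh S Y * joint_evolution n J L (\<lambda>t S. C t) v t S i)"
proof (induction t arbitrary: i)
  case 0
  have "(\<Sum>S\<in>Pow P. walsh S Y * joint_evolution n J L (\<lambda>t S. C t) v 0 S i)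
      = (\<Sum>S\<in>Pow P. if S = {} then v i else 0)"
    by (intro sum.cong) (auto simp: walsh_def)
  then show ?case using assms by (simp add: sum.delta)
next
  case (Suc t)
  let ?F = "joint_evolution n J L (\<lambda>t S. C t) v t"
  let ?g = "gauge (\<lambda>i. walsh (J i) Y) (C t)"
  let ?G = "fibre n (\<lambda>S. C t) (shift J ?F)"
  have "evolution n L (\<lambda>t. gauge (\<lambda>i. walsh (J i) Y) (C t)) v t = (\<lambda>i. \<Sum>S\<in>Pow P. walsh S Y * ?F S i)"
    using Suc.IH by (intro ext)
  then have "mapp n ?g (evolution n L (\<lambda>t. gauge (\<lambda>i. walsh (J i) Y) (C t)) v t) i
      = walsh (J i) Y * mapp n (C t) (\<lambda>j. walsh (J j) Y * (\<Sum>S\<in>Pow P. walsh S Y * ?F S j)) i" for i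
    by (simp add: mapp_gauge)
  also have "\<dots> i = walsh (J i) Y * (\<Sum>S\<in>Pow P. walsh S Y * ?G S i)" for i
  proof -
    have "(\<lambda>j. walsh (J j) Y * (\<Sum>S\<in>Pow P. walsh S Y * ?F S j)) = (\<lambda>j. \<Sum>S\<in>Pow P. walsh S Y * shift J ?F S j)"
      by (intro ext sum_walsh_shift[OF assms])
    then show ?thesis by (simp add: mapp_sum fibre_def)
  qed
  also have "\<dots> i = (\<Sum>S\<in>Pow P. walsh S Y * shift J ?G S i)" for i
    by (rule sum_walsh_shift[OF assms])
  finally have "mapp n ?g (evolution n L (\<lambda>t. gauge (\<lambda>i. walsh (J i) Y) (C t)) v t)
      = (\<lambda>i. \<Sum>S\<in>Pow P. walsh S Y * shift J ?G S i)" by (intro ext)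
  then show ?case by (simp add: mapp_sum fibre_def)
qed

lemma sum_evolution_walsh:
  assumes "finite P" "\<And>i. J i \<subseteq> P" "finite A"
  shows "(\<Sum>Y\<in>Pow P. \<Sum>i\<in>A. (cmod (evolution n L (\<lambda>t. gauge (\<lambda>i. walsh (J i) Y) (C t)) v t i))\<^sup>2)
    = 2 ^ card P * (\<Sum>S\<in>Pow P. \<Sum>i\<in>A. (cmod (joint_evolution n J L (\<lambda>t S. C t) v t S i))\<^sup>2)"
  unfolding evolution_walsh[OF assms(1,2)]
  by (subst (1 2) sum.swap) (simp add: walsh_parseval[OF assms(1)] sum_distrib_left)

text \<open>The square root of an acceptance probability is a seminorm of the state, hence Lipschitz
  with constant 1. For this reason all later comparisons are between square roots of
  probabilities.\<close>

lemma joint_norm_part_diff: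
  assumes "A \<subseteq> {..<n}" and "finite P"
  shows "\<bar>sqrt (\<Sum>S\<in>Pow P. \<Sum>i\<in>A. (cmod (F S i))\<^sup>2) - sqrt (\<Sum>S\<in>Pow P. \<Sum>i\<in>A. (cmod (G S i))\<^sup>2)\<bar>
    \<le> joint_norm P n (\<lambda>S i. F S i - G S i)"
proof -
  define N where "N F = L2_set (\<lambda>(S, i). cmod (F S i)) (Pow P \<times> A)" for F :: "'a set \<Rightarrow> nat \<Rightarrow> complex"
  have N: "sqrt (\<Sum>S\<in>Pow P. \<Sum>i\<in>A. (cmod (F S i))\<^sup>2) = N F" for F :: "'a set \<Rightarrow> nat \<Rightarrow> complex"
    by (simp add: N_def L2_set_def sum.cartesian_product case_prod_unfold)
  have tri: "N F \<le> N (\<lambda>S i. F S i - G S i) + N G" for F G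
  proof -
    have "N F \<le> L2_set (\<lambda>p. (case p of (S, i) \<Rightarrow> cmod (F S i - G S i)) + (case p of (S, i) \<Rightarrow> cmod (G S i))) (Pow P \<times> A)"
      unfolding N_def by (intro L2_set_mono) (auto, metis diff_add_cancel norm_triangle_ineq)
    also have "\<dots> \<le> N (\<lambda>S i. F S i - G S i) + N G" unfolding N_def by (rule L2_set_triangle_ineq)
    finally show ?thesis .
  qed
  have le: "N F \<le> joint_norm P n F" for F
    unfolding N_def joint_norm_L2 L2_set_def real_sqrt_le_iff
    by (intro sum_mono2) (use assms in auto)
  have "N (\<lambda>S i. G S i - F S i) = N (\<lambda>S i. F S i - G S i)"
    by (simp add: N_def norm_minus_commute)
  then show ?thesis
    unfolding N using tri[of F G] tri[of G F] le[of "\<lambda>S i. F S i - G S i"] by linarith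
qed

lemma joint_evolution_masked_perturb:
  assumes P: "finite P" "\<And>i. J i \<subseteq> P" "\<And>i. card (J i) \<le> 1"
    and L: "\<And>t. t < T \<Longrightarrow> opbound n (L t) 1" and C: "\<And>t. t < T \<Longrightarrow> opbound n (C t) 1"
    and small: "\<And>t S. t < T \<Longrightarrow> S \<subseteq> P \<Longrightarrow> card S \<le> 2 * t + 1 \<Longrightarrow> almost_fixes n (charged J S) (C t) (\<eta> t)"
    and "\<And>t. \<eta> t \<ge> 0" "sqnorm n v \<le> 1"
  shows "joint_norm P n (\<lambda>S i. joint_evolution n J L (\<lambda>t S. C t) v T S i
      - joint_evolution n J L (\<lambda>t S. masked (charged J S) (C t)) v T S i) \<le> (\<Sum>u<T. sqrt 2 * \<eta> u)"
  by (rule joint_evolution_perturb[OF P, where T = T])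
    (use assms in \<open>auto intro: opbound_masked opbound_diff_masked\<close>)

text \<open>\<open>p z\<close> is the acceptance probability averaged over the signs. Masking costs
  one sum of errors at \<open>1\<close> and one at \<open>z\<close>, whence the factor 2; between
  the two masked evolutions nothing is lost, since their components differ by phases.\<close>

lemma query_hybrid:
  assumes P: "finite P" "\<And>i. J i \<subseteq> P" "\<And>i. card (J i) \<le> 1"
    and L: "\<And>t. t < T \<Longrightarrow> opbound n (L t) 1" and C: "\<And>t. t < T \<Longrightarrow> opbound n (C t) 1"
    and small: "\<And>t S. t < T \<Longrightarrow> S \<subseteq> P \<Longrightarrow> card S \<le> 2 * t + 1 \<Longrightarrow> almost_fixes n (charged J S) (C t) (\<eta> t)"
    and \<eta>: "\<And>t. \<eta> t \<ge> 0" and v: "sqnorm n v \<le> 1" and A: "A \<subseteq> {..<n}" and z: "cmod z = 1"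
  defines "p \<equiv> \<lambda>z. (\<Sum>Y\<in>Pow P. \<Sum>i\<in>A. (cmod (evolution n L
      (\<lambda>t. gauge (\<lambda>i. walsh (J i) Y * z ^ card (J i)) (C t)) v T i))\<^sup>2) / 2 ^ card P"
  shows "\<bar>sqrt (p 1) - sqrt (p z)\<bar> \<le> 2 * (\<Sum>u<T. sqrt 2 * \<eta> u)"
proof -
  define D where "D z t = gauge (\<lambda>i. z ^ card (J i)) (C t)" for z t
  define F where "F z = joint_evolution n J L (\<lambda>t S. D z t) v T" for z
  define G where "G z = joint_evolution n J L (\<lambda>t S. masked (charged J S) (D z t)) v T" for z
  have finA: "finite A" using A finite_subset by auto
  have finJ: "finite (J i)" for i using P finite_subset by metis
  have p: "p z = (\<Sum>S\<in>Pow P. \<Sum>i\<in>A. (cmod (F z S i))\<^sup>2)" for z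
  proof -
    have "gauge (\<lambda>i. walsh (J i) Y * z ^ card (J i)) (C t) = gauge (\<lambda>i. walsh (J i) Y) (D z t)" for Y t
      by (simp add: gauge_def D_def fun_eq_iff)
    then show ?thesis
      unfolding p_def F_def using sum_evolution_walsh[OF P(1,2) finA, where C = "D z"] by simp
  qed
  have dist: "\<bar>sqrt (p z) - sqrt (\<Sum>S\<in>Pow P. \<Sum>i\<in>A. (cmod (G z S i))\<^sup>2)\<bar> \<le> (\<Sum>u<T. sqrt 2 * \<eta> u)"
    if "cmod z = 1" for z
  proof -
    have ph: "cmod (z ^ card (J i)) = 1" for i using that by (simp add: norm_power)
    have "joint_norm P n (\<lambda>S i. F z S i - G z S i) \<le> (\<Sum>u<T. sqrt 2 * \<eta> u)"
      unfolding F_def G_def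
      by (rule joint_evolution_masked_perturb[OF P L])
        (use assms ph in \<open>auto simp: D_def intro!: opbound_gauge almost_fixes_gauge\<close>)
    then show ?thesis
      unfolding p using joint_norm_part_diff[OF A P(1), of "F z" "G z"] by linarith
  qed
  have "G z S i = z ^ card S * G 1 S i" if "S \<subseteq> P" "i < n" for S i
  proof -
    have "D 1 = C" by (simp add: D_def gauge_def fun_eq_iff)
    moreover have "finite S" using finite_subset[OF that(1) P(1)] .
    ultimately show ?thesis
      unfolding G_def using joint_evolution_gauge[where J = J and C = C, OF z P(3) finJ] that by (simp add: D_def)
  qed
  then have "(\<Sum>S\<in>Pow P. \<Sum>i\<in>A. (cmod (G z S i))\<^sup>2) = (\<Sum>S\<in>Pow P. \<Sum>i\<in>A. (cmod (G 1 S i))\<^sup>2)"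
    by (intro sum.cong refl) (use A z in \<open>auto simp: norm_mult norm_power subset_eq\<close>)
  then show ?thesis using dist[of 1] dist[OF z] by simp
qed

section \<open>Eigenvalues and entropy\<close>

lemma proots_linear_factors: "proots (\<Prod>a\<leftarrow>as. [:- a, 1::complex:]) = mset as"
proof (induction as)
  case Nil
  then show ?case by simp
next
  case (Cons a as)
  have "(\<Prod>a\<leftarrow>as. [:- a, 1::complex:]) \<noteq> 0"
    by (auto simp: prod_list_zero_iff)
  then have "proots ([:- a, 1:] * (\<Prod>a\<leftarrow>as. [:- a, 1::complex:])) = {#a#} + mset as"
    using Cons.IH by (subst proots_mult) (auto simp: proots_linear_factor)
  then show ?case by simp
qed

text \<open>\<open>eigvals\<close> is an arbitrary choice of factorization, but the roots with
  multiplicity fix it up to order, which suffices for the symmetric sum in the entropy.\<close>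

lemma mset_eigvals:
  assumes "A \<in> carrier_mat n n" and "char_poly A = (\<Prod>a\<leftarrow>es. [:- a, 1:])"
  shows "mset (eigvals A) = mset es"
proof -
  have "\<exists>as. char_poly A = (\<Prod>a\<leftarrow>as. [:- a, 1:]) \<and> length as = dim_row A"
    using char_poly_factorized[OF assms(1)] assms(1) by auto
  then have "char_poly A = (\<Prod>a\<leftarrow>eigvals A. [:- a, 1:])"
    unfolding eigvals_def by (rule someI2_ex) auto
  then show ?thesis
    using assms(2) by (metis proots_linear_factors)
qed

lemma vn_entropy_eq:
  assumes "A \<in> carrier_mat n n" and "char_poly A = (\<Prod>a\<leftarrow>es. [:- a, 1:])"
  shows "vn_entropy A = - (\<Sum>a\<leftarrow>es. Re a * ln (Re a))"
  unfolding vn_entropy_def by (simp add: mset_eigvals[OF assms] flip: sum_mset_sum_list)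

section \<open>Traces and spectral mapping by triangularization\<close>

definition mtrace :: "complex mat \<Rightarrow> complex" where
  "mtrace A = (\<Sum>i<dim_row A. A $$ (i, i))"

lemma mtrace_mult_commute:
  assumes "A \<in> carrier_mat n n" "B \<in> carrier_mat n n"
  shows "mtrace (A * B) = mtrace (B * A)"
proof -
  have "mtrace (A * B) = (\<Sum>i<n. \<Sum>k<n. A $$ (i, k) * B $$ (k, i))"
    using assms by (simp add: mtrace_def scalar_prod_def atLeast0LessThan)
  also have "\<dots> = (\<Sum>k<n. \<Sum>i<n. B $$ (k, i) * A $$ (i, k))"
    by (subst sum.swap) (simp add: mult.commute)
  also have "\<dots> = mtrace (B * A)"
    using assms by (simp add: mtrace_def scalar_prod_def atLeast0LessThan)
  finally show ?thesis .
qed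

lemma mtrace_similar:
  assumes "similar_mat_wit A B P Q" "A \<in> carrier_mat n n"
  shows "mtrace A = mtrace B"
proof -
  note w = similar_mat_witD2[OF assms(2,1)]
  have "mtrace A = mtrace (P * (B * Q))" using w by (simp add: assoc_mult_mat[of P n n B n Q n])
  also have "\<dots> = mtrace (B * Q * P)" using w by (intro mtrace_mult_commute) auto
  also have "B * Q * P = B" using w by (simp add: assoc_mult_mat[of B n n Q n P n])
  finally show ?thesis .
qed

lemma similar_mat_wit_mult:
  assumes "similar_mat_wit A B P Q" "similar_mat_wit A' B' P Q" "A \<in> carrier_mat n n" "A' \<in> carrier_mat n n"
  shows "similar_mat_wit (A * A') (B * B') P Q"
proof -
  note w = similar_mat_witD2[OF assms(3,1)] and w' = similar_mat_witD2[OF assms(4,2)]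
  have "A * A' = (P * B * Q) * (P * (B' * Q))" using w w' by (simp add: assoc_mult_mat[of P n n B' n Q n])
  also have "\<dots> = P * B * (Q * (P * (B' * Q)))" using w w' by (intro assoc_mult_mat[of _ n n _ n _ n]) auto
  also have "Q * (P * (B' * Q)) = Q * P * (B' * Q)" using w w' by (intro assoc_mult_mat[symmetric, of _ n n _ n _ n]) auto
  also have "P * B * (Q * P * (B' * Q)) = P * B * (B' * Q)" using w w' by simp
  also have "\<dots> = P * B * B' * Q" using w w' by (intro assoc_mult_mat[symmetric, of _ n n _ n _ n]) auto
  also have "P * B * B' = P * (B * B')" using w w' by (intro assoc_mult_mat[of _ n n _ n _ n]) auto
  finally show ?thesis
    using w w' by (intro similar_mat_witI[of P Q n]) auto
qed

lemma similar_mat_wit_add: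
  assumes "similar_mat_wit A B P Q" "similar_mat_wit A' B' P Q" "A \<in> carrier_mat n n" "A' \<in> carrier_mat n n"
  shows "similar_mat_wit (A + A') (B + B') P Q"
proof -
  note w = similar_mat_witD2[OF assms(3,1)] and w' = similar_mat_witD2[OF assms(4,2)]
  have "A + A' = P * B * Q + P * B' * Q" using w w' by simp
  also have "\<dots> = (P * B + P * B') * Q" using w w' by (intro add_mult_distrib_mat[symmetric, of _ n n]) auto
  also have "P * B + P * B' = P * (B + B')" using w w' by (intro mult_add_distrib_mat[symmetric, of _ n n]) auto
  finally show ?thesis
    using w w' by (intro similar_mat_witI[of P Q n]) auto
qed

lemma upper_triangular_mult:
  fixes A B :: "complex mat"
  assumes "A \<in> carrier_mat n n" "B \<in> carrier_mat n n" "upper_triangular A" "upper_triangular B"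
  shows "upper_triangular (A * B)" "i < n \<Longrightarrow> (A * B) $$ (i, i) = A $$ (i, i) * B $$ (i, i)"
proof -
  have z: "A $$ (i, k) * B $$ (k, j) = 0" if "i < n" "k < n" "j \<le> i" "k \<noteq> i \<or> j < i" for i j k
  proof (cases "k < i")
    case True
    then show ?thesis using assms(1,3) that by (simp add: upper_triangularD)
  next
    case False
    then have "j < k" using that by auto
    then show ?thesis using assms(2,4) that by (simp add: upper_triangularD)
  qed
  show "upper_triangular (A * B)"
    using assms(1,2) z by (intro upper_triangularI) (auto simp: scalar_prod_def intro!: sum.neutral)
  assume i: "i < n"
  have "(A * B) $$ (i, i) = (\<Sum>k\<in>{0..<n}. A $$ (i, k) * B $$ (k, i))"
    using assms(1,2) i by (simp add: scalar_prod_def)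
  also have "\<dots> = (\<Sum>k\<in>{0..<n}. if k = i then A $$ (i, i) * B $$ (i, i) else 0)"
  proof (intro sum.cong refl)
    fix k assume "k \<in> {0..<n}"
    then show "A $$ (i, k) * B $$ (k, i) = (if k = i then A $$ (i, i) * B $$ (i, i) else 0)"
      using z[of i k i] i by (cases "k = i") simp_all
  qed
  finally show "(A * B) $$ (i, i) = A $$ (i, i) * B $$ (i, i)" using i by simp
qed

text \<open>One Schur similarity triangularizes the identity, A and A^2 together, and diagonals of
  upper triangular matrices multiply entrywise. A quadratic polynomial is enough because the hard
  states are quadratic in H; the power sums feed the entropy estimates.\<close>

lemma spectral_mapping:
  fixes A :: "complex mat" and a b c :: complex
  assumes A: "A \<in> carrier_mat n n" and es: "char_poly A = (\<Prod>e\<leftarrow>es. [:- e, 1:])"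
  shows "char_poly (a \<cdot>\<^sub>m 1\<^sub>m n + b \<cdot>\<^sub>m A + c \<cdot>\<^sub>m (A * A)) = (\<Prod>e\<leftarrow>map (\<lambda>e. a + b * e + c * e\<^sup>2) es. [:- e, 1:])"
    and "(\<Sum>e\<leftarrow>es. e) = mtrace A" and "(\<Sum>e\<leftarrow>es. e\<^sup>2) = mtrace (A * A)"
    and "(\<Sum>e\<leftarrow>es. e ^ 4) = mtrace (A * A * (A * A))"
proof -
  obtain B P Q where dec: "schur_decomposition A es = (B, P, Q)" by (cases "schur_decomposition A es")
  have w: "similar_mat_wit A B P Q" and ut: "upper_triangular B" and dg: "diag_mat B = es"
    using schur_decomposition[OF A es dec] by auto
  note W = similar_mat_witD2[OF A w]
  have B: "B \<in> carrier_mat n n" using W by auto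
  have nth: "es ! i = B $$ (i, i)" if "i < n" for i using that B by (auto simp: dg[symmetric] diag_mat_def)
  have len: "length es = n" using B by (auto simp: dg[symmetric] diag_mat_def)
  have sum: "(\<Sum>e\<leftarrow>es. f e) = (\<Sum>i<n. f (B $$ (i, i)))" for f :: "complex \<Rightarrow> complex"
    using nth by (simp add: sum_list_sum_nth len atLeast0LessThan)
  have AA: "A * A \<in> carrier_mat n n" using A by simp
  have BB: "B * B \<in> carrier_mat n n" using B by simp
  have w2: "similar_mat_wit (A * A) (B * B) P Q" using similar_mat_wit_mult[OF w w A A] .
  have w4: "similar_mat_wit (A * A * (A * A)) (B * B * (B * B)) P Q" using similar_mat_wit_mult[OF w2 w2 AA AA] .
  note ut2 = upper_triangular_mult[OF B B ut ut]
  note ut4 = upper_triangular_mult[OF BB BB ut2(1) ut2(1)]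
  show "(\<Sum>e\<leftarrow>es. e) = mtrace A"
    using mtrace_similar[OF w A] B by (simp add: sum[of "\<lambda>e. e", simplified] mtrace_def)
  show "(\<Sum>e\<leftarrow>es. e\<^sup>2) = mtrace (A * A)"
    using mtrace_similar[OF w2 AA] B by (simp add: sum mtrace_def ut2(2) power2_eq_square del: index_mult_mat(1))
  show "(\<Sum>e\<leftarrow>es. e ^ 4) = mtrace (A * A * (A * A))"
    using mtrace_similar[OF w4 mult_carrier_mat[OF AA AA]] A B
    by (simp add: sum mtrace_def ut2(2) ut4(2) power4_eq_xxxx mult.assoc del: index_mult_mat(1))
  let ?g = "\<lambda>M. a \<cdot>\<^sub>m 1\<^sub>m n + b \<cdot>\<^sub>m M + c \<cdot>\<^sub>m (M * M)"
  have w1: "similar_mat_wit (1\<^sub>m n) (1\<^sub>m n) P Q"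
    using W by (intro similar_mat_witI[of P Q n]) auto
  have "similar_mat_wit (?g A) (?g B) P Q"
    using A by (intro similar_mat_wit_add[where n = n] similar_mat_wit_smult w w1 w2) auto
  then have "char_poly (?g A) = char_poly (?g B)"
    by (intro char_poly_similar) (auto simp: similar_mat_def)
  also have "\<dots> = (\<Prod>e\<leftarrow>diag_mat (?g B). [:- e, 1:])"
    using B ut ut2(1) by (intro char_poly_upper_triangular[where n = n]) (auto simp: upper_triangularD)
  also have "diag_mat (?g B) = map (\<lambda>e. a + b * e + c * e\<^sup>2) es"
    using B by (auto simp: diag_mat_def dg[symmetric] ut2(2) power2_eq_square simp del: index_mult_mat(1))
  finally show "char_poly (?g A) = (\<Prod>e\<leftarrow>map (\<lambda>e. a + b * e + c * e\<^sup>2) es. [:- e, 1:])" .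
qed

text \<open>For an eigenvector v the number v^* A v equals its own conjugate and is \<open>e\<close>
  times the nonzero squared norm of v.\<close>

lemma hermitian_root_real:
  fixes A :: "complex mat"
  assumes A: "A \<in> carrier_mat n n" and herm: "\<And>i j. i < n \<Longrightarrow> j < n \<Longrightarrow> A $$ (j, i) = cnj (A $$ (i, j))"
    and es: "char_poly A = (\<Prod>e\<leftarrow>es. [:- e, 1:])" and e: "e \<in> set es"
  shows "Im e = 0"
proof -
  have "poly (char_poly A) e = 0"
    using e unfolding es by (induction es) auto
  then obtain v where "eigenvector A v e"
    using eigenvalue_root_char_poly[OF A] unfolding eigenvalue_def by blast
  then have v: "v \<in> carrier_vec n" "v \<noteq> 0\<^sub>v n" "A *\<^sub>v v = e \<cdot>\<^sub>v v"
    using A by (auto simp: eigenvector_def)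
  define N where "N = (\<Sum>i<n. (cmod (v $ i))\<^sup>2)"
  define q where "q = (\<Sum>i<n. \<Sum>j<n. cnj (v $ i) * A $$ (i, j) * v $ j)"
  have ev: "(\<Sum>j<n. A $$ (i, j) * v $ j) = e * v $ i" if "i < n" for i
    using arg_cong[OF v(3), of "\<lambda>w. w $ i"] that A v(1) by (simp add: scalar_prod_def atLeast0LessThan)
  have "q = (\<Sum>i<n. cnj (v $ i) * (\<Sum>j<n. A $$ (i, j) * v $ j))"
    by (simp add: q_def sum_distrib_left mult.assoc)
  also have "\<dots> = (\<Sum>i<n. e * of_real ((cmod (v $ i))\<^sup>2))"
  proof (intro sum.cong refl)
    fix i assume "i \<in> {..<n}"
    then have "cnj (v $ i) * (\<Sum>j<n. A $$ (i, j) * v $ j) = e * (v $ i * cnj (v $ i))"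
      by (simp add: ev)
    then show "cnj (v $ i) * (\<Sum>j<n. A $$ (i, j) * v $ j) = e * of_real ((cmod (v $ i))\<^sup>2)"
      by (simp only: complex_norm_square)
  qed
  finally have q: "q = e * of_real N" by (simp add: N_def sum_distrib_left)
  have "cnj q = (\<Sum>i<n. \<Sum>j<n. cnj (v $ j) * A $$ (j, i) * v $ i)"
    unfolding q_def cnj_sum
  proof (intro sum.cong refl)
    fix i j assume "i \<in> {..<n}" "j \<in> {..<n}"
    then show "cnj (cnj (v $ i) * A $$ (i, j) * v $ j) = cnj (v $ j) * A $$ (j, i) * v $ i"
      using herm[of i j] by simp
  qed
  also have "\<dots> = q" unfolding q_def by (rule sum.swap)
  finally have "Im q = 0" by (metis Reals_cnj_iff complex_is_Real_iff)
  moreover have "N \<noteq> 0"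
  proof
    assume "N = 0"
    then have "\<forall>i<n. v $ i = 0" unfolding N_def by (subst (asm) sum_nonneg_eq_0_iff) auto
    then show False using v(1,2) by (auto intro!: eq_vecI)
  qed
  ultimately show ?thesis using q by simp
qed

section \<open>Scalar estimates for the two spectra\<close>

lemma mult_ln_le: "x \<ge> 0 \<Longrightarrow> x * ln x \<le> x * (x - 1)" for x :: real
  by (cases "x = 0") (auto intro!: mult_left_mono ln_le_minus_one)

text \<open>For a = |y| one has a^2 ln (a^2) \<ge> 2 a^2 - 2 a = a^2 - 1 + (a - 1)^2. Replacing a by
  \<open>y\<close> in the last square is free for \<open>y \<ge> 0\<close>; the quartic term pays
  for negative \<open>y\<close>.\<close>

lemma square_ln_square_ge:
  fixes y :: real
  shows "y\<^sup>2 * ln (y\<^sup>2) \<ge> y\<^sup>2 - 1 + (y - 1)\<^sup>2 - (y - 1) ^ 4"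
proof -
  define a where "a = \<bar>y\<bar>"
  have "a \<ge> 0" "y\<^sup>2 = a\<^sup>2" by (simp_all add: a_def)
  have "(a - 1)\<^sup>2 \<ge> (y - 1)\<^sup>2 - (y - 1) ^ 4"
  proof (cases "y \<ge> 0")
    case False
    define u where "u = y - 1"
    have "(a - 1)\<^sup>2 - (u\<^sup>2 - u ^ 4) = (u\<^sup>2 - 1)\<^sup>2 + 2 * (u + 1)\<^sup>2 + 1"
      using False by (simp add: a_def u_def power2_eq_square power4_eq_xxxx algebra_simps)
    also have "\<dots> \<ge> 0" by simp
    finally show ?thesis by (simp add: u_def)
  qed (simp add: a_def)
  moreover have "a\<^sup>2 * ln (a\<^sup>2) \<ge> 2 * a\<^sup>2 - 2 * a"
  proof (cases "a = 0")
    case False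
    then have a: "a > 0" using \<open>a \<ge> 0\<close> by simp
    have "ln (1 / a) \<le> 1 / a - 1" using a by (intro ln_le_minus_one) simp
    then have "ln a \<ge> 1 - 1 / a" using a by (simp add: ln_div)
    then have "(2 * a\<^sup>2) * ln a \<ge> (2 * a\<^sup>2) * (1 - 1 / a)" by (intro mult_left_mono) auto
    moreover have "ln (a\<^sup>2) = 2 * ln a" using a by (simp add: ln_realpow)
    moreover have "(2 * a\<^sup>2) * (1 - 1 / a) = 2 * a\<^sup>2 - 2 * a" using a by (simp add: power2_eq_square field_simps)
    ultimately show ?thesis by (simp add: algebra_simps)
  qed simp
  ultimately show ?thesis unfolding \<open>y\<^sup>2 = a\<^sup>2\<close> by (simp add: power2_eq_square algebra_simps)
qed

lemma sum_list_mult_ln_scaled: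
  fixes ls :: "real list"
  assumes "d > 0" "\<And>x. x \<in> set ls \<Longrightarrow> x \<ge> 0" "(\<Sum>x\<leftarrow>ls. x) = d"
  shows "(\<Sum>x\<leftarrow>ls. (x / d) * ln (x / d)) = (\<Sum>x\<leftarrow>ls. x * ln x) / d - ln d"
proof -
  have "(x / d) * ln (x / d) = (x * ln x) / d - x * (ln d / d)" if "x \<in> set ls" for x
    using assms(1) assms(2)[OF that] by (cases "x = 0") (auto simp: ln_div field_simps)
  then have "(\<Sum>x\<leftarrow>ls. (x / d) * ln (x / d)) = (\<Sum>x\<leftarrow>ls. (x * ln x) / d - x * (ln d / d))"
    by (intro arg_cong[where f = sum_list] map_cong refl)
  also have "\<dots> = (\<Sum>x\<leftarrow>ls. x * ln x) / d - (\<Sum>x\<leftarrow>ls. x) * (ln d / d)"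
    by (simp add: sum_list_subtractf sum_list_mult_const divide_inverse)
  finally show ?thesis using assms by simp
qed

text \<open>\<open>hs\<close> stands for the spectrum of the sign matrix H; the assumptions record
  its trace and its second and fourth moments.\<close>

context
  fixes d c s m :: real and hs :: "real list"
  assumes d: "d > 0" and len: "real (length hs) = d" and cs: "c\<^sup>2 + s\<^sup>2 = 1" "0 \<le> c" "c \<le> 1"
    and h1: "sum_list hs = 0" and h2: "(\<Sum>h\<leftarrow>hs. h\<^sup>2) = d" and h4: "(\<Sum>h\<leftarrow>hs. h ^ 4) \<le> m * d"
begin

lemma sum_list_const: "(\<Sum>h\<leftarrow>hs. k) = k * d"
  by (simp add: sum_list_triv flip: len)

text \<open>The case \<open>z = \<i>\<close>. For x = c^2 + s^2 h^2, of mean 1, the bound x ln x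
  \<le> x (x - 1) turns the deficit into the variance of x, which the fourth moment bounds by s^4 (m
  - 1).\<close>

lemma spectral_entropy_ge:
  "- (\<Sum>h\<leftarrow>hs. ((c\<^sup>2 + s\<^sup>2 * h\<^sup>2) / d) * ln ((c\<^sup>2 + s\<^sup>2 * h\<^sup>2) / d)) \<ge> ln d - s ^ 4 * (m - 1)"
proof -
  define ls where "ls = map (\<lambda>h. c\<^sup>2 + s\<^sup>2 * h\<^sup>2) hs"
  have sum1: "(\<Sum>x\<leftarrow>ls. x) = d"
    using cs by (simp add: ls_def o_def sum_list_addf sum_list_const_mult h2 sum_list_const flip: distrib_right)
  have "(\<Sum>x\<leftarrow>ls. x * ln x) \<le> (\<Sum>x\<leftarrow>ls. x * (x - 1))"
    by (intro sum_list_mono mult_ln_le) (auto simp: ls_def)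
  also have "\<dots> = (\<Sum>h\<leftarrow>hs. s ^ 4 * h ^ 4 + (2 * c\<^sup>2 * s\<^sup>2 - s\<^sup>2) * h\<^sup>2 + (c ^ 4 - c\<^sup>2))"
    by (simp add: ls_def o_def power2_eq_square power4_eq_xxxx algebra_simps)
  also have "\<dots> = s ^ 4 * (\<Sum>h\<leftarrow>hs. h ^ 4) + (2 * c\<^sup>2 * s\<^sup>2 - s\<^sup>2) * d + (c ^ 4 - c\<^sup>2) * d"
    by (simp add: sum_list_addf sum_list_const_mult h2 sum_list_const)
  also have "\<dots> \<le> s ^ 4 * (m * d) + (2 * c\<^sup>2 * s\<^sup>2 - s\<^sup>2) * d + (c ^ 4 - c\<^sup>2) * d"
    using h4 by (simp add: mult_left_mono)
  also have "c\<^sup>2 = 1 - s\<^sup>2" using cs by simp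
  also have "c ^ 4 = (1 - s\<^sup>2)\<^sup>2" using \<open>c\<^sup>2 = 1 - s\<^sup>2\<close> by (metis mult_2 numeral_Bit0 power2_eq_square power_add)
  also have "s ^ 4 * (m * d) + (2 * (1 - s\<^sup>2) * s\<^sup>2 - s\<^sup>2) * d + ((1 - s\<^sup>2)\<^sup>2 - (1 - s\<^sup>2)) * d = s ^ 4 * (m - 1) * d"
    by (simp add: power2_eq_square power4_eq_xxxx algebra_simps)
  finally have "(\<Sum>x\<leftarrow>ls. x * ln x) / d \<le> s ^ 4 * (m - 1)" using d by (simp add: field_simps)
  moreover have "(\<Sum>x\<leftarrow>ls. (x / d) * ln (x / d)) = (\<Sum>x\<leftarrow>ls. x * ln x) / d - ln d"
    using d sum1 by (intro sum_list_mult_ln_scaled) (auto simp: ls_def)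
  ultimately have "- (\<Sum>x\<leftarrow>ls. (x / d) * ln (x / d)) \<ge> ln d - s ^ 4 * (m - 1)" by linarith
  then show ?thesis by (simp add: ls_def o_def)
qed

text \<open>The case \<open>z = 1\<close>, from \<open>square_ln_square_ge\<close> at y = c + s h.
  The mean of y^2 - 1 is 0, that of (y - 1)^2 is at least s^2, and that of (y - 1)^4 is at most 8 (m
  + 1) s^4.\<close>

lemma spectral_entropy_le:
  "- (\<Sum>h\<leftarrow>hs. ((c + s * h)\<^sup>2 / d) * ln ((c + s * h)\<^sup>2 / d)) \<le> ln d - s\<^sup>2 + 8 * (m + 1) * s ^ 4"
proof -
  define ls where "ls = map (\<lambda>h. (c + s * h)\<^sup>2) hs"
  have sq: "(c + s * h)\<^sup>2 = c\<^sup>2 + 2 * c * s * h + s\<^sup>2 * h\<^sup>2" for h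
    by (simp add: power2_eq_square algebra_simps)
  have sum1: "(\<Sum>x\<leftarrow>ls. x) = d"
    using cs by (simp add: ls_def o_def sq sum_list_addf sum_list_const_mult h1 h2 sum_list_const flip: distrib_right)
  \<comment> \<open>From c^2 + s^2 = 1 follows 1 - c \<le> s^2, and (1 - c)^4 \<le> (1 -
    c)^2.\<close>
  have c1: "(c - 1) ^ 4 \<le> s ^ 4"
  proof -
    have "(1 - c) * 1 \<le> (1 - c) * (1 + c)" using cs by (intro mult_left_mono) auto
    then have "1 - c \<le> s\<^sup>2" using cs by (simp add: power2_eq_square algebra_simps)
    then have "(1 - c) ^ 2 \<le> (s\<^sup>2)\<^sup>2" using cs by (intro power_mono) auto
    moreover have "(1 - c) ^ 2 \<le> 1" using cs by (simp add: power_le_one)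
    then have "(1 - c)\<^sup>2 * (1 - c)\<^sup>2 \<le> (1 - c)\<^sup>2 * 1" by (intro mult_left_mono) auto
    ultimately show ?thesis by (simp add: power2_eq_square power4_eq_xxxx algebra_simps)
  qed
  have quart: "(a + b) ^ 4 \<le> 8 * a ^ 4 + 8 * b ^ 4" for a b :: real
  proof -
    have "(a + b)\<^sup>2 \<le> 2 * (a\<^sup>2 + b\<^sup>2)" using sum_squares_bound[of a b] by (simp add: power2_sum)
    then have "((a + b)\<^sup>2)\<^sup>2 \<le> (2 * (a\<^sup>2 + b\<^sup>2))\<^sup>2" by (intro power_mono) auto
    then have "(a + b) ^ 4 \<le> 4 * (a\<^sup>2 + b\<^sup>2)\<^sup>2"
      unfolding power_mult_distrib[of 2] power_mult[symmetric] by simp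
    also have "(a\<^sup>2 + b\<^sup>2)\<^sup>2 \<le> 2 * (a ^ 4 + b ^ 4)"
      using sum_squares_bound[of "a\<^sup>2" "b\<^sup>2"] by (simp add: power2_sum)
    finally show ?thesis by simp
  qed
  have "(\<Sum>h\<leftarrow>hs. (c + s * h)\<^sup>2 * ln ((c + s * h)\<^sup>2))
      \<ge> (\<Sum>h\<leftarrow>hs. s\<^sup>2 * h\<^sup>2 - 8 * (s ^ 4 * h ^ 4) + ((c + s * h)\<^sup>2 - 1) + 2 * (c - 1) * s * h - 8 * s ^ 4)"
  proof (rule sum_list_mono)
    fix h
    have "(c + s * h - 1) ^ 4 \<le> 8 * (s * h) ^ 4 + 8 * (c - 1) ^ 4"
      using quart[of "s * h" "c - 1"] by (simp add: algebra_simps)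
    moreover have "(c + s * h - 1)\<^sup>2 = (c - 1)\<^sup>2 + 2 * (c - 1) * s * h + s\<^sup>2 * h\<^sup>2"
      by (simp add: power2_eq_square algebra_simps)
    moreover have "E - 8 * A + (X - 1) + D - 8 * S \<le> L"
      if "U4 \<le> 8 * A + 8 * B" "U2 = C + D + E" "L \<ge> X - 1 + U2 - U4" "B \<le> S" "0 \<le> C"
      for A B C D E L S U2 U4 X :: real using that by linarith
    ultimately show "(c + s * h)\<^sup>2 * ln ((c + s * h)\<^sup>2)
        \<ge> s\<^sup>2 * h\<^sup>2 - 8 * (s ^ 4 * h ^ 4) + ((c + s * h)\<^sup>2 - 1) + 2 * (c - 1) * s * h - 8 * s ^ 4"
      using square_ln_square_ge[of "c + s * h"] c1 zero_le_power2[of "c - 1"]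
      unfolding power_mult_distrib[of s h 4] by blast
  qed
  moreover have "(\<Sum>h\<leftarrow>hs. s\<^sup>2 * h\<^sup>2 - 8 * (s ^ 4 * h ^ 4) + ((c + s * h)\<^sup>2 - 1) + 2 * (c - 1) * s * h - 8 * s ^ 4)
      = s\<^sup>2 * d - 8 * s ^ 4 * (\<Sum>h\<leftarrow>hs. h ^ 4) - 8 * s ^ 4 * d"
    using sum1 by (simp add: ls_def o_def sum_list_addf sum_list_subtractf sum_list_const_mult h1 h2 sum_list_const)
  moreover have "8 * s ^ 4 * (\<Sum>h\<leftarrow>hs. h ^ 4) \<le> 8 * s ^ 4 * (m * d)"
    using h4 by (intro mult_left_mono) auto
  ultimately have "(\<Sum>x\<leftarrow>ls. x * ln x) \<ge> s\<^sup>2 * d - 8 * s ^ 4 * (m * d) - 8 * s ^ 4 * d"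
    unfolding ls_def by (simp add: o_def)
  also have "s\<^sup>2 * d - 8 * s ^ 4 * (m * d) - 8 * s ^ 4 * d = (s\<^sup>2 - 8 * (m + 1) * s ^ 4) * d"
    by (simp add: algebra_simps)
  finally have "(\<Sum>x\<leftarrow>ls. x * ln x) / d \<ge> s\<^sup>2 - 8 * (m + 1) * s ^ 4"
    using d by (simp add: field_simps)
  moreover have "(\<Sum>x\<leftarrow>ls. (x / d) * ln (x / d)) = (\<Sum>x\<leftarrow>ls. x * ln x) / d - ln d"
    using d sum1 by (intro sum_list_mult_ln_scaled) (auto simp: ls_def)
  ultimately have "- (\<Sum>x\<leftarrow>ls. (x / d) * ln (x / d)) \<le> ln d - s\<^sup>2 + 8 * (m + 1) * s ^ 4" by linarith
  then show ?thesis by (simp add: ls_def o_def)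
qed

end

section \<open>Circuits as linear maps on functions\<close>

lemma mat_adjoint_eq: "mat_adjoint A = mat (dim_col A) (dim_row A) (\<lambda>(i, j). cnj (A $$ (j, i)))"
  by (rule eq_matI) (auto simp: mat_adjoint_def mat_of_rows_def)

lemma mat_adjoint_simps [simp]:
  "dim_row (mat_adjoint A) = dim_col A" "dim_col (mat_adjoint A) = dim_row A"
  "i < dim_col A \<Longrightarrow> j < dim_row A \<Longrightarrow> mat_adjoint A $$ (i, j) = cnj (A $$ (j, i))"
  by (simp_all add: mat_adjoint_eq)

lemma mat_adjoint_carrier [simp]: "(A :: complex mat) \<in> carrier_mat m n \<Longrightarrow> mat_adjoint A \<in> carrier_mat n m"
  unfolding carrier_mat_def by auto

lemma mat_adjoint_adjoint: "mat_adjoint (mat_adjoint A) = (A :: complex mat)"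
  by (rule eq_matI) auto

text \<open>Orthonormal rows suffice, since a one-sided inverse of a square matrix is
  two-sided.\<close>

lemma unitary_mat_iff:
  assumes "A \<in> carrier_mat n n"
  shows "unitary_mat A n \<longleftrightarrow> (\<forall>i<n. \<forall>j<n. (\<Sum>k<n. A $$ (i, k) * cnj (A $$ (j, k))) = of_bool (i = j))"
proof -
  have "(A * mat_adjoint A) $$ (i, j) = (\<Sum>k<n. A $$ (i, k) * cnj (A $$ (j, k)))" if "i < n" "j < n" for i j
    using assms that by (simp add: scalar_prod_def atLeast0LessThan)
  then have "A * mat_adjoint A = 1\<^sub>m n \<longleftrightarrow> (\<forall>i<n. \<forall>j<n. (\<Sum>k<n. A $$ (i, k) * cnj (A $$ (j, k))) = of_bool (i = j))"
    using assms by (simp add: mat_eq_iff of_bool_def del: index_mult_mat(1))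
  moreover have "mat_adjoint A * A = 1\<^sub>m n" if "A * mat_adjoint A = 1\<^sub>m n"
    using mat_mult_left_right_inverse[OF assms mat_adjoint_carrier[OF assms] that] .
  ultimately show ?thesis using assms unfolding unitary_mat_def by blast
qed

lemma unitary_mat_adjoint: "unitary_mat A n \<Longrightarrow> unitary_mat (mat_adjoint A) n"
  by (auto simp: unitary_mat_def mat_adjoint_adjoint)

lemma unitary_mat_mult:
  assumes "unitary_mat A n" "unitary_mat B n"
  shows "unitary_mat (A * B) n"
proof -
  have A: "A \<in> carrier_mat n n" and B: "B \<in> carrier_mat n n"
    using assms by (auto simp: unitary_mat_def)
  have "(\<Sum>k<n. (A * B) $$ (i, k) * cnj ((A * B) $$ (j, k))) = of_bool (i = j)" if "i < n" "j < n" for i j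
  proof -
    have AB: "(A * B) $$ (i, k) = (\<Sum>l<n. A $$ (i, l) * B $$ (l, k))" if "i < n" "k < n" for i k
      using A B that by (simp add: scalar_prod_def atLeast0LessThan)
    have "(\<Sum>k<n. (A * B) $$ (i, k) * cnj ((A * B) $$ (j, k)))
        = (\<Sum>k<n. \<Sum>l<n. \<Sum>m<n. (A $$ (i, l) * B $$ (l, k)) * (cnj (A $$ (j, m)) * cnj (B $$ (m, k))))"
      using that by (intro sum.cong refl) (simp only: AB lessThan_iff cnj_sum complex_cnj_mult sum_product)
    also have "\<dots> = (\<Sum>k<n. \<Sum>l<n. \<Sum>m<n. (A $$ (i, l) * cnj (A $$ (j, m))) * (B $$ (l, k) * cnj (B $$ (m, k))))"
      by (intro sum.cong refl) (simp only: mult_ac)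
    also have "\<dots> = (\<Sum>l<n. \<Sum>m<n. \<Sum>k<n. (A $$ (i, l) * cnj (A $$ (j, m))) * (B $$ (l, k) * cnj (B $$ (m, k))))"
      by (subst sum.swap) (intro sum.cong refl sum.swap)
    also have "\<dots> = (\<Sum>l<n. \<Sum>m<n. (A $$ (i, l) * cnj (A $$ (j, m))) * of_bool (l = m))"
      using assms(2) unitary_mat_iff[OF B] by (simp flip: sum_distrib_left)
    also have "\<dots> = (\<Sum>l<n. A $$ (i, l) * cnj (A $$ (j, l)))"
      by (simp add: of_bool_def if_distrib[of "(*) _"] cong: if_cong)
    also have "\<dots> = of_bool (i = j)"
      using assms(1) unitary_mat_iff[OF A] that by simp
    finally show ?thesis .
  qed
  then show ?thesis using A B by (subst unitary_mat_iff) auto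
qed

lemma mapp_mult_mat_vec:
  assumes "A \<in> carrier_mat n n" "v \<in> carrier_vec n" "i < n"
  shows "(A *\<^sub>v v) $ i = mapp n (\<lambda>i j. A $$ (i, j)) (\<lambda>j. v $ j) i"
  using assms by (simp add: mapp_def scalar_prod_def atLeast0LessThan)

lemma sqnorm_mapp_unitary:
  assumes "unitary_mat A n"
  shows "sqnorm n (mapp n (\<lambda>i j. A $$ (i, j)) v) = sqnorm n v"
proof -
  have A: "A \<in> carrier_mat n n" using assms by (simp add: unitary_mat_def)
  have "(\<Sum>i<n. A $$ (i, j) * cnj (A $$ (i, k))) = of_bool (k = j)" if "j < n" "k < n" for j k
  proof -
    have "(\<Sum>i<n. mat_adjoint A $$ (k, i) * cnj (mat_adjoint A $$ (j, i))) = of_bool (k = j)"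
      using unitary_mat_adjoint[OF assms] unitary_mat_iff[OF mat_adjoint_carrier[OF A]] that by blast
    then show ?thesis using A that by (simp add: mult.commute)
  qed
  note orth = this
  have "complex_of_real (sqnorm n (mapp n (\<lambda>i j. A $$ (i, j)) v))
     = (\<Sum>i<n. \<Sum>j<n. \<Sum>k<n. (v j * cnj (v k)) * (A $$ (i, j) * cnj (A $$ (i, k))))"
    by (simp add: sqnorm_def mapp_def complex_norm_square sum_product mult_ac del: of_real_power)
  also have "\<dots> = (\<Sum>j<n. \<Sum>k<n. \<Sum>i<n. (v j * cnj (v k)) * (A $$ (i, j) * cnj (A $$ (i, k))))"
    by (subst sum.swap) (intro sum.cong refl sum.swap)
  also have "\<dots> = (\<Sum>j<n. \<Sum>k<n. (v j * cnj (v k)) * of_bool (k = j))"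
    by (simp add: orth flip: sum_distrib_left)
  also have "\<dots> = (\<Sum>j<n. v j * cnj (v j))"
    by (simp add: of_bool_def if_distrib[of "(*) _"] cong: if_cong)
  also have "\<dots> = complex_of_real (sqnorm n v)"
    by (simp add: sqnorm_def complex_norm_square del: of_real_power)
  finally show ?thesis using of_real_eq_iff by blast
qed

lemma opbound_unitary: "unitary_mat A n \<Longrightarrow> opbound n (\<lambda>i j. A $$ (i, j)) 1"
  by (simp add: opbound_def sqnorm_mapp_unitary)

lemma mapp_cong:
  "(\<And>j. j < n \<Longrightarrow> A i j = B i j) \<Longrightarrow> (\<And>j. j < n \<Longrightarrow> v j = w j) \<Longrightarrow> mapp n A v i = mapp n B w i"
  by (simp add: mapp_def)

lemma sqnorm_cong: "(\<And>i. i < n \<Longrightarrow> v i = w i) \<Longrightarrow> sqnorm n v = sqnorm n w"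
  by (simp add: sqnorm_def)

lemma opbound_cong:
  assumes "\<And>i j. i < n \<Longrightarrow> j < n \<Longrightarrow> A i j = B i j"
  shows "opbound n A \<eta> \<longleftrightarrow> opbound n B \<eta>"
proof -
  have "sqnorm n (mapp n A v) = sqnorm n (mapp n B v)" for v
    by (intro sqnorm_cong mapp_cong) (use assms in auto)
  then show ?thesis by (simp add: opbound_def)
qed

definition ctrl :: "nat \<Rightarrow> nat \<Rightarrow> (nat \<Rightarrow> nat \<Rightarrow> complex) \<Rightarrow> nat \<Rightarrow> nat \<Rightarrow> complex" where
  "ctrl k D W i j = (if i div D = j div D
     then if i div D < k then of_bool (i = j) else W (i mod D) (j mod D) else 0)"

lemma div_mod_block:
  fixes i k D :: nat
  assumes "i < 2 * k * D"
  shows "i div (k * D) = of_bool (\<not> i div D < k)" and "(i mod (k * D)) mod D = i mod D"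
    and "(i mod (k * D)) div D = (if i div D < k then i div D else i div D - k)"
proof -
  have D: "D > 0" and k: "k > 0" using assms by (auto intro!: Nat.gr0I)
  show "(i mod (k * D)) mod D = i mod D" by (simp add: mod_mod_cancel)
  have *: "i div (k * D) = i div D div k" by (simp add: div_mult2_eq mult.commute[of k])
  have q: "i div D < 2 * k" using assms by (simp add: less_mult_imp_div_less)
  have m: "(i mod (k * D)) div D = i div D mod k"
    using D by (simp add: mod_mult2_eq mult.commute[of k])
  show "i div (k * D) = of_bool (\<not> i div D < k)"
  proof (cases "i div D < k")
    case False
    then have "i div D div k = 1" using q by (intro div_nat_eqI) auto
    then show ?thesis using False * by simp
  qed (simp add: *)
  show "(i mod (k * D)) div D = (if i div D < k then i div D else i div D - k)"
  proof (cases "i div D < k")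
    case False
    then have "i div D mod k = i div D - k" using q by (simp add: le_mod_geq not_less)
    then show ?thesis using False m by simp
  qed (simp add: m)
qed

lemma eq_iff_div_mod: "i = j \<longleftrightarrow> i div D = j div D \<and> i mod D = j mod D" for i j D :: nat
  by (metis div_mult_mod_eq)

lemma ctrl_query_index:
  assumes "W \<in> carrier_mat D D" "i < 2 * k * D" "j < 2 * k * D"
  shows "ctrl_query k W $$ (i, j) = ctrl k D (\<lambda>i j. W $$ (i, j)) i j"
proof -
  have kD: "i mod (k * D) < k * D" "j mod (k * D) < k * D" using assms(2) by (auto intro!: mod_less_divisor Nat.gr0I)
  have D: "D > 0" using assms(2) by (auto intro!: Nat.gr0I)
  have d: "i div (k * D) < 2" "j div (k * D) < 2" using assms(2,3) by (simp_all add: div_mod_block(1))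
  have bl: "i mod (k * D) div D < k" "j mod (k * D) div D < k"
    using kD by (simp_all add: less_mult_imp_div_less)
  have "kron proj1 (kron (1\<^sub>m k) W) $$ (i, j)
      = proj1 $$ (i div (k * D), j div (k * D)) * (kron (1\<^sub>m k) W $$ (i mod (k * D), j mod (k * D)))"
    using assms by (simp add: kron_def proj1_def mult.assoc)
  also have "\<dots> = of_bool (\<not> i div D < k \<and> \<not> j div D < k) *
      (of_bool (i mod (k * D) div D = j mod (k * D) div D) * W $$ (i mod D, j mod D))"
    using assms kD d bl by (simp add: kron_def proj1_def div_mod_block)
  finally have 1: "kron proj1 (kron (1\<^sub>m k) W) $$ (i, j) = \<dots>" .
  have "kron (proj0 2) (1\<^sub>m (k * D)) $$ (i, j)
      = proj0 2 $$ (i div (k * D), j div (k * D)) * (1\<^sub>m (k * D) $$ (i mod (k * D), j mod (k * D)))"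
    using assms by (simp add: kron_def proj0_def mult.assoc)
  also have "\<dots> = of_bool (i div D < k \<and> j div D < k) * of_bool (i mod (k * D) = j mod (k * D))"
    using assms kD d by (simp add: proj0_def div_mod_block)
  finally have 0: "kron (proj0 2) (1\<^sub>m (k * D)) $$ (i, j) = \<dots>" .
  have "ctrl_query k W $$ (i, j) = kron (proj0 2) (1\<^sub>m (k * D)) $$ (i, j) + kron proj1 (kron (1\<^sub>m k) W) $$ (i, j)"
    unfolding ctrl_query_def using assms
    by (subst index_add_mat) (auto simp: kron_def proj1_def mult.assoc)
  also have "\<dots> = ctrl k D (\<lambda>i j. W $$ (i, j)) i j"
    unfolding 0 1 ctrl_def
    using eq_iff_div_mod[of i j D] eq_iff_div_mod[of "i mod (k * D)" "j mod (k * D)" D]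
      div_mod_block[OF assms(2)] div_mod_block[OF assms(3)]
    by (cases "i div D < k"; cases "j div D < k") auto
  finally show ?thesis .
qed

lemma ctrl_query_carrier:
  "W \<in> carrier_mat D D \<Longrightarrow> ctrl_query k W \<in> carrier_mat (2 * k * D) (2 * k * D)"
  by (auto simp: ctrl_query_def kron_def proj1_def mult.assoc)

lemma alg_state_evolution:
  assumes W: "W \<in> carrier_mat D D" and n: "n = 2 * k * D" "n > 0"
    and V: "\<And>t. t \<le> T \<Longrightarrow> V t \<in> carrier_mat n n"
  shows "t \<le> T \<Longrightarrow> alg_state k V dg W t \<in> carrier_vec n \<and>
    (\<forall>i<n. alg_state k V dg W t $ i = evolution n (\<lambda>t i j. V (Suc t) $$ (i, j))
      (\<lambda>t. ctrl k D (\<lambda>i j. (if dg t then mat_adjoint W else W) $$ (i, j))) (\<lambda>i. V 0 $$ (i, 0)) t i)"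
proof (induction t)
  case 0
  have "(V 0 *\<^sub>v unit_vec n 0) $ i = V 0 $$ (i, 0)" if "i < n" for i
    using V[of 0] n(2) that by (auto simp: scalar_prod_right_unit)
  then show ?case using V[of 0] W n by auto
next
  case (Suc t)
  let ?W = "if dg t then mat_adjoint W else W"
  let ?\<phi> = "alg_state k V dg W t"
  let ?C = "ctrl k D (\<lambda>i j. ?W $$ (i, j))"
  let ?E = "evolution n (\<lambda>t i j. V (Suc t) $$ (i, j))
      (\<lambda>t. ctrl k D (\<lambda>i j. (if dg t then mat_adjoint W else W) $$ (i, j))) (\<lambda>i. V 0 $$ (i, 0))"
  have IH: "?\<phi> \<in> carrier_vec n" "\<And>i. i < n \<Longrightarrow> ?\<phi> $ i = ?E t i" using Suc by auto
  have W': "?W \<in> carrier_mat D D" using W by simp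
  have C: "ctrl_query k ?W \<in> carrier_mat n n" using ctrl_query_carrier[OF W'] n by simp
  have V': "V (Suc t) \<in> carrier_mat n n" using V Suc.prems by blast
  have "(ctrl_query k ?W *\<^sub>v ?\<phi>) $ i = mapp n ?C (?E t) i" if "i < n" for i
    unfolding mapp_mult_mat_vec[OF C IH(1) that]
    by (intro mapp_cong) (use IH(2) that n ctrl_query_index[OF W'] in auto)
  then have "(V (Suc t) *\<^sub>v (ctrl_query k ?W *\<^sub>v ?\<phi>)) $ i = mapp n (\<lambda>i j. V (Suc t) $$ (i, j)) (mapp n ?C (?E t)) i"
    if "i < n" for i
    using that C IH(1) by (subst mapp_mult_mat_vec[OF V']) (auto intro!: mapp_cong)
  then show ?case using V' C IH(1) by auto
qed

section \<open>Controlled queries and rotations\<close>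

lemma sum_blocks:
  fixes f :: "nat \<Rightarrow> 'a :: comm_monoid_add"
  shows "(\<Sum>i<m * D. f i) = (\<Sum>g<m. \<Sum>i<D. f (g * D + i))"
proof -
  have "(\<Sum>i\<in>{g * D..<g * D + D}. f i) = (\<Sum>i<D. f (g * D + i))" for g
    using sum.shift_bounds_nat_ivl[of f 0 "g * D" D] by (simp add: atLeast0LessThan add.commute)
  then show ?thesis by (simp flip: sum.nat_group)
qed

lemma sqnorm_blocks: "sqnorm (m * D) v = (\<Sum>g<m. sqnorm D (\<lambda>i. v (g * D + i)))"
  by (simp add: sqnorm_def sum_blocks)

lemma mapp_ctrl:
  assumes "g < 2 * k" "i < D"
  shows "mapp (2 * k * D) (ctrl k D W) v (g * D + i) =
    (if g < k then v (g * D + i) else mapp D W (\<lambda>j. v (g * D + j)) i)"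
proof -
  have "mapp (2 * k * D) (ctrl k D W) v (g * D + i)
      = (\<Sum>g'<2 * k. \<Sum>j<D. ctrl k D W (g * D + i) (g' * D + j) * v (g' * D + j))"
    by (simp add: mapp_def sum_blocks)
  also have "\<dots> = (\<Sum>g'<2 * k. if g' = g then
      (\<Sum>j<D. (if g < k then of_bool (i = j) else W i j) * v (g * D + j)) else 0)"
    using assms by (intro sum.cong refl) (auto simp: ctrl_def intro!: sum.cong sum.neutral)
  also have "\<dots> = (\<Sum>j<D. (if g < k then of_bool (i = j) else W i j) * v (g * D + j))"
    using assms by simp
  also have "\<dots> = (if g < k then v (g * D + i) else mapp D W (\<lambda>j. v (g * D + j)) i)"
    using assms by (simp add: mapp_def of_bool_def if_distrib[of "\<lambda>x. x * _"] cong: if_cong)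
  finally show ?thesis .
qed

lemma opbound_ctrl:
  assumes "opbound D W 1"
  shows "opbound (2 * k * D) (ctrl k D W) 1"
  unfolding opbound_def
proof
  fix v
  have "sqnorm D (\<lambda>i. mapp (2 * k * D) (ctrl k D W) v (g * D + i)) \<le> sqnorm D (\<lambda>i. v (g * D + i))"
    if "g < 2 * k" for g
  proof -
    have "sqnorm D (\<lambda>i. mapp (2 * k * D) (ctrl k D W) v (g * D + i))
        = sqnorm D (\<lambda>i. if g < k then v (g * D + i) else mapp D W (\<lambda>j. v (g * D + j)) i)"
      by (intro sqnorm_cong mapp_ctrl that)
    also have "\<dots> \<le> sqnorm D (\<lambda>i. v (g * D + i))"
      using assms by (cases "g < k") (simp_all add: opbound_def)
    finally show ?thesis .
  qed
  then show "sqnorm (2 * k * D) (mapp (2 * k * D) (ctrl k D W) v) \<le> 1\<^sup>2 * sqnorm (2 * k * D) v"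
    unfolding sqnorm_blocks by (auto intro: sum_mono)
qed

text \<open>Everything happens within one block, and the blocks with control 0 are fixed
  exactly.\<close>

lemma almost_fixes_ctrl:
  assumes "almost_fixes D b W \<eta>" and D: "D > 0"
  shows "almost_fixes (2 * k * D) (\<lambda>i. b (i mod D)) (ctrl k D W) \<eta>"
proof -
  let ?n = "2 * k * D"
  let ?A = "mapp ?n (ctrl k D W)"
  have part: "(\<Sum>i | i < m * D \<and> b (i mod D). f i) = (\<Sum>g<m. \<Sum>i | i < D \<and> b i. f (g * D + i))"
    for m and f :: "nat \<Rightarrow> real"
  proof -
    have filter: "(\<Sum>i | i < N \<and> p i. g i) = (\<Sum>i<N. if p i then g i else 0)" for N p and g :: "nat \<Rightarrow> real"
      using sum.inter_filter[of "{..<N}" g p] by simp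
    have "(\<Sum>i | i < m * D \<and> b (i mod D). f i) = (\<Sum>g<m. \<Sum>i<D. if b i then f (g * D + i) else 0)"
      unfolding filter sum_blocks by (intro sum.cong refl) simp
    also have "\<dots> = (\<Sum>g<m. \<Sum>i | i < D \<and> b i. f (g * D + i))"
      unfolding filter ..
    finally show ?thesis .
  qed
  have "(\<Sum>i | i < ?n \<and> b (i mod D). (cmod (?A v i - v i))\<^sup>2) \<le> \<eta>\<^sup>2 * sqnorm ?n v" for v
  proof -
    have "(\<Sum>i | i < D \<and> b i. (cmod (?A v (g * D + i) - v (g * D + i)))\<^sup>2) \<le> \<eta>\<^sup>2 * sqnorm D (\<lambda>i. v (g * D + i))"
      if "g < 2 * k" for g
    proof (cases "g < k")
      case True
      then show ?thesis using that by (simp add: mapp_ctrl)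
    next
      case False
      then have "(\<Sum>i | i < D \<and> b i. (cmod (?A v (g * D + i) - v (g * D + i)))\<^sup>2)
          = (\<Sum>i | i < D \<and> b i. (cmod (mapp D W (\<lambda>j. v (g * D + j)) i - v (g * D + i)))\<^sup>2)"
        using that by (intro sum.cong refl) (simp add: mapp_ctrl)
      also have "\<dots> \<le> \<eta>\<^sup>2 * sqnorm D (\<lambda>i. v (g * D + i))"
        using assms(1) unfolding almost_fixes_def by blast
      finally show ?thesis .
    qed
    then show ?thesis
      unfolding part sqnorm_blocks sum_distrib_left by (intro sum_mono) simp
  qed
  moreover have "sqnorm ?n (\<lambda>i. ?A v i - v i) \<le> \<eta>\<^sup>2 * sqnorm ?n v"
    if supp: "\<forall>i<?n. \<not> b (i mod D) \<longrightarrow> v i = 0" for v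
  proof -
    have "sqnorm D (\<lambda>i. ?A v (g * D + i) - v (g * D + i)) \<le> \<eta>\<^sup>2 * sqnorm D (\<lambda>i. v (g * D + i))"
      if "g < 2 * k" for g
    proof (cases "g < k")
      case True
      then have "sqnorm D (\<lambda>i. ?A v (g * D + i) - v (g * D + i)) = sqnorm D (\<lambda>i. 0)"
        using that by (intro sqnorm_cong) (simp add: mapp_ctrl)
      then show ?thesis by (simp add: sqnorm_def[of D "\<lambda>i. 0"])
    next
      case False
      have "g * D + i < ?n" if "i < D" for i
      proof -
        have "g * D + i < (g + 1) * D" using that by simp
        also have "\<dots> \<le> 2 * k * D" using \<open>g < 2 * k\<close> by (intro mult_right_mono) auto
        finally show ?thesis .
      qed
      then have "\<forall>i<D. \<not> b i \<longrightarrow> v (g * D + i) = 0" using supp by simp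
      then have "sqnorm D (\<lambda>i. mapp D W (\<lambda>j. v (g * D + j)) i - v (g * D + i)) \<le> \<eta>\<^sup>2 * sqnorm D (\<lambda>i. v (g * D + i))"
        by (rule assms(1)[unfolded almost_fixes_def, THEN conjunct2, THEN spec, of "\<lambda>i. v (g * D + i)", THEN mp])
      moreover have "sqnorm D (\<lambda>i. ?A v (g * D + i) - v (g * D + i))
          = sqnorm D (\<lambda>i. mapp D W (\<lambda>j. v (g * D + j)) i - v (g * D + i))"
        using that False by (intro sqnorm_cong) (simp add: mapp_ctrl)
      ultimately show ?thesis by simp
    qed
    then show ?thesis
      unfolding sqnorm_blocks sum_distrib_left by (intro sum_mono) simp
  qed
  ultimately show ?thesis unfolding almost_fixes_def by blast
qed

lemma ctrl_gauge:
  assumes "\<And>i. cmod (\<zeta> i) = 1"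
  shows "ctrl k D (gauge \<zeta> W) = gauge (\<lambda>i. \<zeta> (i mod D)) (ctrl k D W)"
proof -
  have "\<zeta> i * cnj (\<zeta> i) = 1" for i
    using assms[of i] by (metis complex_norm_square of_real_1 one_power2)
  then show ?thesis by (auto simp: ctrl_def gauge_def fun_eq_iff)
qed

text \<open>Being almost fixed on columns is the adjoint form of being almost fixed on rows.\<close>
lemma almost_fixesI:
  assumes adj: "\<And>i j. i < n \<Longrightarrow> j < n \<Longrightarrow> A' i j = cnj (A j i)" and "\<eta> \<ge> 0"
    and row: "\<And>v. (\<Sum>i | i < n \<and> b i. (cmod (mapp n A v i - v i))\<^sup>2) \<le> \<eta>\<^sup>2 * sqnorm n v"
    and row': "\<And>v. (\<Sum>i | i < n \<and> b i. (cmod (mapp n A' v i - v i))\<^sup>2) \<le> \<eta>\<^sup>2 * sqnorm n v"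
  shows "almost_fixes n b A \<eta>"
proof -
  have "sqnorm n (\<lambda>i. mapp n A v i - v i) \<le> \<eta>\<^sup>2 * sqnorm n v" if supp: "\<forall>i<n. \<not> b i \<longrightarrow> v i = 0" for v
  proof -
    \<comment> \<open>With w = (A - 1) v the squared norm of w is the inner product of r = (A^* - 1)
      w with v. Only marked rows of r meet the support of v, so the row bound for A^* and
      Cauchy-Schwarz apply; a factor sqrt (sqnorm n w) is then cancelled.\<close>
    define w where "w i = mapp n A v i - v i" for i
    define r where "r j = mapp n A' w j - w j" for j
    have r: "cnj (r j) = (\<Sum>i<n. cnj (w i) * A i j) - cnj (w j)" if "j < n" for j
      using that by (simp add: r_def mapp_def adj mult.commute)
    have "complex_of_real (sqnorm n w) = (\<Sum>i<n. cnj (w i) * (mapp n A v i - v i))"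
      by (simp add: sqnorm_def complex_norm_square mult.commute w_def[symmetric] del: of_real_power)
    also have "\<dots> = (\<Sum>i<n. \<Sum>j<n. cnj (w i) * A i j * v j) - (\<Sum>i<n. cnj (w i) * v i)"
      by (simp add: right_diff_distrib sum_subtractf mapp_def sum_distrib_left mult.assoc)
    also have "(\<Sum>i<n. \<Sum>j<n. cnj (w i) * A i j * v j) = (\<Sum>j<n. (\<Sum>i<n. cnj (w i) * A i j) * v j)"
      by (subst sum.swap) (simp add: sum_distrib_right)
    also have "(\<Sum>j<n. (\<Sum>i<n. cnj (w i) * A i j) * v j) - (\<Sum>i<n. cnj (w i) * v i) = (\<Sum>j<n. cnj (r j) * v j)"
      by (simp add: r left_diff_distrib sum_subtractf)
    also have "\<dots> = (\<Sum>j | j < n \<and> b j. cnj (r j) * v j)"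
      using supp by (intro sum.mono_neutral_right) auto
    finally have "sqnorm n w = cmod (\<Sum>j | j < n \<and> b j. cnj (r j) * v j)"
      by (metis norm_of_real abs_of_nonneg sqnorm_nonneg)
    also have "\<dots> \<le> (\<Sum>j | j < n \<and> b j. cmod (r j) * cmod (v j))"
      by (rule order_trans[OF norm_sum]) (simp add: norm_mult)
    also have "\<dots> = (\<Sum>j | j < n \<and> b j. \<bar>cmod (r j)\<bar> * \<bar>cmod (v j)\<bar>)" by simp
    also have "\<dots> \<le> L2_set (\<lambda>j. cmod (r j)) {j. j < n \<and> b j} * L2_set (\<lambda>j. cmod (v j)) {j. j < n \<and> b j}"
      by (rule L2_set_mult_ineq)
    also have "\<dots> \<le> sqrt (\<eta>\<^sup>2 * sqnorm n w) * sqrt (sqnorm n v)"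
    proof (intro mult_mono)
      show "L2_set (\<lambda>j. cmod (r j)) {j. j < n \<and> b j} \<le> sqrt (\<eta>\<^sup>2 * sqnorm n w)"
        unfolding L2_set_def real_sqrt_le_iff r_def using row'[of w] .
      show "L2_set (\<lambda>j. cmod (v j)) {j. j < n \<and> b j} \<le> sqrt (sqnorm n v)"
        unfolding L2_set_def real_sqrt_le_iff sqnorm_def by (intro sum_mono2) auto
    qed (simp_all add: L2_set_nonneg)
    finally have le: "sqnorm n w \<le> sqrt (sqnorm n w) * (\<eta> * sqrt (sqnorm n v))"
      using \<open>\<eta> \<ge> 0\<close> by (simp add: real_sqrt_mult mult_ac)
    have "sqrt (sqnorm n w) \<le> \<eta> * sqrt (sqnorm n v)"
    proof (cases "sqnorm n w = 0")
      case False
      then have "sqnorm n w > 0" using sqnorm_nonneg[of n w] by linarith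
      then have pos: "sqrt (sqnorm n w) > 0" by simp
      have "sqrt (sqnorm n w) * sqrt (sqnorm n w) \<le> sqrt (sqnorm n w) * (\<eta> * sqrt (sqnorm n v))"
        using le by simp
      then show ?thesis using pos by (rule mult_left_le_imp_le)
    qed (use \<open>\<eta> \<ge> 0\<close> in simp)
    then have "(sqrt (sqnorm n w))\<^sup>2 \<le> (\<eta> * sqrt (sqnorm n v))\<^sup>2" by (intro power_mono) auto
    then show ?thesis by (simp add: power_mult_distrib w_def[symmetric])
  qed
  then show ?thesis using row unfolding almost_fixes_def by blast
qed

text \<open>The rotation of the plane spanned by \<open>u\<close> and \<open>v\<close> that sends
  \<open>u\<close> to c u + s v, extended by the identity on the orthogonal complement.\<close>

definition rot :: "real \<Rightarrow> real \<Rightarrow> (nat \<Rightarrow> real) \<Rightarrow> (nat \<Rightarrow> real) \<Rightarrow> nat \<Rightarrow> nat \<Rightarrow> real" where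
  "rot c s u v i j = of_bool (i = j) + (c - 1) * (u i * u j + v i * v j) + s * (v i * u j - u i * v j)"

lemma rot_transpose: "rot c s u v j i = rot c (- s) u v i j"
  by (cases "i = j") (simp_all add: rot_def algebra_simps)

definition orthonormal_pair :: "nat \<Rightarrow> (nat \<Rightarrow> real) \<Rightarrow> (nat \<Rightarrow> real) \<Rightarrow> bool" where
  "orthonormal_pair D u v \<longleftrightarrow> (\<Sum>k<D. u k * u k) = 1 \<and> (\<Sum>k<D. v k * v k) = 1 \<and> (\<Sum>k<D. u k * v k) = 0"

lemma rot_rows:
  assumes uv: "orthonormal_pair D u v" and cs: "c\<^sup>2 + s\<^sup>2 = 1" and "i < D" "j < D"
  shows "(\<Sum>k<D. rot c s u v i k * rot c s u v j k) = of_bool (i = j)"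
proof -
  define p q where "p i = (c - 1) * u i + s * v i" and "q i = (c - 1) * v i - s * u i" for i
  have rot: "rot c s u v i k = of_bool (i = k) + p i * u k + q i * v k" for i k
    by (simp add: rot_def p_def q_def algebra_simps)
  have vu: "(\<Sum>k<D. v k * u k) = 0" using uv by (simp add: orthonormal_pair_def mult.commute)
  have "(\<Sum>k<D. rot c s u v i k * rot c s u v j k)
    = (\<Sum>k<D. of_bool (i = k) * of_bool (j = k) + of_bool (i = k) * (p j * u k + q j * v k)
       + of_bool (j = k) * (p i * u k + q i * v k)
       + (p i * p j) * (u k * u k) + (p i * q j) * (u k * v k) + (q i * p j) * (v k * u k) + (q i * q j) * (v k * v k))"
    unfolding rot by (intro sum.cong refl) (simp add: algebra_simps)
  also have "\<dots> = of_bool (i = j) + (p j * u i + q j * v i) + (p i * u j + q i * v j) + p i * p j + q i * q j"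
    using uv vu assms(3,4)
    by (simp add: sum.distrib sum_distrib_left[symmetric] orthonormal_pair_def of_bool_def
        if_distrib[of "\<lambda>x. x * _"] cong: if_cong)
  also have "\<dots> = of_bool (i = j) + ((c\<^sup>2 + s\<^sup>2) - 1) * (u i * u j + v i * v j)"
    by (simp add: p_def q_def power2_eq_square algebra_simps)
  finally show ?thesis using cs by simp
qed

definition cmat :: "nat \<Rightarrow> (nat \<Rightarrow> nat \<Rightarrow> real) \<Rightarrow> complex mat" where
  "cmat D R = mat D D (\<lambda>(i, j). complex_of_real (R i j))"

lemma unitary_rot:
  assumes "orthonormal_pair D u v" "c\<^sup>2 + s\<^sup>2 = 1"
  shows "unitary_mat (cmat D (rot c s u v)) D"
proof (subst unitary_mat_iff)
  show "\<forall>i<D. \<forall>j<D. (\<Sum>k<D. cmat D (rot c s u v) $$ (i, k) * cnj (cmat D (rot c s u v) $$ (j, k))) = of_bool (i = j)"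
  proof (intro allI impI)
    fix i j assume ij: "i < D" "j < D"
    then have "(\<Sum>k<D. cmat D (rot c s u v) $$ (i, k) * cnj (cmat D (rot c s u v) $$ (j, k)))
        = complex_of_real (\<Sum>k<D. rot c s u v i k * rot c s u v j k)"
      by (simp add: cmat_def)
    also have "\<dots> = of_bool (i = j)" unfolding rot_rows[OF assms ij] by simp
    finally show "(\<Sum>k<D. cmat D (rot c s u v) $$ (i, k) * cnj (cmat D (rot c s u v) $$ (j, k))) = of_bool (i = j)" .
  qed
qed (simp add: cmat_def)

definition ip :: "nat \<Rightarrow> (nat \<Rightarrow> real) \<Rightarrow> (nat \<Rightarrow> complex) \<Rightarrow> complex" where
  "ip D f w = (\<Sum>k<D. complex_of_real (f k) * w k)"

lemma mapp_rot:
  assumes "i < D"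
  shows "mapp D (\<lambda>i j. complex_of_real (rot c s u v i j)) w i
    = w i + (complex_of_real (c - 1) * ip D u w - complex_of_real s * ip D v w) * u i
      + (complex_of_real (c - 1) * ip D v w + complex_of_real s * ip D u w) * v i"
proof -
  have "mapp D (\<lambda>i j. complex_of_real (rot c s u v i j)) w i
    = (\<Sum>k<D. of_bool (i = k) * w k + complex_of_real ((c - 1) * u i + s * v i) * (u k * w k)
       + complex_of_real ((c - 1) * v i - s * u i) * (v k * w k))"
    unfolding mapp_def rot_def by (intro sum.cong refl) (simp add: algebra_simps)
  also have "\<dots> = w i + complex_of_real ((c - 1) * u i + s * v i) * ip D u w + complex_of_real ((c - 1) * v i - s * u i) * ip D v w"
    using assms(1)
    by (simp add: ip_def sum.distrib sum_distrib_left of_bool_def if_distrib[of "\<lambda>x. x * _"] cong: if_cong)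
  also have "\<dots> = w i + ((c - 1) * ip D u w - s * ip D v w) * u i + ((c - 1) * ip D v w + s * ip D u w) * v i"
    by (simp add: algebra_simps)
  finally show ?thesis .
qed

lemma ip_bound:
  assumes "(\<Sum>k<D. f k * f k) = 1"
  shows "(cmod (ip D f w))\<^sup>2 \<le> sqnorm D w"
proof -
  have "cmod (ip D f w) \<le> (\<Sum>k<D. \<bar>f k\<bar> * \<bar>cmod (w k)\<bar>)"
    unfolding ip_def by (rule order_trans[OF norm_sum]) (simp add: norm_mult)
  also have "\<dots> \<le> L2_set f {..<D} * L2_set (\<lambda>k. cmod (w k)) {..<D}"
    by (rule L2_set_mult_ineq)
  also have "\<dots> = sqrt (sqnorm D w)"
    using assms by (simp add: L2_set_def sqnorm_def power2_eq_square[of "f _"])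
  finally have "(cmod (ip D f w))\<^sup>2 \<le> (sqrt (sqnorm D w))\<^sup>2" by (intro power_mono) auto
  then show ?thesis by simp
qed

text \<open>Where \<open>u\<close> vanishes, the displacement is one scalar times
  \<open>v i\<close>. The squared modulus of that scalar is at most 4 s^2 times the squared norm of
  the input, using (c - 1)^2 \<le> s^2 for \<open>c \<ge> 0\<close>.\<close>

lemma rot_fixes_rows:
  assumes uv: "orthonormal_pair D u v" and cs: "c\<^sup>2 + s\<^sup>2 = 1" "0 \<le> c" and b: "\<And>i. b i \<Longrightarrow> u i = 0"
  shows "(\<Sum>i | i < D \<and> b i. (cmod (mapp D (\<lambda>i j. complex_of_real (rot c s u v i j)) w i - w i))\<^sup>2)
    \<le> 4 * s\<^sup>2 * (\<Sum>i | i < D \<and> b i. (v i)\<^sup>2) * sqnorm D w"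
proof -
  let ?z = "complex_of_real (c - 1) * ip D v w + complex_of_real s * ip D u w"
  have "c \<le> 1" using cs by (metis abs_le_square_iff abs_of_nonneg le_add_same_cancel1 one_power2 zero_le_power2 abs_one)
  have "(1 - c) * (1 - c) \<le> (1 - c) * (1 + c)" using cs \<open>c \<le> 1\<close> by (intro mult_left_mono) auto
  then have c: "(c - 1)\<^sup>2 \<le> s\<^sup>2" using cs by (simp add: power2_eq_square algebra_simps)
  have "(cmod ?z)\<^sup>2 \<le> (\<bar>c - 1\<bar> * cmod (ip D v w) + \<bar>s\<bar> * cmod (ip D u w))\<^sup>2"
    using norm_triangle_ineq[of "complex_of_real (c - 1) * ip D v w" "complex_of_real s * ip D u w"]
    unfolding norm_mult norm_of_real by (intro power_mono) auto
  also have "\<dots> \<le> 2 * ((c - 1)\<^sup>2 * (cmod (ip D v w))\<^sup>2) + 2 * (s\<^sup>2 * (cmod (ip D u w))\<^sup>2)"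
    using sum_squares_bound[of "\<bar>c - 1\<bar> * cmod (ip D v w)" "\<bar>s\<bar> * cmod (ip D u w)"]
    by (simp add: power2_sum power_mult_distrib)
  also have "\<dots> \<le> 2 * (s\<^sup>2 * sqnorm D w) + 2 * (s\<^sup>2 * sqnorm D w)"
    using uv c by (intro add_mono mult_left_mono mult_mono ip_bound) (auto simp: orthonormal_pair_def)
  also have "\<dots> = 4 * s\<^sup>2 * sqnorm D w" by simp
  finally have z: "(cmod ?z)\<^sup>2 \<le> 4 * s\<^sup>2 * sqnorm D w" .
  have "(\<Sum>i | i < D \<and> b i. (cmod (mapp D (\<lambda>i j. complex_of_real (rot c s u v i j)) w i - w i))\<^sup>2)
      = (\<Sum>i | i < D \<and> b i. (cmod ?z)\<^sup>2 * (v i)\<^sup>2)"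
    by (intro sum.cong refl) (simp add: mapp_rot b norm_mult power_mult_distrib)
  also have "\<dots> \<le> (\<Sum>i | i < D \<and> b i. 4 * s\<^sup>2 * sqnorm D w * (v i)\<^sup>2)"
    using z by (intro sum_mono mult_right_mono) auto
  also have "\<dots> = 4 * s\<^sup>2 * (\<Sum>i | i < D \<and> b i. (v i)\<^sup>2) * sqnorm D w"
    by (simp add: sum_distrib_left sum_distrib_right mult_ac)
  finally show ?thesis .
qed

definition rot2 :: "nat \<Rightarrow> real \<Rightarrow> real \<Rightarrow> (nat \<Rightarrow> real) \<Rightarrow> (nat \<Rightarrow> real) \<Rightarrow> real \<Rightarrow> real \<Rightarrow> (nat \<Rightarrow> real) \<Rightarrow> (nat \<Rightarrow> real)
    \<Rightarrow> nat \<Rightarrow> nat \<Rightarrow> real" where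
  "rot2 D c s u v c' s' u' v' i j = (\<Sum>k<D. rot c s u v i k * rot c' s' u' v' k j)"

lemma cmat_rot2: "cmat D (rot2 D c s u v c' s' u' v') = cmat D (rot c s u v) * cmat D (rot c' s' u' v')"
  by (rule eq_matI) (auto simp: cmat_def rot2_def scalar_prod_def atLeast0LessThan)

lemma unitary_rot2:
  assumes "orthonormal_pair D u v" "c\<^sup>2 + s\<^sup>2 = 1" "orthonormal_pair D u' v'" "c'\<^sup>2 + s'\<^sup>2 = 1"
  shows "unitary_mat (cmat D (rot2 D c s u v c' s' u' v')) D"
  unfolding cmat_rot2 using assms by (intro unitary_mat_mult unitary_rot)

lemma mapp_mapp:
  "mapp n A (mapp n B v) i = mapp n (\<lambda>i j. \<Sum>k<n. A i k * B k j) v i"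
  unfolding mapp_def sum_distrib_left sum_distrib_right
  by (subst sum.swap) (simp add: mult.assoc)

text \<open>The second rotation is exactly the identity on marked rows, so only the first one moves
  them. The transpose is the product in reverse order with negated sines, and the same bound holds
  for it.\<close>

lemma almost_fixes_rot2:
  assumes uv: "orthonormal_pair D u v" "c\<^sup>2 + s\<^sup>2 = 1" "0 \<le> c"
    and uv': "orthonormal_pair D u' v'" "c'\<^sup>2 + s'\<^sup>2 = 1"
    and b: "\<And>i. b i \<Longrightarrow> u i = 0" "\<And>i. b i \<Longrightarrow> u' i = 0" "\<And>i. b i \<Longrightarrow> v' i = 0"
    and \<eta>: "\<eta> \<ge> 0" "4 * s\<^sup>2 * (\<Sum>i | i < D \<and> b i. (v i)\<^sup>2) \<le> \<eta>\<^sup>2"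
  shows "almost_fixes D b (\<lambda>i j. complex_of_real (rot2 D c s u v c' s' u' v' i j)) \<eta>"
    and "almost_fixes D b (\<lambda>i j. complex_of_real (rot2 D c s u v c' s' u' v' j i)) \<eta>"
proof -
  let ?B = "\<lambda>i j. complex_of_real (rot2 D c s u v c' s' u' v' i j)"
  let ?B' = "\<lambda>i j. complex_of_real (rot2 D c s u v c' s' u' v' j i)"
  let ?R = "\<lambda>s i j. complex_of_real (rot c s u v i j)" and ?Q = "\<lambda>s' i j. complex_of_real (rot c' s' u' v' i j)"
  have B: "mapp D ?B w i = mapp D (?R s) (mapp D (?Q s') w) i" for w i
    unfolding mapp_mapp by (intro mapp_cong) (simp_all add: rot2_def)
  have B': "mapp D ?B' w i = mapp D (?Q (- s')) (mapp D (?R (- s)) w) i" for w i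
    unfolding mapp_mapp by (intro mapp_cong) (simp_all add: rot2_def rot_transpose[symmetric] mult.commute)
  have Q: "mapp D (?Q s') w i = w i" if "i < D" "b i" for s' w i
    using that b by (simp add: mapp_rot)
  have nQ: "sqnorm D (mapp D (?Q s') w) = sqnorm D w" for w
    using sqnorm_mapp_unitary[OF unitary_rot[OF uv'], of w]
    by (subst (asm) sqnorm_cong[where w = "mapp D (?Q s') w"]) (auto intro!: mapp_cong simp: cmat_def)
  have "(\<Sum>i | i < D \<and> b i. (cmod (mapp D ?B w i - w i))\<^sup>2) \<le> \<eta>\<^sup>2 * sqnorm D w" for w
  proof -
    let ?w = "mapp D (?Q s') w"
    have "(\<Sum>i | i < D \<and> b i. (cmod (mapp D ?B w i - w i))\<^sup>2)
        = (\<Sum>i | i < D \<and> b i. (cmod (mapp D (?R s) ?w i - ?w i))\<^sup>2)"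
      by (intro sum.cong refl) (simp add: B Q)
    also have "\<dots> \<le> 4 * s\<^sup>2 * (\<Sum>i | i < D \<and> b i. (v i)\<^sup>2) * sqnorm D ?w"
      using uv b by (intro rot_fixes_rows) auto
    also have "\<dots> \<le> \<eta>\<^sup>2 * sqnorm D w" unfolding nQ using \<eta> by (intro mult_right_mono) auto
    finally show ?thesis .
  qed
  note row = this
  have "(\<Sum>i | i < D \<and> b i. (cmod (mapp D ?B' w i - w i))\<^sup>2) \<le> \<eta>\<^sup>2 * sqnorm D w" for w
  proof -
    have "(\<Sum>i | i < D \<and> b i. (cmod (mapp D ?B' w i - w i))\<^sup>2)
        = (\<Sum>i | i < D \<and> b i. (cmod (mapp D (?R (- s)) w i - w i))\<^sup>2)"
      by (intro sum.cong refl) (simp add: B' Q)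
    also have "\<dots> \<le> 4 * (- s)\<^sup>2 * (\<Sum>i | i < D \<and> b i. (v i)\<^sup>2) * sqnorm D w"
      using uv b by (intro rot_fixes_rows) auto
    also have "\<dots> \<le> \<eta>\<^sup>2 * sqnorm D w" using \<eta> by (intro mult_right_mono) auto
    finally show ?thesis .
  qed
  note row' = this
  show "almost_fixes D b ?B \<eta>" using row row' \<eta> by (intro almost_fixesI[where A' = ?B']) auto
  show "almost_fixes D b ?B' \<eta>" using row row' \<eta> by (intro almost_fixesI[where A' = ?B]) auto
qed

section \<open>The oracle before sign randomization\<close>

lemma evolution_joint:
  "evolution n L C v t i = joint_evolution n (\<lambda>_. {} :: 'b set) L (\<lambda>t S. C t) v t {} i"
proof (induction t arbitrary: i)
  case (Suc t)
  have "evolution n L C v t = joint_evolution n (\<lambda>_. {} :: 'b set) L (\<lambda>t S. C t) v t {}" by (intro ext) (rule Suc)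
  moreover have "shift (\<lambda>_. {}) F = F" for F :: "'b set \<Rightarrow> nat \<Rightarrow> complex" by (simp add: shift_def fun_eq_iff)
  ultimately show ?case by (simp add: fibre_def)
qed simp

text \<open>The joint hybrid bound with empty edges and the single label \<open>{}\<close>.\<close>

lemma evolution_perturb:
  assumes L: "\<And>t. t < T \<Longrightarrow> opbound n (L t) 1" and C: "\<And>t. t < T \<Longrightarrow> opbound n (C t) 1"
    and C': "\<And>t. t < T \<Longrightarrow> opbound n (C' t) 1"
    and d: "\<And>t. t < T \<Longrightarrow> opbound n (\<lambda>i j. C t i j - C' t i j) \<eta>"
    and \<eta>: "\<eta> \<ge> 0" and v: "sqnorm n v \<le> 1" and A: "A \<subseteq> {..<n}"
  shows "\<bar>sqrt (\<Sum>i\<in>A. (cmod (evolution n L C v T i))\<^sup>2) - sqrt (\<Sum>i\<in>A. (cmod (evolution n L C' v T i))\<^sup>2)\<bar> \<le> T * \<eta>"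
proof -
  let ?J = "\<lambda>_. {} :: nat set"
  let ?F = "\<lambda>C. joint_evolution n ?J L (\<lambda>t S. C t) v T"
  have "joint_norm {} n (\<lambda>S i. ?F C S i - ?F C' S i) \<le> (\<Sum>u<T. \<eta>)"
    by (rule joint_evolution_perturb[where T = T]) (use assms in auto)
  moreover have "\<bar>sqrt (\<Sum>S\<in>Pow {}. \<Sum>i\<in>A. (cmod (?F C S i))\<^sup>2) - sqrt (\<Sum>S\<in>Pow {}. \<Sum>i\<in>A. (cmod (?F C' S i))\<^sup>2)\<bar>
      \<le> joint_norm {} n (\<lambda>S i. ?F C S i - ?F C' S i)"
    by (rule joint_norm_part_diff[OF A]) simp
  ultimately show ?thesis unfolding evolution_joint[where 'b = nat] by simp
qed

lemma sqnorm_evolution: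
  assumes "\<And>t. t < T \<Longrightarrow> opbound n (L t) 1" "\<And>t. t < T \<Longrightarrow> opbound n (C t) 1"
  shows "t \<le> T \<Longrightarrow> sqnorm n (evolution n L C v t) \<le> sqnorm n v"
proof (induction t)
  case (Suc t)
  have "sqnorm n (evolution n L C v (Suc t)) \<le> sqnorm n (mapp n (C t) (evolution n L C v t))"
    using assms(1)[of t] Suc.prems by (simp add: opbound_def)
  also have "\<dots> \<le> sqnorm n (evolution n L C v t)"
    using assms(2)[of t] Suc.prems by (simp add: opbound_def)
  finally show ?case using Suc by simp
qed simp

section \<open>Vectors and rotations on the purifying space\<close>

definition diagonal :: "nat \<Rightarrow> nat \<Rightarrow> bool" where
  "diagonal d i \<longleftrightarrow> i div d = i mod d"

definition basis0 :: "nat \<Rightarrow> real" where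
  "basis0 i = of_bool (i = 0)"

definition diag_rest :: "nat \<Rightarrow> nat \<Rightarrow> real" where
  "diag_rest d i = of_bool (diagonal d i \<and> i \<noteq> 0) / sqrt (real (d - 1))"

definition diag_vec :: "nat \<Rightarrow> nat \<Rightarrow> real" where
  "diag_vec d i = of_bool (diagonal d i) / sqrt d"

definition offdiag_vec :: "nat \<Rightarrow> nat \<Rightarrow> real" where
  "offdiag_vec d i = of_bool (\<not> diagonal d i) / sqrt (real d * real (d - 1))"

lemma diagonal_block [simp]: "b < d \<Longrightarrow> diagonal d (a * d + b) \<longleftrightarrow> a = b"
  by (simp add: diagonal_def)

lemma sum_of_bool_eq:
  fixes d :: nat
  assumes "a < d"
  shows "(\<Sum>b<d. of_bool (a = b)) = (1 :: real)" "(\<Sum>b<d. of_bool (a \<noteq> b)) = real (d - 1)"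
proof -
  show 1: "(\<Sum>b<d. of_bool (a = b)) = (1 :: real)" using assms by (simp add: of_bool_def)
  have "(\<Sum>b<d. of_bool (a \<noteq> b)) = (\<Sum>b<d. 1 - of_bool (a = b) :: real)"
    by (intro sum.cong) auto
  then show "(\<Sum>b<d. of_bool (a \<noteq> b)) = real (d - 1)"
    using 1 assms by (simp add: sum_subtractf of_nat_diff)
qed

lemma sum_diagonal:
  fixes d :: nat
  shows "(\<Sum>i<d * d. of_bool (diagonal d i)) = real d" "(\<Sum>i<d * d. of_bool (\<not> diagonal d i)) = real d * real (d - 1)"
proof -
  have "(\<Sum>i<d * d. of_bool (diagonal d i)) = (\<Sum>a<d. \<Sum>b<d. of_bool (a = b) :: real)"
    unfolding sum_blocks by (intro sum.cong refl) simp
  also have "\<dots> = (\<Sum>a<d. 1)" by (intro sum.cong refl sum_of_bool_eq) simp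
  finally show "(\<Sum>i<d * d. of_bool (diagonal d i)) = real d" by simp
  have "(\<Sum>i<d * d. of_bool (\<not> diagonal d i)) = (\<Sum>a<d. \<Sum>b<d. of_bool (a \<noteq> b) :: real)"
    unfolding sum_blocks by (intro sum.cong refl) simp
  also have "\<dots> = (\<Sum>a<d. real (d - 1))" by (intro sum.cong refl sum_of_bool_eq) simp
  finally show "(\<Sum>i<d * d. of_bool (\<not> diagonal d i)) = real d * real (d - 1)" by (simp only: sum_constant card_lessThan)
qed

lemma orthonormal_diag_offdiag:
  assumes "d \<ge> 2"
  shows "orthonormal_pair (d * d) (diag_vec d) (offdiag_vec d)"
proof -
  have "(\<Sum>k<d * d. diag_vec d k * diag_vec d k) = (\<Sum>k<d * d. of_bool (diagonal d k) / real d)"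
    by (intro sum.cong) (auto simp: diag_vec_def)
  moreover have "(\<Sum>k<d * d. offdiag_vec d k * offdiag_vec d k) = (\<Sum>k<d * d. of_bool (\<not> diagonal d k) / (real d * real (d - 1)))"
    by (intro sum.cong) (auto simp: offdiag_vec_def real_sqrt_mult[symmetric])
  moreover have "(\<Sum>k<d * d. diag_vec d k * offdiag_vec d k) = 0"
    by (intro sum.neutral) (auto simp: diag_vec_def offdiag_vec_def)
  ultimately show ?thesis
    using assms by (simp add: orthonormal_pair_def sum_divide_distrib[symmetric] sum_diagonal)
qed

lemma orthonormal_basis0_rest:
  assumes "d \<ge> 2"
  shows "orthonormal_pair (d * d) basis0 (diag_rest d)"
proof -
  have D: "0 < d * d" using assms by simp
  have "(\<Sum>k<d * d. of_bool (diagonal d k \<and> k \<noteq> 0)) = (\<Sum>k<d * d. of_bool (diagonal d k) - of_bool (k = 0) :: real)"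
    using assms by (intro sum.cong) (auto simp: diagonal_def)
  also have "\<dots> = real (d - 1)"
    using D assms by (simp add: sum_subtractf sum_diagonal of_nat_diff of_bool_def[of "_ = 0"])
  finally have "(\<Sum>k<d * d. of_bool (diagonal d k \<and> k \<noteq> 0)) = real (d - 1)" .
  moreover have "(\<Sum>k<d * d. diag_rest d k * diag_rest d k) = (\<Sum>k<d * d. of_bool (diagonal d k \<and> k \<noteq> 0) / real (d - 1))"
    by (intro sum.cong) (auto simp: diag_rest_def)
  moreover have "(\<Sum>k<d * d. basis0 k * basis0 k) = (\<Sum>k<d * d. if k = 0 then 1 else 0)"
    by (intro sum.cong) (auto simp: basis0_def)
  then have "(\<Sum>k<d * d. basis0 k * basis0 k) = 1" using D by simp
  moreover have "(\<Sum>k<d * d. basis0 k * diag_rest d k) = 0"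
    by (intro sum.neutral) (auto simp: basis0_def diag_rest_def)
  ultimately show ?thesis
    using assms by (simp add: orthonormal_pair_def sum_divide_distrib[symmetric])
qed

lemma rot_basis0_column:
  assumes "i < D"
  shows "rot c s basis0 (diag_rest d) i 0 = c * basis0 i + s * diag_rest d i"
  by (simp add: rot_def basis0_def diag_rest_def algebra_simps)

text \<open>The coefficients are cosine and sine of the angle between the first basis vector and the
  maximally entangled vector.\<close>

lemma basis0_rest_diag:
  assumes "d \<ge> 2"
  shows "1 / sqrt d * basis0 i + sqrt (1 - 1 / d) * diag_rest d i = diag_vec d i"
proof -
  have "sqrt (1 - 1 / real d) = sqrt (real (d - 1)) / sqrt d"
    using assms by (simp add: real_sqrt_divide[symmetric] of_nat_diff field_simps)
  then show ?thesis using assms by (auto simp: basis0_def diag_rest_def diag_vec_def diagonal_def)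
qed

text \<open>Sends the first basis vector to \<open>c \<Omega> + s h\<close>, where \<open>\<Omega>\<close> is maximally entangled and \<open>h\<close> is
  the uniform vector on the off-diagonal coordinates.\<close>
definition seed :: "nat \<Rightarrow> real \<Rightarrow> real \<Rightarrow> nat \<Rightarrow> nat \<Rightarrow> real" where
  "seed d c s = rot2 (d * d) c s (diag_vec d) (offdiag_vec d) (1 / sqrt d) (sqrt (1 - 1 / d)) basis0 (diag_rest d)"

text \<open>The inner rotation carries the first basis vector to \<Omega>. Its angle may be large,
  but it moves only diagonal coordinates, which carry no edge; only the outer rotation, of sine
  \<open>s\<close>, reaches off-diagonal ones.\<close>

lemma seed_column:
  assumes "d \<ge> 2" "i < d * d"
  shows "seed d c s i 0 = c * diag_vec d i + s * offdiag_vec d i"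
proof -
  have on: "orthonormal_pair (d * d) (diag_vec d) (offdiag_vec d)" using orthonormal_diag_offdiag assms by blast
  have vu: "(\<Sum>k<d * d. offdiag_vec d k * diag_vec d k) = 0"
    using on by (simp add: orthonormal_pair_def mult.commute)
  have "seed d c s i 0 = (\<Sum>k<d * d. rot c s (diag_vec d) (offdiag_vec d) i k * diag_vec d k)"
    unfolding seed_def rot2_def
    by (intro sum.cong refl) (simp only: lessThan_iff rot_basis0_column basis0_rest_diag[OF assms(1)])
  also have "\<dots> = (\<Sum>k<d * d. of_bool (i = k) * diag_vec d k + ((c - 1) * diag_vec d i + s * offdiag_vec d i) * (diag_vec d k * diag_vec d k)
      + ((c - 1) * offdiag_vec d i - s * diag_vec d i) * (offdiag_vec d k * diag_vec d k))"
    by (intro sum.cong refl) (simp add: rot_def algebra_simps)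
  also have "\<dots> = diag_vec d i + ((c - 1) * diag_vec d i + s * offdiag_vec d i)"
    using on vu assms(2)
    by (simp add: sum.distrib sum_distrib_left[symmetric] orthonormal_pair_def of_bool_def
        if_distrib[of "\<lambda>x. x * _"] cong: if_cong)
  finally show ?thesis by (simp add: algebra_simps)
qed

lemma unitary_seed:
  assumes "d \<ge> 2" "c\<^sup>2 + s\<^sup>2 = 1"
  shows "unitary_mat (cmat (d * d) (seed d c s)) (d * d)"
  unfolding seed_def
  by (intro unitary_rot2 orthonormal_diag_offdiag orthonormal_basis0_rest assms)
    (use assms in \<open>simp add: power_divide\<close>)

text \<open>An unordered pair encoded as a set of at most one ordered pair, so that (a, b) and (b,
  a) share a sign and H is symmetric; the diagonal gets the empty set and hence the sign 1.\<close>

definition edge :: "nat \<Rightarrow> nat \<Rightarrow> (nat \<times> nat) set" where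
  "edge a b = (if a = b then {} else {(min a b, max a b)})"

definition edges :: "nat \<Rightarrow> (nat \<times> nat) set" where
  "edges d = {(a, b). a < b \<and> b < d}"

text \<open>The additional \<open>mod d\<close> makes the map periodic with period
  \<open>d * d\<close>, so one definition serves all blocks of the full register.\<close>

definition edge_of :: "nat \<Rightarrow> nat \<Rightarrow> (nat \<times> nat) set" where
  "edge_of d i = edge (i div d mod d) (i mod d)"

lemma edge_of_block: "a < d \<Longrightarrow> b < d \<Longrightarrow> edge_of d (a * d + b) = edge a b"
  by (simp add: edge_of_def)

lemma edge_of_mod: "d > 0 \<Longrightarrow> edge_of d (i mod (d * d)) = edge_of d i"
  by (simp add: edge_of_def mod_mult2_eq mod_mod_cancel)

lemma finite_edges [simp]: "finite (edges d)"
  by (rule finite_subset[of _ "{..<d} \<times> {..<d}"]) (auto simp: edges_def)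

lemma edge_of_subset: "d > 0 \<Longrightarrow> edge_of d i \<subseteq> edges d"
  by (auto simp: edge_of_def edge_def edges_def min_def max_def)

lemma card_edge: "card (edge a b) = of_bool (a \<noteq> b)"
  by (simp add: edge_def)

lemma card_edge_of: "card (edge_of d i) \<le> 1"
  by (simp add: edge_of_def card_edge)

text \<open>An edge of \<open>S\<close> charges only the coordinates (a, b) and (b, a), each of
  weight 1 / (d (d - 1)).\<close>

lemma sum_offdiag_charged:
  assumes "d \<ge> 2" "finite S"
  shows "(\<Sum>i | i < d * d \<and> charged (edge_of d) S i. (offdiag_vec d i)\<^sup>2) \<le> 2 * real (card S) / (real d * real (d - 1))"
proof -
  let ?X = "{i. i < d * d \<and> charged (edge_of d) S i}"
  have "?X \<subseteq> (\<lambda>(a, b). a * d + b) ` S \<union> (\<lambda>(a, b). b * d + a) ` S"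
  proof
    fix i assume "i \<in> ?X"
    then have i: "i < d * d" "edge_of d i \<noteq> {}" "edge_of d i \<subseteq> S" by (auto simp: charged_def)
    have "i div d < d" using i(1) by (simp add: less_mult_imp_div_less)
    then have "edge_of d i = edge (i div d) (i mod d)" by (simp add: edge_of_def)
    then have "(i div d, i mod d) \<in> S \<or> (i mod d, i div d) \<in> S"
      using i(2,3) by (auto simp: edge_def min_def max_def split: if_splits)
    then show "i \<in> (\<lambda>(a, b). a * d + b) ` S \<union> (\<lambda>(a, b). b * d + a) ` S"
    proof
      assume "(i div d, i mod d) \<in> S"
      then show "i \<in> (\<lambda>(a, b). a * d + b) ` S \<union> (\<lambda>(a, b). b * d + a) ` S" by (intro UnI1 rev_image_eqI[where x = "(i div d, i mod d)"]) auto
    next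
      assume "(i mod d, i div d) \<in> S"
      then show "i \<in> (\<lambda>(a, b). a * d + b) ` S \<union> (\<lambda>(a, b). b * d + a) ` S" by (intro UnI2 rev_image_eqI[where x = "(i mod d, i div d)"]) auto
    qed
  qed
  then have "card ?X \<le> card ((\<lambda>(a, b). a * d + b) ` S \<union> (\<lambda>(a, b). b * d + a) ` S)"
    using assms(2) by (intro card_mono) auto
  also have "\<dots> \<le> card S + card S"
    by (rule order_trans[OF card_Un_le]) (intro add_mono card_image_le assms)
  finally have X: "real (card ?X) \<le> 2 * real (card S)" by simp
  have "(\<Sum>i\<in>?X. (offdiag_vec d i)\<^sup>2) \<le> (\<Sum>i\<in>?X. 1 / (real d * real (d - 1)))"
    by (intro sum_mono) (auto simp: offdiag_vec_def power_divide)
  also have "\<dots> = card ?X / (real d * real (d - 1))" by simp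
  also have "\<dots> \<le> 2 * real (card S) / (real d * real (d - 1))" using X by (intro divide_right_mono) auto
  finally show ?thesis .
qed

text \<open>A charged coordinate is off-diagonal, so of the four vectors defining the rotations only
  \<open>offdiag_vec\<close> is nonzero there, and its weight on the charged coordinates is small.
  The transposed form covers inverse queries.\<close>

lemma almost_fixes_seed:
  assumes "d \<ge> 2" "c\<^sup>2 + s\<^sup>2 = 1" "0 \<le> c" "0 \<le> s" "finite S" "card S \<le> m"
  shows "almost_fixes (d * d) (charged (edge_of d) S) (\<lambda>i j. complex_of_real (seed d c s i j)) (2 * s * sqrt (2 * real m / (real d * real (d - 1))))"
    and "almost_fixes (d * d) (charged (edge_of d) S) (\<lambda>i j. complex_of_real (seed d c s j i)) (2 * s * sqrt (2 * real m / (real d * real (d - 1))))"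
proof -
  \<comment> \<open>Beyond \<open>d * d\<close> the folding in \<open>edge_of\<close> no longer
    matches \<open>diagonal\<close>; hence the restriction of the predicate.\<close>
  let ?b = "\<lambda>i. i < d * d \<and> charged (edge_of d) S i"
  let ?\<eta> = "2 * s * sqrt (2 * real m / (real d * real (d - 1)))"
  have b: "\<not> diagonal d i" if "?b i" for i
  proof
    assume "diagonal d i"
    moreover have "i div d < d" using that by (simp add: less_mult_imp_div_less)
    ultimately have "edge_of d i = {}" by (simp add: diagonal_def edge_of_def edge_def)
    then show False using that by (simp add: charged_def)
  qed
  have b0: "diag_vec d i = 0" "diag_rest d i = 0" "basis0 i = 0" if "?b i" for i
    using b[OF that] by (cases "i = 0"; simp add: diag_vec_def diag_rest_def basis0_def diagonal_def)+
  have cs': "(1 / sqrt d)\<^sup>2 + (sqrt (1 - 1 / d))\<^sup>2 = 1" using assms(1) by (simp add: power_divide)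
  have "2 * real (card S) / (real d * real (d - 1)) \<le> 2 * real m / (real d * real (d - 1))"
    using assms(6) by (intro divide_right_mono) auto
  then have "4 * s\<^sup>2 * (\<Sum>i | i < d * d \<and> ?b i. (offdiag_vec d i)\<^sup>2) \<le> 4 * s\<^sup>2 * (2 * real m / (real d * real (d - 1)))"
    using sum_offdiag_charged[OF assms(1,5)] by (intro mult_left_mono) auto
  also have "\<dots> = ?\<eta>\<^sup>2" by (simp add: power_mult_distrib)
  finally have \<eta>: "4 * s\<^sup>2 * (\<Sum>i | i < d * d \<and> ?b i. (offdiag_vec d i)\<^sup>2) \<le> ?\<eta>\<^sup>2" .
  note on = orthonormal_diag_offdiag[OF assms(1)] orthonormal_basis0_rest[OF assms(1)]
  have eq: "almost_fixes (d * d) (charged (edge_of d) S) A ?\<eta> = almost_fixes (d * d) ?b A ?\<eta>" for A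
    by (simp add: almost_fixes_def conj_commute cong: conj_cong)
  have nn: "?\<eta> \<ge> 0" using assms by simp
  show "almost_fixes (d * d) (charged (edge_of d) S) (\<lambda>i j. complex_of_real (seed d c s i j)) ?\<eta>"
    unfolding eq seed_def using b0 \<eta> nn by (intro almost_fixes_rot2(1)[OF on(1) assms(2,3) on(2) cs']) auto
  show "almost_fixes (d * d) (charged (edge_of d) S) (\<lambda>i j. complex_of_real (seed d c s j i)) ?\<eta>"
    unfolding eq seed_def using b0 \<eta> nn by (intro almost_fixes_rot2(2)[OF on(1) assms(2,3) on(2) cs']) auto
qed

section \<open>Random sign matrices\<close>

lemma unitary_gauge:
  assumes "unitary_mat A n" and \<zeta>: "\<And>i. cmod (\<zeta> i) = 1"
  shows "unitary_mat (mat n n (\<lambda>(i, j). gauge \<zeta> (\<lambda>i j. A $$ (i, j)) i j)) n"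
proof (subst unitary_mat_iff)
  have A: "A \<in> carrier_mat n n" using assms(1) by (simp add: unitary_mat_def)
  have \<zeta>1: "cnj (\<zeta> k) * \<zeta> k = 1" for k
    using \<zeta>[of k] by (metis complex_norm_square of_real_1 one_power2 mult.commute)
  show "\<forall>i<n. \<forall>j<n. (\<Sum>k<n. mat n n (\<lambda>(i, j). gauge \<zeta> (\<lambda>i j. A $$ (i, j)) i j) $$ (i, k)
      * cnj (mat n n (\<lambda>(i, j). gauge \<zeta> (\<lambda>i j. A $$ (i, j)) i j) $$ (j, k))) = of_bool (i = j)"
  proof (intro allI impI)
    fix i j assume ij: "i < n" "j < n"
    have "(\<Sum>k<n. mat n n (\<lambda>(i, j). gauge \<zeta> (\<lambda>i j. A $$ (i, j)) i j) $$ (i, k)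
      * cnj (mat n n (\<lambda>(i, j). gauge \<zeta> (\<lambda>i j. A $$ (i, j)) i j) $$ (j, k)))
      = (\<Sum>k<n. \<zeta> i * cnj (\<zeta> j) * (A $$ (i, k) * cnj (A $$ (j, k))))"
    proof (intro sum.cong refl)
      fix k assume k: "k \<in> {..<n}"
      have "\<zeta> i * A $$ (i, k) * cnj (\<zeta> k) * (cnj (\<zeta> j) * cnj (A $$ (j, k)) * \<zeta> k)
          = (cnj (\<zeta> k) * \<zeta> k) * (\<zeta> i * cnj (\<zeta> j) * (A $$ (i, k) * cnj (A $$ (j, k))))"
        by (simp only: mult_ac)
      then show "mat n n (\<lambda>(i, j). gauge \<zeta> (\<lambda>i j. A $$ (i, j)) i j) $$ (i, k)
          * cnj (mat n n (\<lambda>(i, j). gauge \<zeta> (\<lambda>i j. A $$ (i, j)) i j) $$ (j, k))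
          = \<zeta> i * cnj (\<zeta> j) * (A $$ (i, k) * cnj (A $$ (j, k)))"
        using ij k by (simp add: gauge_def \<zeta>1)
    qed
    also have "\<dots> = \<zeta> i * cnj (\<zeta> j) * of_bool (i = j)"
      unfolding sum_distrib_left[symmetric] using assms(1) ij unitary_mat_iff[OF A] by simp
    also have "\<dots> = of_bool (i = j)"
      using \<zeta>1[of i] by (cases "i = j") (simp_all add: mult.commute)
    finally show "(\<Sum>k<n. mat n n (\<lambda>(i, j). gauge \<zeta> (\<lambda>i j. A $$ (i, j)) i j) $$ (i, k)
      * cnj (mat n n (\<lambda>(i, j). gauge \<zeta> (\<lambda>i j. A $$ (i, j)) i j) $$ (j, k))) = of_bool (i = j)" .
  qed
qed simp

lemma mat_mult_index:
  assumes "A \<in> carrier_mat m n" "B \<in> carrier_mat n p" "i < m" "j < p"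
  shows "(A * B) $$ (i, j) = (\<Sum>k<n. A $$ (i, k) * B $$ (k, j))"
  using assms by (simp add: scalar_prod_def atLeast0LessThan)

text \<open>The input state selects the column 0 of the oracle.\<close>

lemma oracle_state_eq:
  assumes U: "U \<in> carrier_mat (d * m) (d * m)" and pos: "d * m > 0"
  shows "oracle_state d m U = mat d d (\<lambda>(a, a'). \<Sum>k<m. U $$ (a * m + k, 0) * cnj (U $$ (a' * m + k, 0)))"
proof -
  have "(U * proj0 (d * m)) $$ (i, l) = U $$ (i, 0) * of_bool (l = 0)" if "i < d * m" "l < d * m" for i l
  proof -
    have "(U * proj0 (d * m)) $$ (i, l) = (\<Sum>k<d * m. U $$ (i, k) * proj0 (d * m) $$ (k, l))"
      using that by (intro mat_mult_index[OF U]) (simp_all add: proj0_def)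
    also have "\<dots> = (\<Sum>k<d * m. if k = 0 then U $$ (i, 0) * of_bool (l = 0) else 0)"
      using that by (intro sum.cong refl) (auto simp: proj0_def)
    finally show ?thesis using pos by simp
  qed
  note UP = this
  have "(U * proj0 (d * m) * mat_adjoint U) $$ (i, j) = U $$ (i, 0) * cnj (U $$ (j, 0))"
    if "i < d * m" "j < d * m" for i j
  proof -
    have "(U * proj0 (d * m) * mat_adjoint U) $$ (i, j) = (\<Sum>l<d * m. (U * proj0 (d * m)) $$ (i, l) * cnj (U $$ (j, l)))"
      using U that by (subst mat_mult_index[where m = "d * m" and n = "d * m" and p = "d * m"]) (auto simp: proj0_def)
    also have "\<dots> = (\<Sum>l<d * m. if l = 0 then U $$ (i, 0) * cnj (U $$ (j, 0)) else 0)"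
      using that by (intro sum.cong refl) (auto simp: UP)
    finally show ?thesis using pos by simp
  qed
  note UPU = this
  have "a * m + k < d * m" if "a < d" "k < m" for a k
  proof -
    have "a * m + k < (a + 1) * m" using that by simp
    also have "\<dots> \<le> d * m" using that by (intro mult_right_mono) auto
    finally show ?thesis .
  qed
  then show ?thesis
    unfolding oracle_state_def ptrace2_def by (intro eq_matI) (simp_all add: UPU)
qed

section \<open>The hard oracles and their reduced states\<close>

definition phase :: "nat \<Rightarrow> complex \<Rightarrow> (nat \<times> nat) set \<Rightarrow> nat \<Rightarrow> complex" where
  "phase d z Y i = walsh (edge_of d i) Y * z ^ card (edge_of d i)"

text \<open>Coordinate 0 is diagonal and has phase 1, so conjugation acts on column 0 as left
  multiplication by the phases: signs and \<open>z\<close> reach exactly the off-diagonal amplitudes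
  of the prepared vector.\<close>

definition hard_unitary :: "nat \<Rightarrow> real \<Rightarrow> real \<Rightarrow> complex \<Rightarrow> (nat \<times> nat) set \<Rightarrow> complex mat" where
  "hard_unitary d c s z Y =
     mat (d * d) (d * d) (\<lambda>(i, j). gauge (phase d z Y) (\<lambda>i j. complex_of_real (seed d c s i j)) i j)"

definition sign_mat :: "nat \<Rightarrow> (nat \<times> nat) set \<Rightarrow> complex mat" where
  "sign_mat d Y = mat d d (\<lambda>(a, b). if a = b then 0 else walsh (edge a b) Y / sqrt (real (d - 1)))"

lemma norm_phase: "cmod z = 1 \<Longrightarrow> cmod (phase d z Y i) = 1"
  by (simp add: phase_def norm_mult norm_power)

lemma unitary_hard:
  assumes "d \<ge> 2" "c\<^sup>2 + s\<^sup>2 = 1" "cmod z = 1"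
  shows "unitary_mat (hard_unitary d c s z Y) (d * d)"
proof -
  have "hard_unitary d c s z Y
      = mat (d * d) (d * d) (\<lambda>(i, j). gauge (phase d z Y) (\<lambda>i j. cmat (d * d) (seed d c s) $$ (i, j)) i j)"
    unfolding hard_unitary_def by (rule eq_matI) (auto simp: gauge_def cmat_def)
  then show ?thesis
    using unitary_gauge[OF unitary_seed[OF assms(1,2)] norm_phase[OF assms(3)]] by simp
qed

lemma sign_mat_carrier [simp]: "sign_mat d Y \<in> carrier_mat d d"
  by (simp add: sign_mat_def)

lemma sign_mat_dim [simp]: "dim_row (sign_mat d Y) = d" "dim_col (sign_mat d Y) = d"
  by (simp_all add: sign_mat_def)

lemma edge_commute: "edge a b = edge b a"
  by (auto simp: edge_def min.commute max.commute)

lemma sign_mat_sym: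
  assumes "i < d" "j < d"
  shows "sign_mat d Y $$ (j, i) = cnj (sign_mat d Y $$ (i, j))"
  using assms by (simp add: sign_mat_def edge_commute[of j i])

lemma hard_column:
  assumes "d \<ge> 2" "a < d" "b < d"
  shows "hard_unitary d c s z Y $$ (a * d + b, 0)
    = (complex_of_real c * of_bool (a = b) + z * complex_of_real s * sign_mat d Y $$ (a, b)) / complex_of_real (sqrt d)"
proof -
  have lt: "a * d + b < d * d"
  proof -
    have "a * d + b < (a + 1) * d" using assms by simp
    also have "\<dots> \<le> d * d" using assms by (intro mult_right_mono) auto
    finally show ?thesis .
  qed
  have "edge_of d 0 = {}" by (simp add: edge_of_def edge_def)
  then have "phase d z Y 0 = 1" by (simp add: phase_def walsh_def)
  then have "hard_unitary d c s z Y $$ (a * d + b, 0) = phase d z Y (a * d + b) * seed d c s (a * d + b) 0"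
    using lt assms(1) by (simp add: hard_unitary_def gauge_def)
  also have "\<dots> = (complex_of_real c * of_bool (a = b) + z * complex_of_real s * sign_mat d Y $$ (a, b)) / complex_of_real (sqrt d)"
    using assms
    by (auto simp: seed_column[OF assms(1) lt] phase_def edge_of_block card_edge sign_mat_def diag_vec_def
        offdiag_vec_def real_sqrt_mult walsh_def[of "{}"] edge_def[of b b] mult_ac)
  finally show ?thesis .
qed

text \<open>Reshaped into a matrix, column 0 is M = (c + z s H) / sqrt d, and the reduced state is M
  M^*. As H is Hermitian and |z| = 1, the value of \<open>z\<close> survives only in the cross term
  z + cnj z.\<close>

lemma oracle_state_hard:
  assumes "d \<ge> 2" "cmod z = 1"
  shows "oracle_state d d (hard_unitary d c s z Y) = complex_of_real (c\<^sup>2 / d) \<cdot>\<^sub>m 1\<^sub>m d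
    + complex_of_real (2 * c * s * Re z / d) \<cdot>\<^sub>m sign_mat d Y
    + complex_of_real (s\<^sup>2 / d) \<cdot>\<^sub>m (sign_mat d Y * sign_mat d Y)" (is "?L = ?R")
proof (rule eq_matI)
  have U: "hard_unitary d c s z Y \<in> carrier_mat (d * d) (d * d)" by (simp add: hard_unitary_def)
  have pos: "d * d > 0" using assms by simp
  show "dim_row ?L = dim_row ?R" "dim_col ?L = dim_col ?R" by (simp_all add: oracle_state_eq[OF U pos])
  fix a a' assume "a < dim_row ?R" "a' < dim_col ?R"
  then have a: "a < d" "a' < d" by simp_all
  let ?H = "sign_mat d Y"
  let ?z = "complex_of_real"
  have zz: "z * cnj z = 1" using assms(2) by (metis complex_norm_square of_real_1 one_power2)
  have zr: "z + cnj z = ?z (2 * Re z)" by (simp add: complex_add_cnj)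
  have sq: "?z (sqrt d) * ?z (sqrt d) = ?z d" by (simp flip: of_real_mult)
  have HH: "(?H * ?H) $$ (a, a') = (\<Sum>k<d. ?H $$ (a, k) * ?H $$ (k, a'))"
    using a by (simp add: scalar_prod_def atLeast0LessThan)
  have "?L $$ (a, a') = (\<Sum>k<d. (complex_of_real c * of_bool (a = k) + z * complex_of_real s * ?H $$ (a, k)) / complex_of_real (sqrt d) *
      cnj ((complex_of_real c * of_bool (a' = k) + z * complex_of_real s * ?H $$ (a', k)) / complex_of_real (sqrt d)))"
    using a by (simp add: oracle_state_eq[OF U pos] hard_column[OF assms(1)])
  also have "\<dots> = (\<Sum>k<d. (of_bool (a = k) * (complex_of_real c * complex_of_real c * of_bool (a' = k) + cnj z * complex_of_real c * complex_of_real s * ?H $$ (k, a'))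
      + of_bool (a' = k) * (z * complex_of_real c * complex_of_real s * ?H $$ (a, k)) + complex_of_real s * complex_of_real s * (?H $$ (a, k) * ?H $$ (k, a'))) / d)"
  proof (intro sum.cong refl)
    fix k assume "k \<in> {..<d}"
    then have k: "?H $$ (k, a') = cnj (?H $$ (a', k))" using sign_mat_sym[of a' d k] a by simp
    have "(complex_of_real c * of_bool (a = k) + z * complex_of_real s * ?H $$ (a, k)) / complex_of_real (sqrt d) * cnj ((complex_of_real c * of_bool (a' = k) + z * complex_of_real s * ?H $$ (a', k)) / complex_of_real (sqrt d))
       = (complex_of_real c * of_bool (a = k) + z * complex_of_real s * ?H $$ (a, k)) * (complex_of_real c * of_bool (a' = k) + cnj z * complex_of_real s * ?H $$ (k, a')) / d"
      by (simp add: k sq)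
    also have "(complex_of_real c * of_bool (a = k) + z * complex_of_real s * ?H $$ (a, k)) * (complex_of_real c * of_bool (a' = k) + cnj z * complex_of_real s * ?H $$ (k, a'))
      = of_bool (a = k) * (complex_of_real c * complex_of_real c * of_bool (a' = k) + cnj z * complex_of_real c * complex_of_real s * ?H $$ (k, a'))
      + of_bool (a' = k) * (z * complex_of_real c * complex_of_real s * ?H $$ (a, k)) + (z * cnj z) * (complex_of_real s * complex_of_real s * (?H $$ (a, k) * ?H $$ (k, a')))"
      by (simp add: algebra_simps)
    finally show "(complex_of_real c * of_bool (a = k) + z * complex_of_real s * ?H $$ (a, k)) / complex_of_real (sqrt d) * cnj ((complex_of_real c * of_bool (a' = k) + z * complex_of_real s * ?H $$ (a', k)) / complex_of_real (sqrt d))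
      = (of_bool (a = k) * (complex_of_real c * complex_of_real c * of_bool (a' = k) + cnj z * complex_of_real c * complex_of_real s * ?H $$ (k, a'))
      + of_bool (a' = k) * (z * complex_of_real c * complex_of_real s * ?H $$ (a, k)) + complex_of_real s * complex_of_real s * (?H $$ (a, k) * ?H $$ (k, a'))) / d"
      by (simp add: zz)
  qed
  also have "\<dots> = ((complex_of_real c * complex_of_real c * of_bool (a = a') + cnj z * complex_of_real c * complex_of_real s * ?H $$ (a, a')) + z * complex_of_real c * complex_of_real s * ?H $$ (a, a')
      + complex_of_real s * complex_of_real s * (\<Sum>k<d. ?H $$ (a, k) * ?H $$ (k, a'))) / d"
    using a by (simp add: sum_divide_distrib[symmetric] sum.distrib sum_distrib_left[symmetric] of_bool_def
        if_distrib[of "\<lambda>x. x * _"] eq_commute[of a' a] cong: if_cong)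
  also have "\<dots> = (complex_of_real c * complex_of_real c * of_bool (a = a') + (z + cnj z) * complex_of_real c * complex_of_real s * ?H $$ (a, a') + complex_of_real s * complex_of_real s * (?H * ?H) $$ (a, a')) / d"
    unfolding HH by (simp add: algebra_simps)
  also have "\<dots> = ?R $$ (a, a')"
    unfolding zr using a by (simp add: power2_eq_square add_divide_distrib mult_ac del: index_mult_mat(1))
  finally show "?L $$ (a, a') = ?R $$ (a, a')" .
qed

section \<open>Moments of the sign matrix\<close>

lemma mtrace_hermitian_square:
  assumes A: "A \<in> carrier_mat n n" and "\<And>i j. i < n \<Longrightarrow> j < n \<Longrightarrow> A $$ (j, i) = cnj (A $$ (i, j))"
  shows "mtrace (A * A) = complex_of_real (\<Sum>i<n. \<Sum>j<n. (cmod (A $$ (i, j)))\<^sup>2)"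
proof -
  have "mtrace (A * A) = (\<Sum>i<n. \<Sum>j<n. A $$ (i, j) * A $$ (j, i))"
    using A by (simp add: mtrace_def scalar_prod_def atLeast0LessThan)
  also have "\<dots> = (\<Sum>i<n. \<Sum>j<n. complex_of_real ((cmod (A $$ (i, j)))\<^sup>2))"
  proof (intro sum.cong refl)
    fix i j assume "i \<in> {..<n}" "j \<in> {..<n}"
    then have "A $$ (j, i) = cnj (A $$ (i, j))" by (intro assms(2)) auto
    then show "A $$ (i, j) * A $$ (j, i) = complex_of_real ((cmod (A $$ (i, j)))\<^sup>2)"
      by (simp only: complex_norm_square)
  qed
  finally show ?thesis by simp
qed

lemma hermitian_square:
  assumes A: "A \<in> carrier_mat n n" and h: "\<And>i j. i < n \<Longrightarrow> j < n \<Longrightarrow> A $$ (j, i) = cnj (A $$ (i, j))"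
    and "i < n" "j < n"
  shows "(A * A) $$ (j, i) = cnj ((A * A) $$ (i, j))"
proof -
  have "(A * A) $$ (j, i) = (\<Sum>k<n. A $$ (j, k) * A $$ (k, i))"
    using A assms(3,4) by (simp add: scalar_prod_def atLeast0LessThan)
  also have "\<dots> = (\<Sum>k<n. cnj (A $$ (i, k)) * cnj (A $$ (k, j)))"
  proof (intro sum.cong refl)
    fix k assume "k \<in> {..<n}"
    then show "A $$ (j, k) * A $$ (k, i) = cnj (A $$ (i, k)) * cnj (A $$ (k, j))"
      using h[of i k] h[of k j] assms(3,4) by simp
  qed
  also have "\<dots> = cnj (\<Sum>k<n. A $$ (i, k) * A $$ (k, j))" by simp
  also have "(\<Sum>k<n. A $$ (i, k) * A $$ (k, j)) = (A * A) $$ (i, j)"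
    using A assms(3,4) by (simp add: scalar_prod_def atLeast0LessThan)
  finally show ?thesis .
qed

text \<open>This is tr H^4, written as the squared Frobenius norm of H^2.\<close>

definition quartic :: "nat \<Rightarrow> (nat \<times> nat) set \<Rightarrow> real" where
  "quartic d Y = (\<Sum>i<d. \<Sum>j<d. (cmod ((sign_mat d Y * sign_mat d Y) $$ (i, j)))\<^sup>2)"

lemma norm_sign_mat:
  assumes "d \<ge> 2" "i < d" "j < d"
  shows "(cmod (sign_mat d Y $$ (i, j)))\<^sup>2 = of_bool (i \<noteq> j) / real (d - 1)"
  using assms by (simp add: sign_mat_def norm_divide power_divide)

lemma sum_norm_sign_mat:
  assumes "d \<ge> 2" "i < d"
  shows "(\<Sum>j<d. (cmod (sign_mat d Y $$ (i, j)))\<^sup>2) = 1"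
proof -
  have "(\<Sum>j<d. (cmod (sign_mat d Y $$ (i, j)))\<^sup>2) = (\<Sum>j<d. of_bool (i \<noteq> j) / real (d - 1))"
    using assms by (intro sum.cong refl) (simp add: norm_sign_mat)
  also have "\<dots> = (\<Sum>j<d. of_bool (i \<noteq> j)) / real (d - 1)" by (simp only: sum_divide_distrib)
  also have "\<dots> = 1" unfolding sum_of_bool_eq(2)[OF assms(2)] using assms(1) by simp
  finally show ?thesis .
qed

lemma mtrace_sign_mat:
  assumes "d \<ge> 2"
  shows "mtrace (sign_mat d Y) = 0" "mtrace (sign_mat d Y * sign_mat d Y) = of_nat d"
    "mtrace (sign_mat d Y * sign_mat d Y * (sign_mat d Y * sign_mat d Y)) = of_real (quartic d Y)"
proof -
  let ?H = "sign_mat d Y"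
  show "mtrace ?H = 0" by (simp add: mtrace_def sign_mat_def)
  have "mtrace (?H * ?H) = of_real (\<Sum>i<d. \<Sum>j<d. (cmod (?H $$ (i, j)))\<^sup>2)"
    by (intro mtrace_hermitian_square sign_mat_sym) auto
  also have "(\<Sum>i<d. \<Sum>j<d. (cmod (?H $$ (i, j)))\<^sup>2) = (\<Sum>i<d. 1)"
    using assms by (intro sum.cong refl sum_norm_sign_mat) auto
  finally show "mtrace (?H * ?H) = of_nat d" by simp
  show "mtrace (?H * ?H * (?H * ?H)) = of_real (quartic d Y)"
    unfolding quartic_def
    by (intro mtrace_hermitian_square hermitian_square[of _ d] sign_mat_sym) (auto intro!: mult_carrier_mat[of _ d d])
qed

lemma hard_entropy:
  assumes d: "d \<ge> 2" and cs: "c\<^sup>2 + s\<^sup>2 = 1" "0 \<le> c" and q: "quartic d Y \<le> m * d"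
  shows "vn_entropy (oracle_state d d (hard_unitary d c s \<i> Y)) \<ge> ln d - s ^ 4 * (m - 1)"
    and "vn_entropy (oracle_state d d (hard_unitary d c s 1 Y)) \<le> ln d - s\<^sup>2 + 8 * (m + 1) * s ^ 4"
proof -
  let ?H = "sign_mat d Y"
  have H: "?H \<in> carrier_mat d d" by simp
  obtain es where es: "char_poly ?H = (\<Prod>e\<leftarrow>es. [:- e, 1:])" "length es = d"
    using char_poly_factorized[OF H] by auto
  have real: "complex_of_real (Re e) = e" if "e \<in> set es" for e
    using hermitian_root_real[OF H sign_mat_sym es(1) that] by (simp add: complex_eq_iff)
  define hs where "hs = map Re es"
  have es_eq: "es = map complex_of_real hs"
    unfolding hs_def using real by (simp add: map_idI)
  note sm = spectral_mapping[OF H es(1)]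
  have of_real_list: "(\<Sum>h\<leftarrow>xs. complex_of_real (f h)) = complex_of_real (\<Sum>h\<leftarrow>xs. f h)" for f :: "real \<Rightarrow> real" and xs
    by (induction xs) auto
  have h1: "sum_list hs = 0"
    using sm(2) of_real_list[of "\<lambda>h. h" hs] by (simp add: es_eq mtrace_sign_mat[OF d] o_def)
  have "complex_of_real (\<Sum>h\<leftarrow>hs. h\<^sup>2) = complex_of_real (real d)"
    using sm(3) by (simp add: es_eq mtrace_sign_mat[OF d] o_def flip: of_real_list)
  then have h2: "(\<Sum>h\<leftarrow>hs. h\<^sup>2) = d" using of_real_eq_iff by blast
  have "complex_of_real (\<Sum>h\<leftarrow>hs. h ^ 4) = complex_of_real (quartic d Y)"
    using sm(4) by (simp add: es_eq mtrace_sign_mat[OF d] o_def flip: of_real_list)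
  then have h4: "(\<Sum>h\<leftarrow>hs. h ^ 4) \<le> m * d" using of_real_eq_iff q by metis
  have len: "real (length hs) = d" using es(2) by (simp add: hs_def)
  have "c\<^sup>2 \<le> 1\<^sup>2" using cs(1) by (metis le_add_same_cancel1 one_power2 zero_le_power2)
  then have c1: "c \<le> 1" by (rule power2_le_imp_le) simp
  have ent: "vn_entropy (oracle_state d d (hard_unitary d c s z Y))
      = - (\<Sum>h\<leftarrow>hs. ((c\<^sup>2 + 2 * c * s * Re z * h + s\<^sup>2 * h\<^sup>2) / d) * ln ((c\<^sup>2 + 2 * c * s * Re z * h + s\<^sup>2 * h\<^sup>2) / d))"
    if "cmod z = 1" for z
  proof -
    let ?\<rho> = "complex_of_real (c\<^sup>2 / d) \<cdot>\<^sub>m 1\<^sub>m d + complex_of_real (2 * c * s * Re z / d) \<cdot>\<^sub>m ?H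
      + complex_of_real (s\<^sup>2 / d) \<cdot>\<^sub>m (?H * ?H)"
    have "vn_entropy ?\<rho> = - (\<Sum>a\<leftarrow>map (\<lambda>e. complex_of_real (c\<^sup>2 / d) + complex_of_real (2 * c * s * Re z / d) * e
        + complex_of_real (s\<^sup>2 / d) * e\<^sup>2) es. Re a * ln (Re a))"
      by (rule vn_entropy_eq[where n = d, OF _ sm(1)]) (auto intro!: mult_carrier_mat[of _ d d])
    also have "\<dots> = - (\<Sum>h\<leftarrow>hs. ((c\<^sup>2 + 2 * c * s * Re z * h + s\<^sup>2 * h\<^sup>2) / d) * ln ((c\<^sup>2 + 2 * c * s * Re z * h + s\<^sup>2 * h\<^sup>2) / d))"
      unfolding es_eq map_map o_def
      by (intro arg_cong[where f = uminus] arg_cong[where f = sum_list] map_cong refl)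
        (simp add: add_divide_distrib flip: of_real_mult of_real_add of_real_power)
    finally show ?thesis unfolding oracle_state_hard[OF d that] .
  qed
  have d0: "real d > 0" using d by simp
  show "vn_entropy (oracle_state d d (hard_unitary d c s \<i> Y)) \<ge> ln d - s ^ 4 * (m - 1)"
    using spectral_entropy_ge[OF d0 len cs c1 h1 h2 h4] by (simp add: ent)
  have "(c + s * h)\<^sup>2 = c\<^sup>2 + 2 * c * s * h + s\<^sup>2 * h\<^sup>2" for h
    by (simp add: power2_eq_square algebra_simps)
  then show "vn_entropy (oracle_state d d (hard_unitary d c s 1 Y)) \<le> ln d - s\<^sup>2 + 8 * (m + 1) * s ^ 4"
    using spectral_entropy_le[OF d0 len cs c1 h1 h2 h4] by (simp add: ent)
qed

lemma sum_norm_walsh_family: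
  assumes P: "finite P" and B: "finite B" and f: "inj_on f B" "\<And>b. b \<in> B \<Longrightarrow> f b \<subseteq> P"
  shows "(\<Sum>Y\<in>Pow P. (cmod (\<Sum>b\<in>B. walsh (f b) Y))\<^sup>2) = 2 ^ card P * real (card B)"
proof -
  have "(\<Sum>b\<in>B. walsh (f b) Y) = (\<Sum>S\<in>Pow P. walsh S Y * of_bool (S \<in> f ` B))" for Y
  proof -
    have "(\<Sum>b\<in>B. walsh (f b) Y) = (\<Sum>S\<in>f ` B. walsh S Y)"
      using sum.reindex[OF f(1), of "\<lambda>S. walsh S Y"] by simp
    also have "\<dots> = (\<Sum>S\<in>f ` B. walsh S Y * of_bool (S \<in> f ` B))" by (intro sum.cong) auto
    also have "\<dots> = (\<Sum>S\<in>Pow P. walsh S Y * of_bool (S \<in> f ` B))"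
      by (intro sum.mono_neutral_left) (use P f in auto)
    finally show ?thesis .
  qed
  then have "(\<Sum>Y\<in>Pow P. (cmod (\<Sum>b\<in>B. walsh (f b) Y))\<^sup>2)
      = 2 ^ card P * (\<Sum>S\<in>Pow P. (cmod (of_bool (S \<in> f ` B)))\<^sup>2)"
    using walsh_parseval[OF P] by simp
  also have "(\<Sum>S\<in>Pow P. (cmod (of_bool (S \<in> f ` B)))\<^sup>2) = (\<Sum>S\<in>Pow P. if S \<in> f ` B then 1 else 0)"
    by (intro sum.cong) auto
  also have "\<dots> = real (card (Pow P \<inter> f ` B))" using P by (simp flip: sum.inter_restrict)
  also have "Pow P \<inter> f ` B = f ` B" using f(2) by auto
  also have "card (f ` B) = card B" by (rule card_image[OF f(1)])
  finally show ?thesis .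
qed

lemma sign_mat_square_diag:
  assumes "d \<ge> 2" "i < d"
  shows "(sign_mat d Y * sign_mat d Y) $$ (i, i) = 1"
proof -
  have "(sign_mat d Y * sign_mat d Y) $$ (i, i) = (\<Sum>k<d. sign_mat d Y $$ (i, k) * sign_mat d Y $$ (k, i))"
    using assms by (intro mat_mult_index) auto
  also have "\<dots> = (\<Sum>k<d. complex_of_real ((cmod (sign_mat d Y $$ (i, k)))\<^sup>2))"
  proof (intro sum.cong refl)
    fix k assume "k \<in> {..<d}"
    then have "sign_mat d Y $$ (k, i) = cnj (sign_mat d Y $$ (i, k))" using assms by (intro sign_mat_sym) auto
    then show "sign_mat d Y $$ (i, k) * sign_mat d Y $$ (k, i) = complex_of_real ((cmod (sign_mat d Y $$ (i, k)))\<^sup>2)"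
      by (simp only: complex_norm_square)
  qed
  also have "\<dots> = 1" unfolding of_real_sum[symmetric] sum_norm_sign_mat[OF assms] by simp
  finally show ?thesis .
qed

text \<open>The entry sums the characters of the paths i - b - j over the intermediate vertices b.
  Different b give different pairs of edges, so no two terms correlate.\<close>

lemma sign_mat_square_offdiag:
  assumes "d \<ge> 2" "i < d" "j < d" "i \<noteq> j"
  shows "(\<Sum>Y\<in>Pow (edges d). (cmod ((sign_mat d Y * sign_mat d Y) $$ (i, j)))\<^sup>2) \<le> 2 ^ card (edges d) / real (d - 1)"
proof -
  define B where "B = {..<d} - {i, j}"
  define f where "f b = edge i b \<union> edge b j" for b
  have fsub: "f b \<subseteq> edges d" if "b \<in> B" for b
    using that assms by (auto simp: f_def B_def edge_def edges_def min_def max_def)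
  have inj: "inj_on f B"
  proof (rule inj_onI)
    fix b b' assume b: "b \<in> B" "b' \<in> B" and eq: "f b = f b'"
    \<comment> \<open>The endpoints of the path are i, j and the intermediate vertex, so the path
      determines that vertex.\<close>
    have "b \<in> (\<Union>(x, y)\<in>f b. {x, y})" "(\<Union>(x, y)\<in>f b'. {x, y}) \<subseteq> {i, j, b'}"
      using b assms by (auto simp: f_def B_def edge_def min_def max_def)
    then show "b = b'" using eq b by (auto simp: B_def)
  qed
  have "(sign_mat d Y * sign_mat d Y) $$ (i, j) = (\<Sum>b\<in>B. walsh (f b) Y) / real (d - 1)" for Y
  proof -
    have "(sign_mat d Y * sign_mat d Y) $$ (i, j) = (\<Sum>k<d. sign_mat d Y $$ (i, k) * sign_mat d Y $$ (k, j))"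
      using assms by (intro mat_mult_index) auto
    also have "\<dots> = (\<Sum>k\<in>B. sign_mat d Y $$ (i, k) * sign_mat d Y $$ (k, j))"
      by (intro sum.mono_neutral_right) (auto simp: B_def sign_mat_def assms)
    also have "\<dots> = (\<Sum>k\<in>B. walsh (f k) Y / real (d - 1))"
    proof (intro sum.cong refl)
      fix k assume k: "k \<in> B"
      have "edge i k \<inter> edge k j = {}" using k assms by (auto simp: B_def edge_def min_def max_def split: if_splits)
      then have "f k = sym_diff (edge i k) (edge k j)" by (auto simp: f_def)
      then have "walsh (f k) Y = walsh (edge i k) Y * walsh (edge k j) Y"
        by (simp only:) (intro walsh_sym_diff, auto simp: edge_def)
      moreover have "complex_of_real (sqrt (real (d - 1))) * complex_of_real (sqrt (real (d - 1))) = real (d - 1)"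
        by (simp flip: of_real_mult)
      ultimately show "sign_mat d Y $$ (i, k) * sign_mat d Y $$ (k, j) = walsh (f k) Y / real (d - 1)"
        using k assms by (auto simp: B_def sign_mat_def)
    qed
    finally show ?thesis by (simp only: sum_divide_distrib)
  qed
  then have "(cmod ((sign_mat d Y * sign_mat d Y) $$ (i, j)))\<^sup>2
      = (cmod (\<Sum>b\<in>B. walsh (f b) Y))\<^sup>2 / (real (d - 1))\<^sup>2" for Y
    by (simp only: norm_divide power_divide norm_of_real norm_of_nat abs_of_nat of_real_of_nat_eq)
  then have "(\<Sum>Y\<in>Pow (edges d). (cmod ((sign_mat d Y * sign_mat d Y) $$ (i, j)))\<^sup>2)
      = (\<Sum>Y\<in>Pow (edges d). (cmod (\<Sum>b\<in>B. walsh (f b) Y))\<^sup>2) / (real (d - 1))\<^sup>2"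
    by (simp only: sum_divide_distrib)
  also have "\<dots> = 2 ^ card (edges d) * real (card B) / (real (d - 1))\<^sup>2"
    using fsub by (subst sum_norm_walsh_family[OF _ _ inj]) (auto simp: B_def)
  also have "\<dots> \<le> 2 ^ card (edges d) * real (d - 1) / (real (d - 1))\<^sup>2"
  proof (intro divide_right_mono mult_left_mono)
    have "card B \<le> d - 1" using assms card_Diff_subset[of "{i, j}" "{..<d}"] by (simp add: B_def)
    then show "real (card B) \<le> real (d - 1)" by simp
  qed auto
  also have "\<dots> = 2 ^ card (edges d) / real (d - 1)"
    using assms by (simp add: power2_eq_square)
  finally show ?thesis .
qed

text \<open>On average the diagonal of H^2 contributes d and the off-diagonal entries at most
  d.\<close>

lemma sum_quartic:
  assumes "d \<ge> 2"
  shows "(\<Sum>Y\<in>Pow (edges d). quartic d Y) \<le> 2 * real d * 2 ^ card (edges d)"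
proof -
  let ?P = "Pow (edges d)" and ?N = "2 ^ card (edges d) :: real"
  have "(\<Sum>Y\<in>?P. quartic d Y)
      = (\<Sum>i<d. \<Sum>j<d. \<Sum>Y\<in>?P. (cmod ((sign_mat d Y * sign_mat d Y) $$ (i, j)))\<^sup>2)"
    unfolding quartic_def by (subst sum.swap) (intro sum.cong refl sum.swap)
  also have "\<dots> \<le> (\<Sum>i<d. \<Sum>j<d. ?N * of_bool (i = j) + ?N / real (d - 1) * of_bool (i \<noteq> j))"
  proof (intro sum_mono)
    fix i j assume ij: "i \<in> {..<d}" "j \<in> {..<d}"
    show "(\<Sum>Y\<in>?P. (cmod ((sign_mat d Y * sign_mat d Y) $$ (i, j)))\<^sup>2)
        \<le> ?N * of_bool (i = j) + ?N / real (d - 1) * of_bool (i \<noteq> j)"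
    proof (cases "i = j")
      case True
      then show ?thesis using ij sign_mat_square_diag[OF assms] by (simp add: card_Pow del: index_mult_mat(1))
    next
      case False
      then show ?thesis using ij sign_mat_square_offdiag[OF assms, of i j] by (simp del: index_mult_mat(1))
    qed
  qed
  also have "\<dots> = (\<Sum>i<d. ?N + ?N / real (d - 1) * real (d - 1))"
  proof (intro sum.cong refl)
    fix i assume "i \<in> {..<d}"
    then have i: "i < d" by simp
    show "(\<Sum>j<d. ?N * of_bool (i = j) + ?N / real (d - 1) * of_bool (i \<noteq> j)) = ?N + ?N / real (d - 1) * real (d - 1)"
      unfolding sum.distrib sum_distrib_left[symmetric] sum_of_bool_eq[OF i] by simp
  qed
  also have "\<dots> = 2 * real d * ?N" using assms by simp
  finally show ?thesis .
qed

lemma quartic_nonneg: "quartic d Y \<ge> 0"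
  by (simp add: quartic_def sum_nonneg)

text \<open>Markov's inequality: the mean is at most \<open>2 * d\<close>, so at most a tenth of the
  sign patterns exceed \<open>20 * d\<close>.\<close>

lemma card_quartic_large:
  assumes "d \<ge> 2"
  shows "10 * real (card {Y \<in> Pow (edges d). \<not> quartic d Y \<le> 20 * real d}) \<le> 2 ^ card (edges d)"
proof -
  let ?X = "{Y \<in> Pow (edges d). \<not> quartic d Y \<le> 20 * real d}"
  have "(20 * real d) * real (card ?X) = (\<Sum>Y\<in>?X. 20 * real d)" by simp
  also have "\<dots> \<le> (\<Sum>Y\<in>?X. quartic d Y)" by (intro sum_mono) auto
  also have "\<dots> \<le> (\<Sum>Y\<in>Pow (edges d). quartic d Y)"
    by (intro sum_mono2) (auto simp: quartic_nonneg)
  also have "\<dots> \<le> 2 * real d * 2 ^ card (edges d)" by (rule sum_quartic[OF assms])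
  finally have "(2 * real d) * (10 * real (card ?X)) \<le> (2 * real d) * 2 ^ card (edges d)" by simp
  then show ?thesis using assms by (simp only: mult_le_cancel_left)
qed

section \<open>Lower bounds for entropy estimators\<close>

lemma ctrl_cong:
  assumes "D > 0" "\<And>i j. i < D \<Longrightarrow> j < D \<Longrightarrow> W i j = W' i j"
  shows "ctrl k D W = ctrl k D W'"
  using assms by (simp add: ctrl_def fun_eq_iff)

lemma opbound_ctrl_diff:
  assumes "opbound D (\<lambda>i j. W i j - W' i j) \<eta>"
  shows "opbound (2 * k * D) (\<lambda>i j. ctrl k D W i j - ctrl k D W' i j) \<eta>"
  unfolding opbound_def
proof
  fix v
  let ?M = "mapp (2 * k * D) (\<lambda>i j. ctrl k D W i j - ctrl k D W' i j) v"
  have "sqnorm D (\<lambda>i. ?M (g * D + i)) \<le> \<eta>\<^sup>2 * sqnorm D (\<lambda>i. v (g * D + i))" if "g < 2 * k" for g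
  proof -
    have "sqnorm D (\<lambda>i. ?M (g * D + i))
        = sqnorm D (\<lambda>i. if g < k then 0 else mapp D (\<lambda>i j. W i j - W' i j) (\<lambda>j. v (g * D + j)) i)"
      by (intro sqnorm_cong) (simp add: mapp_diff_left mapp_ctrl that)
    also have "\<dots> \<le> \<eta>\<^sup>2 * sqnorm D (\<lambda>i. v (g * D + i))"
      using assms by (cases "g < k") (simp_all add: opbound_def sqnorm_def[of D "\<lambda>i. 0"])
    finally show ?thesis .
  qed
  then show "sqnorm (2 * k * D) ?M \<le> \<eta>\<^sup>2 * sqnorm (2 * k * D) v"
    unfolding sqnorm_blocks sum_distrib_left by (auto intro: sum_mono)
qed

lemma sqnorm_column:
  assumes "unitary_mat A n" "n > 0"
  shows "sqnorm n (\<lambda>i. A $$ (i, 0)) = 1"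
proof -
  have "sqnorm n (mapp n (\<lambda>i j. A $$ (i, j)) (\<lambda>j. of_bool (j = 0))) = sqnorm n (\<lambda>j. of_bool (j = 0))"
    by (rule sqnorm_mapp_unitary[OF assms(1)])
  moreover have "mapp n (\<lambda>i j. A $$ (i, j)) (\<lambda>j. of_bool (j = 0)) = (\<lambda>i. A $$ (i, 0))"
  proof
    fix i
    have "mapp n (\<lambda>i j. A $$ (i, j)) (\<lambda>j. of_bool (j = 0)) i = (\<Sum>j<n. if j = 0 then A $$ (i, 0) else 0)"
      unfolding mapp_def by (intro sum.cong) auto
    then show "mapp n (\<lambda>i j. A $$ (i, j)) (\<lambda>j. of_bool (j = 0)) i = A $$ (i, 0)" using assms(2) by simp
  qed
  moreover have "sqnorm n (\<lambda>j. of_bool (j = 0)) = (\<Sum>j<n. if j = 0 then 1 else 0)"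
    unfolding sqnorm_def by (intro sum.cong) auto
  ultimately show ?thesis using assms(2) by simp
qed

text \<open>All hard instances have a purifying register of dimension \<open>d\<close>, so the
  estimator is studied through its circuit for \<open>m = d\<close>.\<close>

locale estimator =
  fixes d :: nat and \<epsilon> :: real and T :: nat and k V dg est
  assumes est: "entropy_estimator d \<epsilon> T k V dg est" and d: "d \<ge> 2" and \<epsilon>: "\<epsilon> > 0"
begin

definition dimension :: nat where "dimension = 2 * k d * (d * d)"

definition layer :: "nat \<Rightarrow> nat \<Rightarrow> nat \<Rightarrow> complex" where
  "layer t i j = V d (Suc t) $$ (i, j)"

definition start :: "nat \<Rightarrow> complex" where
  "start i = V d 0 $$ (i, 0)"

definition query :: "(nat \<Rightarrow> nat \<Rightarrow> complex) \<Rightarrow> nat \<Rightarrow> nat \<Rightarrow> nat \<Rightarrow> complex" where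
  "query W t = ctrl (k d) (d * d) (if dg d t then (\<lambda>i j. cnj (W j i)) else W)"

text \<open>Thresholding the estimate turns the estimator into a test distinguishing two
  entropies.\<close>

definition accepting :: "real \<Rightarrow> nat set" where
  "accepting \<theta> = {i. i < dimension \<and> est d i \<ge> \<theta>}"

definition accept :: "real \<Rightarrow> (nat \<Rightarrow> nat \<Rightarrow> complex) \<Rightarrow> real" where
  "accept \<theta> W = (\<Sum>i\<in>accepting \<theta>. (cmod (evolution dimension layer (query W) start T i))\<^sup>2)"

lemma dimension_pos: "dimension > 0" and unitary_V: "t \<le> T \<Longrightarrow> unitary_mat (V d t) dimension"
  and success: "unitary_mat U (d * d) \<Longrightarrow>
    success_prob T (k d) (V d) (dg d) (est d) U (vn_entropy (oracle_state d d U)) \<epsilon> \<ge> 2/3"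
  using est d unfolding entropy_estimator_def dimension_def by (force simp: Suc_le_eq)+

lemma accepting_subset: "accepting \<theta> \<subseteq> {..<dimension}"
  by (auto simp: accepting_def)

lemma opbound_layer: "t < T \<Longrightarrow> opbound dimension (layer t) 1"
  using opbound_unitary[OF unitary_V[of "Suc t"]] by (simp add: layer_def[abs_def])

lemma sqnorm_start: "sqnorm dimension start = 1"
  using sqnorm_column[OF unitary_V[of 0] dimension_pos] by (simp add: start_def[abs_def])

lemma opbound_query:
  assumes "unitary_mat U (d * d)"
  shows "opbound dimension (query (\<lambda>i j. U $$ (i, j)) t) 1"
proof -
  have U: "U \<in> carrier_mat (d * d) (d * d)" using assms by (simp add: unitary_mat_def)
  have "opbound (d * d) (\<lambda>i j. mat_adjoint U $$ (i, j)) 1"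
    using opbound_unitary[OF unitary_mat_adjoint[OF assms]] .
  then have "opbound (d * d) (\<lambda>i j. cnj (U $$ (j, i))) 1"
    by (subst opbound_cong[where B = "\<lambda>i j. mat_adjoint U $$ (i, j)"]) (use U in auto)
  then show ?thesis
    using opbound_unitary[OF assms] unfolding query_def dimension_def by (auto intro: opbound_ctrl)
qed

lemma query_cong:
  assumes "\<And>i j. i < d * d \<Longrightarrow> j < d * d \<Longrightarrow> W i j = W' i j"
  shows "query W = query W'"
  unfolding query_def using assms d by (intro ext) (auto intro!: ctrl_cong[THEN fun_cong, THEN fun_cong])

lemma accept_cong:
  "(\<And>i j. i < d * d \<Longrightarrow> j < d * d \<Longrightarrow> W i j = W' i j) \<Longrightarrow> accept \<theta> W = accept \<theta> W'"
  unfolding accept_def using query_cong[of W W'] by simp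

lemma alg_state_eq:
  assumes "unitary_mat U (d * d)"
  shows "alg_state (k d) (V d) (dg d) U T \<in> carrier_vec dimension"
    and "i < dimension \<Longrightarrow> alg_state (k d) (V d) (dg d) U T $ i
      = evolution dimension layer (query (\<lambda>i j. U $$ (i, j))) start T i"
proof -
  have U: "U \<in> carrier_mat (d * d) (d * d)" using assms by (simp add: unitary_mat_def)
  have V: "V d t \<in> carrier_mat dimension dimension" if "t \<le> T" for t
    using unitary_V[OF that] by (simp add: unitary_mat_def)
  have q: "(\<lambda>t. ctrl (k d) (d * d) (\<lambda>i j. (if dg d t then mat_adjoint U else U) $$ (i, j))) = query (\<lambda>i j. U $$ (i, j))"
    unfolding query_def using U d by (intro ext ctrl_cong[THEN fun_cong, THEN fun_cong]) auto
  note A = alg_state_evolution[where T = T and t = T and dg = "dg d" and V = "V d" and k = "k d",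
      OF U dimension_def dimension_pos V order_refl, unfolded q]
  show "alg_state (k d) (V d) (dg d) U T \<in> carrier_vec dimension" using A by auto
  show "alg_state (k d) (V d) (dg d) U T $ i = evolution dimension layer (query (\<lambda>i j. U $$ (i, j))) start T i"
    if "i < dimension" using A that by (auto simp: layer_def[abs_def] start_def[abs_def])
qed

text \<open>When the entropy lies below the threshold by more than \<epsilon>, the correct outcomes,
  of weight at least 2/3, are disjoint from the accepting ones. This inequality is strict because an
  estimate equal to \<theta> accepts.\<close>

lemma accept_bounds:
  assumes U: "unitary_mat U (d * d)"
  defines "S \<equiv> vn_entropy (oracle_state d d U)" and "W \<equiv> \<lambda>i j. U $$ (i, j)"
  shows "0 \<le> accept \<theta> W" "accept \<theta> W \<le> 1"
    and "S - \<epsilon> \<ge> \<theta> \<Longrightarrow> accept \<theta> W \<ge> 2/3"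
    and "S + \<epsilon> < \<theta> \<Longrightarrow> accept \<theta> W \<le> 1/3"
proof -
  let ?p = "\<lambda>i. (cmod (evolution dimension layer (query W) start T i))\<^sup>2"
  let ?G = "{i. i < dimension \<and> \<bar>est d i - S\<bar> \<le> \<epsilon>}"
  have "sqnorm dimension (evolution dimension layer (query W) start T) \<le> sqnorm dimension start"
    by (rule sqnorm_evolution[where T = T]) (use opbound_layer opbound_query[OF U] in \<open>auto simp: W_def\<close>)
  then have total: "(\<Sum>i<dimension. ?p i) \<le> 1" using sqnorm_start by (simp add: sqnorm_def)
  have le: "(\<Sum>i\<in>X. ?p i) \<le> (\<Sum>i\<in>Z. ?p i)" if "X \<subseteq> Z" "Z \<subseteq> {..<dimension}" for X Z
    using that by (intro sum_mono2) (auto intro: finite_subset)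
  have "success_prob T (k d) (V d) (dg d) (est d) U S \<epsilon> = (\<Sum>i<dimension. if \<bar>est d i - S\<bar> \<le> \<epsilon> then ?p i else 0)"
    unfolding success_prob_def Let_def using alg_state_eq[OF U]
    by (intro sum.cong) (auto simp: W_def)
  also have "\<dots> = (\<Sum>i\<in>?G. ?p i)"
    using sum.inter_filter[of "{..<dimension}" ?p "\<lambda>i. \<bar>est d i - S\<bar> \<le> \<epsilon>"] by simp
  finally have G: "(\<Sum>i\<in>?G. ?p i) \<ge> 2/3" using success[OF U] by (simp add: S_def)
  show "0 \<le> accept \<theta> W" by (simp add: accept_def sum_nonneg)
  show "accept \<theta> W \<le> 1" unfolding accept_def by (rule order_trans[OF le[OF accepting_subset order_refl] total])
  show "accept \<theta> W \<ge> 2/3" if "S - \<epsilon> \<ge> \<theta>"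
    using le[OF _ accepting_subset, of ?G \<theta>] G that by (force simp: accept_def accepting_def)
  show "accept \<theta> W \<le> 1/3" if "S + \<epsilon> < \<theta>"
  proof -
    have "?G \<inter> accepting \<theta> = {}" using that by (auto simp: accepting_def)
    then have "(\<Sum>i\<in>?G. ?p i) + accept \<theta> W = (\<Sum>i\<in>?G \<union> accepting \<theta>. ?p i)"
      unfolding accept_def by (intro sum.union_disjoint[symmetric]) (auto simp: accepting_def)
    also have "\<dots> \<le> (\<Sum>i<dimension. ?p i)" by (intro le) (auto simp: accepting_def)
    finally show ?thesis using total G by simp
  qed
qed

lemma accept_perturb:
  fixes \<eta> :: real
  assumes "unitary_mat U (d * d)" "unitary_mat U' (d * d)" "\<eta> \<ge> 0"
    and "opbound (d * d) (\<lambda>i j. U $$ (i, j) - U' $$ (i, j)) \<eta>"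
    and "opbound (d * d) (\<lambda>i j. cnj (U $$ (j, i)) - cnj (U' $$ (j, i))) \<eta>"
  shows "\<bar>sqrt (accept \<theta> (\<lambda>i j. U $$ (i, j))) - sqrt (accept \<theta> (\<lambda>i j. U' $$ (i, j)))\<bar> \<le> real T * \<eta>"
  unfolding accept_def
  by (rule evolution_perturb)
    (use assms opbound_layer opbound_query sqnorm_start accepting_subset
      in \<open>auto simp: query_def dimension_def intro: opbound_ctrl_diff\<close>)

text \<open>The adjoint of a conjugated matrix is the conjugated adjoint, so both kinds of query are
  covered; periodicity spreads the phases over all blocks.\<close>

lemma query_gauge:
  assumes "\<And>i. cmod (\<zeta> i) = 1" "\<And>i. \<zeta> (i mod (d * d)) = \<zeta> i"
  shows "query (gauge \<zeta> W) t = gauge \<zeta> (query W t)"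
proof -
  have "(\<lambda>i j. cnj (gauge \<zeta> W j i)) = gauge \<zeta> (\<lambda>i j. cnj (W j i))"
    by (simp add: gauge_def fun_eq_iff mult_ac)
  then show ?thesis
    unfolding query_def using ctrl_gauge[of \<zeta> "k d" "d * d", OF assms(1)] assms(2) by auto
qed

lemma accept_hard:
  assumes "cmod z = 1"
  shows "accept \<theta> (\<lambda>i j. hard_unitary d c s z Y $$ (i, j)) =
    (\<Sum>i\<in>accepting \<theta>. (cmod (evolution dimension layer
      (\<lambda>t. gauge (\<lambda>i. walsh (edge_of d i) Y * z ^ card (edge_of d i)) (query (\<lambda>i j. seed d c s i j) t)) start T i))\<^sup>2)"
proof -
  have "accept \<theta> (\<lambda>i j. hard_unitary d c s z Y $$ (i, j)) = accept \<theta> (gauge (phase d z Y) (\<lambda>i j. seed d c s i j))"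
    by (rule accept_cong) (simp add: hard_unitary_def)
  moreover have "query (gauge (phase d z Y) (\<lambda>i j. seed d c s i j)) = (\<lambda>t. gauge (phase d z Y) (query (\<lambda>i j. seed d c s i j) t))"
    using d by (intro ext query_gauge[THEN fun_cong, THEN fun_cong] norm_phase assms) (simp_all add: phase_def edge_of_mod)
  ultimately show ?thesis by (simp add: accept_def phase_def[abs_def])
qed

lemma cubic_bound:
  assumes \<epsilon>0: "\<epsilon> \<le> 1 / 2000"
  shows "102400 * \<epsilon> * real T ^ 3 \<ge> (real d)\<^sup>2"
proof -
  define s where "s = 2 * sqrt \<epsilon>"
  define c where "c = sqrt (1 - s\<^sup>2)"
  have s2: "s\<^sup>2 = 4 * \<epsilon>" using \<epsilon> by (simp add: s_def power_mult_distrib)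
  have s4: "s ^ 4 = 16 * \<epsilon>\<^sup>2"
  proof -
    have "s ^ 4 = (s\<^sup>2)\<^sup>2" by simp
    then show ?thesis by (simp add: s2 power_mult_distrib)
  qed
  have cs: "c\<^sup>2 + s\<^sup>2 = 1" "0 \<le> c" using \<epsilon>0 by (simp_all add: c_def s2)
  have s: "0 \<le> s" using \<epsilon> by (simp add: s_def)
  define P where "P = edges d"
  define N :: real where "N = 2 ^ card P"
  \<comment> \<open>With fourth moment at most \<open>20 * d\<close> the deficit is at most 19 s^4
    for \<open>z = \<i>\<close> and at least 4 \<epsilon> - 168 s^4 for \<open>z = 1\<close>. Since
    s^4 = 16 \<epsilon>^2 and \<epsilon> \<le> 1/2000, the gap exceeds the 2 \<epsilon> needed to
    separate two estimates.\<close>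
  define \<theta> where "\<theta> = ln d - 19 * s ^ 4 - \<epsilon>"
  define acc where "acc z Y = accept \<theta> (\<lambda>i j. hard_unitary d c s z Y $$ (i, j))" for z Y
  define p where "p z = (\<Sum>Y\<in>Pow P. acc z Y) / N" for z
  define X where "X = {Y \<in> Pow P. \<not> quartic d Y \<le> 20 * real d}"
  have X: "X \<subseteq> Pow P" "finite X" by (auto simp: X_def P_def)
  have N: "N > 0" by (simp add: N_def)
  have cardX: "real (card X) \<le> N / 10" using card_quartic_large[OF d] by (simp add: X_def P_def N_def)
  have cardG: "real (card (Pow P - X)) = N - real (card X)"
    using X card_mono[OF _ X(1)] by (simp add: card_Diff_subset card_Pow P_def N_def of_nat_diff)
  have split: "(\<Sum>Y\<in>Pow P. f Y) = (\<Sum>Y\<in>Pow P - X. f Y) + (\<Sum>Y\<in>X. f Y)" for f :: "_ \<Rightarrow> real"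
    using X by (intro sum.subset_diff) (auto simp: P_def)
  have U: "unitary_mat (hard_unitary d c s z Y) (d * d)" if "cmod z = 1" for z Y
    by (rule unitary_hard[OF d cs(1) that])
  have hi: "acc \<i> Y \<ge> 2/3" if "Y \<in> Pow P - X" for Y
  proof -
    have "quartic d Y \<le> 20 * real d" using that by (auto simp: X_def)
    from hard_entropy(1)[OF d cs this]
    have "vn_entropy (oracle_state d d (hard_unitary d c s \<i> Y)) - \<epsilon> \<ge> \<theta>" by (simp add: \<theta>_def)
    then show ?thesis unfolding acc_def by (intro accept_bounds(3) U) auto
  qed
  have lo: "acc 1 Y \<le> 1/3" if "Y \<in> Pow P - X" for Y
  proof -
    have "quartic d Y \<le> 20 * real d" using that by (auto simp: X_def)
    from hard_entropy(2)[OF d cs this]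
    have "vn_entropy (oracle_state d d (hard_unitary d c s 1 Y)) \<le> ln d - s\<^sup>2 + 168 * s ^ 4" by simp
    moreover have "\<epsilon> * \<epsilon> \<le> \<epsilon> * (1 / 2000)" using \<epsilon> \<epsilon>0 by (intro mult_left_mono) auto
    then have "ln d - s\<^sup>2 + 168 * s ^ 4 + \<epsilon> < \<theta>"
      unfolding \<theta>_def s2 s4 using \<epsilon> by (simp add: power2_eq_square)
    ultimately have "vn_entropy (oracle_state d d (hard_unitary d c s 1 Y)) + \<epsilon> < \<theta>" by linarith
    then show ?thesis unfolding acc_def by (intro accept_bounds(4) U) auto
  qed
  have b0: "0 \<le> acc z Y" "acc z Y \<le> 1" if "cmod z = 1" for z Y
    unfolding acc_def by (intro accept_bounds U that)+
  \<comment> \<open>The exceptional tenth of the patterns gets the worst possible value: 2/3 * 9/10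
    = 0.6 here, and 1/3 * 9/10 + 1/10 = 0.4 for \<open>z = 1\<close>.\<close>
  have "(\<Sum>Y\<in>Pow P. acc \<i> Y) \<ge> (\<Sum>Y\<in>Pow P - X. 2/3) + (\<Sum>Y\<in>X. 0)"
    unfolding split by (intro add_mono sum_mono hi b0) auto
  then have "(\<Sum>Y\<in>Pow P. acc \<i> Y) \<ge> 0.6 * N" using cardX cardG by (simp add: P_def)
  then have p1: "p \<i> \<ge> 0.6" using N by (simp add: p_def field_simps)
  have "(\<Sum>Y\<in>Pow P. acc 1 Y) \<le> (\<Sum>Y\<in>Pow P - X. 1/3) + (\<Sum>Y\<in>X. 1)"
    unfolding split by (intro add_mono sum_mono lo b0) auto
  then have "(\<Sum>Y\<in>Pow P. acc 1 Y) \<le> real (card (Pow P - X)) / 3 + real (card X)" by simp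
  then have "(\<Sum>Y\<in>Pow P. acc 1 Y) \<le> 0.4 * N" using cardX cardG by linarith
  then have p2: "p 1 \<le> 0.4" using N by (simp add: p_def field_simps)
  define \<eta> where "\<eta> t = 2 * s * sqrt (2 * real (2 * t + 1) / (real d * real (d - 1)))" for t
  \<comment> \<open>A bound uniform in \<open>t < T\<close>, as 2 (2 t + 1) \<le> 4 T.\<close>
  define R where "R = sqrt (4 * real T / (real d * real (d - 1)))"
  have "\<bar>sqrt (p 1) - sqrt (p \<i>)\<bar> \<le> 2 * (\<Sum>u<T. sqrt 2 * \<eta> u)"
  proof -
    let ?C = "query (\<lambda>i j. complex_of_real (seed d c s i j))"
    have d0: "d > 0" using d by simp
    have "opbound dimension (?C t) 1" for t
    proof -
      have "query (\<lambda>i j. cmat (d * d) (seed d c s) $$ (i, j)) = ?C" by (intro query_cong) (simp add: cmat_def)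
      then show ?thesis using opbound_query[OF unitary_seed[OF d cs(1)], of t] by simp
    qed
    moreover have "almost_fixes dimension (charged (edge_of d) S) (?C t) (\<eta> t)" if "S \<subseteq> P" "card S \<le> 2 * t + 1" for t S
    proof -
      have S: "finite S" using that(1) finite_edges unfolding P_def by (rule finite_subset)
      have "almost_fixes (2 * k d * (d * d)) (\<lambda>i. charged (edge_of d) S (i mod (d * d))) (?C t) (\<eta> t)"
        unfolding query_def \<eta>_def using d0 almost_fixes_seed[OF d cs s S that(2)]
        by (intro almost_fixes_ctrl) auto
      moreover have "(\<lambda>i. charged (edge_of d) S (i mod (d * d))) = charged (edge_of d) S"
        using d0 by (simp add: charged_def fun_eq_iff edge_of_mod)
      ultimately show ?thesis by (simp add: dimension_def)
    qed
    moreover have "\<eta> t \<ge> 0" for t using s by (simp add: \<eta>_def)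
    ultimately have "\<bar>sqrt ((\<Sum>Y\<in>Pow P. \<Sum>i\<in>accepting \<theta>. (cmod (evolution dimension layer
      (\<lambda>t. gauge (\<lambda>i. walsh (edge_of d i) Y * 1 ^ card (edge_of d i)) (?C t)) start T i))\<^sup>2) / 2 ^ card P)
      - sqrt ((\<Sum>Y\<in>Pow P. \<Sum>i\<in>accepting \<theta>. (cmod (evolution dimension layer
      (\<lambda>t. gauge (\<lambda>i. walsh (edge_of d i) Y * \<i> ^ card (edge_of d i)) (?C t)) start T i))\<^sup>2) / 2 ^ card P)\<bar>
      \<le> 2 * (\<Sum>u<T. sqrt 2 * \<eta> u)"
      by (intro query_hybrid accepting_subset opbound_layer)
        (auto simp: P_def sqnorm_start edge_of_subset[OF d0, THEN subsetD] card_edge_of[simplified])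
    then show ?thesis by (simp only: p_def acc_def accept_hard N_def norm_one norm_ii)
  qed
  moreover have "(\<Sum>u<T. sqrt 2 * \<eta> u) \<le> (\<Sum>u<T. sqrt 2 * (2 * s * R))"
    unfolding \<eta>_def R_def using s by (intro sum_mono mult_left_mono real_sqrt_le_mono divide_right_mono) auto
  then have "(\<Sum>u<T. sqrt 2 * \<eta> u) \<le> real T * (sqrt 2 * (2 * s * R))" by simp
  moreover have "sqrt (p \<i>) \<ge> 77 / 100" using p1 by (intro real_le_rsqrt) (simp add: power2_eq_square)
  moreover have "sqrt (p 1) \<le> 64 / 100" using p2 by (intro real_le_lsqrt) (auto simp: power2_eq_square)
  ultimately have "1 / 10 \<le> 2 * (real T * (sqrt 2 * (2 * s * R)))" by linarith
  then have "(1 / 10)\<^sup>2 \<le> (2 * (real T * (sqrt 2 * (2 * s * R))))\<^sup>2"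
    by (intro power_mono) auto
  \<comment> \<open>The product is 4 * 2 * 4 * 4 * 4 with s^2 = 4 \<epsilon>. Then d - 1 \<ge> d / 2
    doubles it to 1024, and the squared gap 1/100 on the left yields 102400.\<close>
  also have "\<dots> = 512 * \<epsilon> * real T ^ 3 / (real d * real (d - 1))"
    by (simp add: power_mult_distrib s2 R_def) (simp add: power2_eq_square power3_eq_cube)
  also have "\<dots> \<le> 512 * \<epsilon> * real T ^ 3 / (real d * (real d / 2))"
    using d \<epsilon> by (intro divide_left_mono mult_left_mono) (auto simp: of_nat_diff)
  also have "\<dots> = 1024 * \<epsilon> * real T ^ 3 / (real d)\<^sup>2" by (simp add: power2_eq_square)
  finally show ?thesis using d by (simp add: field_simps power2_eq_square)
qed

end

section \<open>The logarithmic term: comparing two nearby rotations\<close>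

lemma opbound_rot_diff:
  assumes uv: "orthonormal_pair D u v" and b: "\<bar>c - c'\<bar> \<le> \<tau>" "\<bar>s - s'\<bar> \<le> \<tau>"
  shows "opbound D (\<lambda>i j. complex_of_real (rot c s u v i j) - complex_of_real (rot c' s' u v i j)) (4 * \<tau>)"
  unfolding opbound_def
proof
  fix w
  \<comment> \<open>The difference maps into the span of \<open>u\<close> and \<open>v\<close>;
    these are its coefficients there. Both squares are at most 4 \<tau>^2 times the squared norm of
    the input, which adds up to (4 \<tau>)^2.\<close>
  define x y where "x = complex_of_real (c - c') * ip D u w - complex_of_real (s - s') * ip D v w"
    and "y = complex_of_real (c - c') * ip D v w + complex_of_real (s - s') * ip D u w"
  have u: "(\<Sum>k<D. u k * u k) = 1" and v: "(\<Sum>k<D. v k * v k) = 1"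
    using uv by (auto simp: orthonormal_pair_def)
  have \<tau>: "(c - c')\<^sup>2 \<le> \<tau>\<^sup>2" "(s - s')\<^sup>2 \<le> \<tau>\<^sup>2"
    using b power_mono[of "\<bar>c - c'\<bar>" \<tau> 2] power_mono[of "\<bar>s - s'\<bar>" \<tau> 2] by auto
  have sq: "(cmod (f + g))\<^sup>2 \<le> 2 * (cmod f)\<^sup>2 + 2 * (cmod g)\<^sup>2" for f g :: complex
  proof -
    have "(cmod (f + g))\<^sup>2 \<le> (cmod f + cmod g)\<^sup>2" by (intro power_mono norm_triangle_ineq) auto
    also have "\<dots> \<le> 2 * (cmod f)\<^sup>2 + 2 * (cmod g)\<^sup>2"
      using sum_squares_bound[of "cmod f" "cmod g"] by (simp add: power2_sum)
    finally show ?thesis .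
  qed
  have part: "(cmod (complex_of_real a * ip D f w))\<^sup>2 \<le> \<tau>\<^sup>2 * sqnorm D w"
    if "a\<^sup>2 \<le> \<tau>\<^sup>2" "(\<Sum>k<D. f k * f k) = 1" for a f
    unfolding norm_mult power_mult_distrib norm_of_real power2_abs
    using that by (intro mult_mono ip_bound) auto
  have x: "(cmod x)\<^sup>2 \<le> 4 * \<tau>\<^sup>2 * sqnorm D w"
    using sq[of "complex_of_real (c - c') * ip D u w" "- (complex_of_real (s - s') * ip D v w)"]
      part[OF \<tau>(1) u] part[OF \<tau>(2) v] unfolding x_def norm_minus_cancel add_uminus_conv_diff by linarith
  have y: "(cmod y)\<^sup>2 \<le> 4 * \<tau>\<^sup>2 * sqnorm D w"
    using sq[of "complex_of_real (c - c') * ip D v w" "complex_of_real (s - s') * ip D u w"]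
      part[OF \<tau>(1) v] part[OF \<tau>(2) u] unfolding y_def by linarith
  have "sqnorm D (mapp D (\<lambda>i j. complex_of_real (rot c s u v i j) - complex_of_real (rot c' s' u v i j)) w)
      = sqnorm D (\<lambda>i. x * u i + y * v i)"
    by (intro sqnorm_cong) (simp add: mapp_diff_left mapp_rot x_def y_def algebra_simps)
  also have "\<dots> \<le> (\<Sum>i<D. 2 * (cmod x)\<^sup>2 * (u i * u i) + 2 * (cmod y)\<^sup>2 * (v i * v i))"
    unfolding sqnorm_def
  proof (rule sum_mono)
    fix i
    have "(cmod (x * u i))\<^sup>2 = (cmod x)\<^sup>2 * (u i * u i)" "(cmod (y * v i))\<^sup>2 = (cmod y)\<^sup>2 * (v i * v i)"
      by (simp_all add: norm_mult power_mult_distrib power2_eq_square)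
    then show "(cmod (x * u i + y * v i))\<^sup>2 \<le> 2 * (cmod x)\<^sup>2 * (u i * u i) + 2 * (cmod y)\<^sup>2 * (v i * v i)"
      using sq[of "x * u i" "y * v i"] by simp
  qed
  also have "\<dots> = 2 * (cmod x)\<^sup>2 + 2 * (cmod y)\<^sup>2"
    by (simp add: sum.distrib sum_distrib_left[symmetric] u v)
  also have "\<dots> \<le> (4 * \<tau>)\<^sup>2 * sqnorm D w" using x y by (simp add: power_mult_distrib)
  finally show "sqnorm D (mapp D (\<lambda>i j. complex_of_real (rot c s u v i j) - complex_of_real (rot c' s' u v i j)) w)
      \<le> (4 * \<tau>)\<^sup>2 * sqnorm D w" .
qed

text \<open>Column 0 purifies the diagonal state with eigenvalue 1 - p on the first level and
  \<open>p\<close> spread evenly over the other d - 1 levels.\<close>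

definition tilt :: "nat \<Rightarrow> real \<Rightarrow> nat \<Rightarrow> nat \<Rightarrow> real" where
  "tilt d p = rot (sqrt (1 - p)) (sqrt p) basis0 (diag_rest d)"

lemma tilt_transpose: "tilt d p j i = rot (sqrt (1 - p)) (- sqrt p) basis0 (diag_rest d) i j"
  unfolding tilt_def by (rule rot_transpose)

lemma unitary_tilt:
  assumes "d \<ge> 2" "0 \<le> p" "p \<le> 1"
  shows "unitary_mat (cmat (d * d) (tilt d p)) (d * d)"
  unfolding tilt_def using assms by (intro unitary_rot orthonormal_basis0_rest) auto

lemma entropy_tilt:
  assumes "d \<ge> 2" "0 < p" "p < 1"
  shows "vn_entropy (oracle_state d d (cmat (d * d) (tilt d p)))
    = - (1 - p) * ln (1 - p) - p * ln p + p * ln (real (d - 1))"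
proof -
  let ?U = "cmat (d * d) (tilt d p)"
  let ?\<rho> = "oracle_state d d ?U"
  have U: "?U \<in> carrier_mat (d * d) (d * d)" by (simp add: cmat_def)
  have pos: "d * d > 0" using assms by simp
  define f where "f a = (if a = 0 then 1 - p else p / real (d - 1))" for a :: nat
  have col: "?U $$ (a * d + b, 0) = complex_of_real (of_bool (a = b) * sqrt (f a))" if "a < d" "b < d" for a b
  proof -
    have lt: "a * d + b < d * d"
    proof -
      have "a * d + b < (a + 1) * d" using that by simp
      also have "\<dots> \<le> d * d" using that by (intro mult_right_mono) auto
      finally show ?thesis .
    qed
    have "tilt d p (a * d + b) 0 = sqrt (1 - p) * basis0 (a * d + b) + sqrt p * diag_rest d (a * d + b)"
      unfolding tilt_def using rot_basis0_column[OF lt] .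
    also have "\<dots> = of_bool (a = b) * sqrt (f a)"
      using that assms by (auto simp: basis0_def diag_rest_def f_def real_sqrt_divide)
    finally show ?thesis using lt pos by (simp add: cmat_def)
  qed
  have f0: "f a \<ge> 0" for a using assms by (simp add: f_def)
  have \<rho>: "?\<rho> = mat d d (\<lambda>(a, a'). if a = a' then complex_of_real (f a) else 0)"
  proof (rule eq_matI)
    fix a a' assume "a < dim_row (mat d d (\<lambda>(a, a'). if a = a' then complex_of_real (f a) else 0))"
      "a' < dim_col (mat d d (\<lambda>(a, a'). if a = a' then complex_of_real (f a) else 0))"
    then have a: "a < d" "a' < d" by auto
    have "?\<rho> $$ (a, a') = (\<Sum>k<d. complex_of_real (of_bool (a = k) * sqrt (f a)) * complex_of_real (of_bool (a' = k) * sqrt (f a')))"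
      using a by (simp add: oracle_state_eq[OF U pos] col)
    also have "\<dots> = (\<Sum>k<d. if k = a then (if a = a' then complex_of_real (f a) else 0) else 0)"
      using f0 by (intro sum.cong refl) (auto simp flip: of_real_mult)
    also have "\<dots> = mat d d (\<lambda>(a, a'). if a = a' then complex_of_real (f a) else 0) $$ (a, a')"
      using a by simp
    finally show "?\<rho> $$ (a, a') = \<dots>" .
  qed (simp_all add: oracle_state_eq[OF U pos])
  have "char_poly ?\<rho> = (\<Prod>a\<leftarrow>diag_mat ?\<rho>. [:- a, 1:])"
    unfolding \<rho> by (rule char_poly_upper_triangular[where n = d]) auto
  then have "vn_entropy ?\<rho> = - (\<Sum>a\<leftarrow>diag_mat ?\<rho>. Re a * ln (Re a))"
    by (intro vn_entropy_eq[where n = d]) (simp_all add: \<rho>)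
  also have "diag_mat ?\<rho> = map (\<lambda>i. complex_of_real (f i)) [0..<d]"
    unfolding \<rho> diag_mat_def by (intro map_cong) auto
  also have "(\<Sum>a\<leftarrow>map (\<lambda>i. complex_of_real (f i)) [0..<d]. Re a * ln (Re a)) = (\<Sum>i<d. f i * ln (f i))"
    by (simp add: o_def interv_sum_list_conv_sum_set_nat atLeast0LessThan)
  also have "\<dots> = f 0 * ln (f 0) + (\<Sum>i\<in>{..<d} - {0}. f i * ln (f i))"
    using assms by (intro sum.remove) auto
  also have "(\<Sum>i\<in>{..<d} - {0}. f i * ln (f i)) = (\<Sum>i\<in>{..<d} - {0}. (p / real (d - 1)) * ln (p / real (d - 1)))"
    by (intro sum.cong) (auto simp: f_def)
  also have "\<dots> = p * ln (p / real (d - 1))"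
    using assms by (simp add: card_Diff_subset)
  also have "\<dots> = p * ln p - p * ln (real (d - 1))"
    using assms by (simp add: ln_div right_diff_distrib)
  finally show ?thesis by (simp add: f_def algebra_simps)
qed

text \<open>The convex function x ln x lies above its tangent at \<open>y\<close>.\<close>

lemma mult_ln_tangent:
  fixes x y :: real
  assumes "x > 0" "y > 0"
  shows "x * ln x - y * ln y \<ge> (x - y) * (ln y + 1)"
proof -
  have "ln (y / x) \<le> y / x - 1" using assms by (intro ln_le_minus_one) auto
  then have "x * ln (y / x) \<le> x * (y / x - 1)" using assms by (intro mult_left_mono) auto
  then have "x * (ln y - ln x) \<le> y - x" using assms by (simp add: ln_div algebra_simps)
  then show ?thesis by (simp add: algebra_simps)
qed

text \<open>By concavity the slope is at least the derivative at \<open>q\<close>, which is ln ((1 -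
  q) / q) + ln (d - 1). For \<open>q \<le> 1 / 3\<close> the first term is at least ln 2, and 2 (d -
  1) \<ge> d.\<close>

lemma entropy_tilt_increase:
  assumes d: "d \<ge> 2" and "1 / 4 \<le> p" "p \<le> q" "q \<le> 1 / 3"
  shows "vn_entropy (oracle_state d d (cmat (d * d) (tilt d q)))
    \<ge> vn_entropy (oracle_state d d (cmat (d * d) (tilt d p))) + (q - p) * ln (real d)"
proof -
  have "ln 2 \<le> ln ((1 - q) / q)" using assms by (intro ln_mono) (auto simp: field_simps)
  then have q: "ln 2 \<le> ln (1 - q) - ln q" using assms by (simp add: ln_div)
  have "ln (real d) \<le> ln (2 * real (d - 1))" using d by (intro ln_mono) (auto simp: of_nat_diff)
  also have "\<dots> = ln 2 + ln (real (d - 1))" using d by (intro ln_mult_pos) auto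
  finally have "ln (real d) \<le> ln (1 - q) - ln q + ln (real (d - 1))" using q by linarith
  then have "(q - p) * ln (real d) \<le> (q - p) * (ln (1 - q) - ln q + ln (real (d - 1)))"
    using assms by (intro mult_left_mono) auto
  moreover have "p * ln p - q * ln q \<ge> (p - q) * (ln q + 1)"
    and "(1 - p) * ln (1 - p) - (1 - q) * ln (1 - q) \<ge> ((1 - p) - (1 - q)) * (ln (1 - q) + 1)"
    using assms by (intro mult_ln_tangent; simp)+
  ultimately show ?thesis using assms by (simp add: entropy_tilt algebra_simps)
qed

text \<open>Above 1/4 the two roots sum to at least 1. This keeps the oracle perturbation linear in
  the change of weight, and is the reason to start from weight 1/4.\<close>

lemma sqrt_diff_le:
  fixes x y :: real
  assumes "1 / 4 \<le> x" "1 / 4 \<le> y"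
  shows "\<bar>sqrt x - sqrt y\<bar> \<le> \<bar>x - y\<bar>"
proof -
  have "sqrt x \<ge> 1 / 2" "sqrt y \<ge> 1 / 2"
    by (rule real_le_rsqrt, use assms in \<open>simp add: power2_eq_square\<close>)+
  then have "1 \<le> sqrt x + sqrt y" by linarith
  then have "\<bar>sqrt x - sqrt y\<bar> * 1 \<le> \<bar>sqrt x - sqrt y\<bar> * (sqrt x + sqrt y)"
    by (intro mult_left_mono) auto
  also have "\<dots> = \<bar>(sqrt x - sqrt y) * (sqrt x + sqrt y)\<bar>"
    using \<open>1 \<le> sqrt x + sqrt y\<close> by (simp add: abs_mult)
  also have "(sqrt x - sqrt y) * (sqrt x + sqrt y) = x - y"
    using assms by (simp add: algebra_simps)
  finally show ?thesis by simp
qed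

lemma half_le_ln: "d \<ge> 2 \<Longrightarrow> 1 / 2 \<le> ln (real d)"
proof -
  assume "d \<ge> 2"
  then have "ln 2 \<le> ln (real d)" by (intro ln_mono) auto
  moreover have "ln (1 / 2 :: real) \<le> 1 / 2 - 1" by (intro ln_le_minus_one) simp
  ultimately show ?thesis by (simp add: ln_div)
qed

context estimator
begin

lemma log_bound:
  assumes \<epsilon>0: "\<epsilon> \<le> 1 / 2000"
  shows "60 * real T \<ge> ln (real d) / \<epsilon>"
proof -
  \<comment> \<open>An entropy change of 3 \<epsilon> leaves room for the two error intervals, and
    \<tau> \<le> 1/12 keeps \<open>q\<close> below 1/3.\<close>
  define \<tau> where "\<tau> = 3 * \<epsilon> / ln (real d)"
  have ln: "ln (real d) \<ge> 1 / 2" using half_le_ln[OF d] .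
  have \<tau>: "0 < \<tau>" "\<tau> \<le> 1 / 12" using ln \<epsilon> \<epsilon>0 by (auto simp: \<tau>_def field_simps)
  define q where "q = 1 / 4 + \<tau>"
  define U where "U p = cmat (d * d) (tilt d p)" for p
  define \<theta> where "\<theta> = vn_entropy (oracle_state d d (U q)) - \<epsilon>"
  have U: "unitary_mat (U p) (d * d)" if "0 \<le> p" "p \<le> 1" for p
    unfolding U_def using unitary_tilt[OF d that] .
  have "\<tau> * ln (real d) = 3 * \<epsilon>" using ln by (simp add: \<tau>_def)
  then have "vn_entropy (oracle_state d d (U (1 / 4))) + 3 * \<epsilon> \<le> vn_entropy (oracle_state d d (U q))"
    using entropy_tilt_increase[OF d, of "1 / 4" q] \<tau> by (simp add: U_def q_def)
  then have lo: "accept \<theta> (\<lambda>i j. U (1 / 4) $$ (i, j)) \<le> 1 / 3"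
    using \<epsilon> by (intro accept_bounds(4) U) (auto simp: \<theta>_def)
  have hi: "accept \<theta> (\<lambda>i j. U q $$ (i, j)) \<ge> 2 / 3"
    using \<tau> by (intro accept_bounds(3) U) (auto simp: \<theta>_def q_def)
  have c: "\<bar>sqrt (1 - 1 / 4) - sqrt (1 - q)\<bar> \<le> \<tau>" "\<bar>sqrt (1 / 4) - sqrt q\<bar> \<le> \<tau>"
    using sqrt_diff_le[of "1 - 1 / 4" "1 - q"] sqrt_diff_le[of "1 / 4" q] \<tau> by (auto simp: q_def)
  have on: "orthonormal_pair (d * d) basis0 (diag_rest d)" by (rule orthonormal_basis0_rest[OF d])
  have "opbound (d * d) (\<lambda>i j. U (1 / 4) $$ (i, j) - U q $$ (i, j)) (4 * \<tau>)"
    using opbound_rot_diff[OF on c]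
    by (subst opbound_cong[where B = "\<lambda>i j. complex_of_real (tilt d (1 / 4) i j) - complex_of_real (tilt d q i j)"])
      (simp_all add: U_def cmat_def tilt_def)
  moreover have "opbound (d * d) (\<lambda>i j. cnj (U (1 / 4) $$ (j, i)) - cnj (U q $$ (j, i))) (4 * \<tau>)"
  proof -
    have "\<bar>- sqrt (1 / 4) - - sqrt q\<bar> \<le> \<tau>" using c(2) by linarith
    from opbound_rot_diff[OF on c(1) this] show ?thesis
      by (subst opbound_cong[where B = "\<lambda>i j. complex_of_real (rot (sqrt (1 - 1 / 4)) (- sqrt (1 / 4)) basis0 (diag_rest d) i j)
          - complex_of_real (rot (sqrt (1 - q)) (- sqrt q) basis0 (diag_rest d) i j)"])
        (simp_all add: U_def cmat_def tilt_transpose)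
  qed
  ultimately have "\<bar>sqrt (accept \<theta> (\<lambda>i j. U (1 / 4) $$ (i, j))) - sqrt (accept \<theta> (\<lambda>i j. U q $$ (i, j)))\<bar> \<le> real T * (4 * \<tau>)"
    using \<tau> by (intro accept_perturb U) (auto simp: q_def)
  moreover have "sqrt (accept \<theta> (\<lambda>i j. U q $$ (i, j))) \<ge> 81 / 100"
    using hi by (intro real_le_rsqrt) (simp add: power2_eq_square)
  moreover have "sqrt (accept \<theta> (\<lambda>i j. U (1 / 4) $$ (i, j))) \<le> 58 / 100"
    using lo by (intro real_le_lsqrt) (auto simp: power2_eq_square accept_bounds U)
  \<comment> \<open>The gap 0.81 - 0.58 exceeds 1/5, and 4 \<tau> = 12 \<epsilon> / ln d; hence the
    constant 60.\<close>
  ultimately have "1 / 5 \<le> real T * (4 * \<tau>)" by linarith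
  then show ?thesis using ln \<epsilon> by (simp add: \<tau>_def field_simps)
qed

text \<open>The comparison (d^2 / \<epsilon>)^(1/3) \<ge> (d / \<epsilon>)^(1/2) is equivalent to d
  \<epsilon> \<ge> 1, which dictates the case split. The constant 180 comes from the case d
  \<epsilon> < 1, where the square root term is at most 2 ln d / \<epsilon> \<le> 120 T.\<close>

lemma query_lower_bound:
  assumes \<epsilon>0: "\<epsilon> \<le> 1 / 2000"
  shows "180 * real T \<ge> sqrt (real d) / sqrt \<epsilon> + ln (real d) / \<epsilon>"
proof -
  define x where "x = sqrt (real d) / sqrt \<epsilon>"
  have x: "x > 0" "x\<^sup>2 = real d / \<epsilon>" using d \<epsilon> by (auto simp: x_def power_divide)
  note log = log_bound[OF \<epsilon>0]
  show ?thesis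
  proof (cases "real d * \<epsilon> \<ge> 1")
    case True
    \<comment> \<open>The constant 50 works because 50^3 = 125000 exceeds the 102400 of
      \<open>cubic_bound\<close>.\<close>
    have "x \<le> 50 * real T"
    proof (rule ccontr)
      assume "\<not> x \<le> 50 * real T"
      then have "real T \<le> x / 50" by simp
      then have "real T ^ 3 \<le> (x / 50) ^ 3" by (intro power_mono) auto
      then have T3: "102400 * \<epsilon> * real T ^ 3 \<le> 102400 * \<epsilon> * (x / 50) ^ 3" using \<epsilon> by (intro mult_left_mono) auto
      have "x * (x\<^sup>2 * \<epsilon>) = x * real d" using x \<epsilon> by simp
      then have "\<epsilon> * x ^ 3 = x * real d" by (simp add: power2_eq_square power3_eq_cube mult_ac)
      moreover have "x \<le> real d"
      proof -
        have "real d * 1 \<le> real d * (real d * \<epsilon>)" using True by (intro mult_left_mono) auto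
        then have "x\<^sup>2 \<le> (real d)\<^sup>2"
          unfolding x(2) pos_divide_le_eq[OF \<epsilon>] by (simp add: power2_eq_square mult_ac)
        then show ?thesis by (rule power2_le_imp_le) simp
      qed
      then have "x * real d \<le> real d * real d" by (intro mult_right_mono) auto
      ultimately have "102400 * \<epsilon> * (x / 50) ^ 3 \<le> 102400 / 125000 * (real d)\<^sup>2"
        by (simp add: power_divide power2_eq_square)
      also have "\<dots> < (real d)\<^sup>2" using d by simp
      finally show False using T3 cubic_bound[OF \<epsilon>0] by linarith
    qed
    then show ?thesis using log unfolding x_def by linarith
  next
    case False
    have "x \<le> 1 / \<epsilon>"
    proof -
      have "x\<^sup>2 = (real d * \<epsilon>) * (1 / \<epsilon>)\<^sup>2" unfolding x(2) using \<epsilon> by (simp add: power2_eq_square)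
      also have "\<dots> \<le> 1 * (1 / \<epsilon>)\<^sup>2" using False by (intro mult_right_mono) auto
      finally have "x\<^sup>2 \<le> (1 / \<epsilon>)\<^sup>2" by simp
      then show ?thesis by (rule power2_le_imp_le) (use \<epsilon> in simp)
    qed
    also have "\<dots> \<le> 2 * (ln (real d) / \<epsilon>)" using half_le_ln[OF d] \<epsilon> by (simp add: divide_right_mono)
    finally show ?thesis using log unfolding x_def by linarith
  qed
qed

end

theorem theorem2p36:
  shows "\<exists>c > 0. \<exists>\<epsilon>0 > 0. \<forall>d \<ge> 2. \<forall>\<epsilon>. 0 < \<epsilon> \<and> \<epsilon> \<le> \<epsilon>0 \<longrightarrow>
           (\<forall>T k V dg est. entropy_estimator d \<epsilon> T k V dg est \<longrightarrow>
              real T \<ge> c * (sqrt (real d) / sqrt \<epsilon> + ln (real d) / \<epsilon>))"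
proof (rule exI[of _ "1 / 180"], rule conjI, simp, rule exI[of _ "1 / 2000"], intro conjI allI impI)
  fix d :: nat and \<epsilon> :: real and T k V dg est
  assume "2 \<le> d" "0 < \<epsilon> \<and> \<epsilon> \<le> 1 / 2000" and est: "entropy_estimator d \<epsilon> T k V dg est"
  then interpret estimator d \<epsilon> T k V dg est by unfold_locales auto
  show "real T \<ge> 1 / 180 * (sqrt (real d) / sqrt \<epsilon> + ln (real d) / \<epsilon>)"
    using query_lower_bound \<open>0 < \<epsilon> \<and> \<epsilon> \<le> 1 / 2000\<close> by simp
qed simp_all

end
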